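(* Let $\tau>0$ and $0<\delta,\epsilon<1$. Suppose that $\psi_1,\dots,\psi_m$ are orthonormal functions in $L^2_\rho(\mathbb{X})$, that $\sum_{i=1}^m|\psi_i|^2\in L^2_\rho(\mathbb{X})$, and that for each $j\in\{1,\dots,l\}$ one has $\|\mathcal{K}_m^\tau[\phi_j]\|_{L^2_\rho(\mathbb{X})}\le L_j$ for some $L_j>0$. Then there exists a constant $c_\delta>0$ (depending only on $\delta$) such that, with $\kappa=\left\|\sum_{i=1}^m|\psi_i|^2\right\|_{L^\infty(\mathbb{X})}$, for all $n\ge c_\delta\cdot\kappa\cdot\log(m/\epsilon)$ the following holds. Let $\mathbf{x}_t^{(1)},\dots,\mathbf{x}_t^{(n)}$ be sampled i.i.d. from $\rho$, let $\mathbf{y}_t^{(i)}=\mathbf{x}_{t+\tau}^{(i)}$, and let $K_{mn}^\tau\in\mathbb{C}^{l\times m}$ be the solution of the EDMD least-squares problem $$\min_{K\in\mathbb{C}^{l\times m}}\|\Phi_n^\tau-K\Psi_n\|_F^2 .$$ Define the diagonal matrix $A\in\mathbb{R}^{l\times l}$ by $$A_{jj}=\min\left\{1,\frac{L_j}{\|\mathcal{K}_{mn}^\tau[\phi_j]\|_{L^2_\rho(\mathbb{X})}}\right\},\qquad j=1,\dots,l,$$ and set $\widetilde{K}_{mn}^\tau=AK_{mn}^\tau$. Then, with probability at least $1-l\epsilon$, $$\mathbb{E}\|\widetilde{K}_{mn}^\tau-K_m^\tau\|_F^2\le\frac1n\cdot\frac{\left\|\sum_{i=1}^m|\psi_i|^2\right\|_{L^2_\rho(\mathbb{X})}}{(1-\delta)^2}\sum_{j=1}^l\left\|\left(\mathcal{K}^\tau[\phi_j]-\mathcal{K}_m^\tau[\phi_j]\right)^2\right\|_{L^2_\rho(\mathbb{X})}+4\left(\sum_{j=1}^lL_j^2\right)\epsilon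 .$$
   Context: Let $\mathbb{X}\subseteq\mathbb{R}^d$ be the state space of a (deterministic or stochastic, discrete- or continuous-time) dynamical system with states $\mathbf{x}_t$, and let $\rho$ be a probability measure on $\mathbb{X}$. For $\tau>0$ the Koopman operator acts on observables $\varphi:\mathbb{X}\to\mathbb{C}$ by $\mathcal{K}^\tau[\varphi](\mathbf{x})=\mathbb{E}[\varphi(\mathbf{x}_{t+\tau})\mid\mathbf{x}_t=\mathbf{x}]$. Data are pairs $(\mathbf{x}_t^{(i)},\mathbf{y}_t^{(i)})$, $i=1,\dots,n$, where the $\mathbf{x}_t^{(i)}$ are i.i.d. with law $\rho$ and $\mathbf{y}_t^{(i)}=\mathbf{x}_{t+\tau}^{(i)}$ is the state reached from $\mathbf{x}_t^{(i)}$ after time $\tau$. Let $\vec\psi=(\psi_1,\dots,\psi_m)$ (expansion dictionary) and $\vec\phi=(\phi_1,\dots,\phi_l)$ (feature dictionary) consist of possibly complex-valued functions in $L^2_\rho(\mathbb{X})$; it is implicit that $\mathcal{K}^\tau[\phi_j]\in L^2_\rho(\mathbb{X})$. The EDMD (Extended Dynamic Mode Decomposition) matrices are $\Psi_n=(\psi_i(\mathbf{x}_t^{(j)}))_{i,j}\in\mathbb{C}^{m\times n}$ and $\Phi_n^\tau=(\phi_i(\mathbf{y}_t^{(j)}))_{i,j}\in\mathbb{C}^{l\times n}$. For a solution $K_{mn}^\tau\in\mathbb{C}^{l\times m}$ of $\min_K\|\Phi_n^\tau-K\Psi_n\|_F^2$ and $\varphi=\mathbf{c}\cdot\vec\phi$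 with $\mathbf{c}\in\mathbb{C}^l$, set $\mathcal{K}_{mn}^\tau[\varphi]=\mathbf{c}\cdot K_{mn}^\tau\vec\psi$ (with $\mathbf{a}\cdot\mathbf{b}=\sum_ia_ib_i$); in particular $\mathcal{K}_{mn}^\tau[\phi_j]=\sum_{i=1}^m(K_{mn}^\tau)_{ji}\psi_i$. Set $K_m^\tau=\lim_{n\to\infty}K_{mn}^\tau$ and $\mathcal{K}_m^\tau[\varphi]=\mathbf{c}\cdot K_m^\tau\vec\psi$. This is the matrix representation of the $L^2_\rho(\mathbb{X})$-orthogonal projection of the Koopman operator onto $\mathrm{span}\{\psi_1,\dots,\psi_m\}$, i.e. $\mathcal{K}_m^\tau[\phi_j]=\sum_{i=1}^m(K_m^\tau)_{ji}\psi_i$ is the orthogonal projection of $\mathcal{K}^\tau[\phi_j]$ onto that span. $\|\cdot\|_F$ is the Frobenius norm. $\mathbb{E}$ (in the error bound) is the expectation with respect to the random draw of the data. If $\|\mathcal{K}_{mn}^\tau[\phi_j]\|_{L^2_\rho(\mathbb{X})}=0$, the minimum defining $A_{jj}$ is $1$.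
   Formalization: Added assumption: almost surely φ_j(y_t) = K^τ[φ_j](x_t) for each j (automatic for deterministic systems). Without it the bound fails for stochastic systems, since the right side has no term for the conditional variance of φ_j(y_t) given x_t. *)

theory Defs
  imports "HOL-Probability.Probability" "Jordan_Normal_Form.Matrix"
begin

text \<open>States are points of \<open>\<real>\<^sup>d\<close>, represented as extensional functions on \<open>{..<d}\<close>, so that the
  dimension \<open>d\<close> is an ordinary variable: a constant chosen before \<open>d\<close> is quantified
  does not depend on \<open>d\<close>. The product sigma-algebra is the Borel sigma-algebra of \<open>\<real>\<^sup>d\<close>.\<close>

type_synonym state = "nat \<Rightarrow> real"

definition state_space :: "nat \<Rightarrow> state set \<Rightarrow> state measure" where
  "state_space d X = restrict_space (\<Pi>\<^sub>M i\<in>{..<d}. borel) X"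


subsection \<open>The spaces \<open>L\<^sup>2\<close> and \<open>L\<^sup>\<infinity>\<close>\<close>

text \<open>The norm takes the value \<open>\<infinity>\<close> outside \<open>L\<^sup>2\<close>, e.g. at the square of an \<open>L\<^sup>2\<close> function
  that is not in \<open>L\<^sup>4\<close>.\<close>

definition L2_norm :: "'a measure \<Rightarrow> ('a \<Rightarrow> 'b::real_normed_vector) \<Rightarrow> ennreal" where
  "L2_norm M f =
     (let I = (\<integral>\<^sup>+x. ennreal ((norm (f x))\<^sup>2) \<partial>M)
      in if I = \<infinity> then \<infinity> else ennreal (sqrt (enn2real I)))"

definition in_L2 :: "'a measure \<Rightarrow> ('a \<Rightarrow> 'b::real_normed_vector) \<Rightarrow> bool" where
  "in_L2 M f \<longleftrightarrow> f \<in> borel_measurable M \<and> L2_norm M f < \<infinity>"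

definition L2_inner :: "'a measure \<Rightarrow> ('a \<Rightarrow> complex) \<Rightarrow> ('a \<Rightarrow> complex) \<Rightarrow> complex" where
  "L2_inner M f g = (\<integral>x. f x * cnj (g x) \<partial>M)"

definition Linf_norm :: "'a measure \<Rightarrow> ('a \<Rightarrow> 'b::real_normed_vector) \<Rightarrow> ennreal" where
  "Linf_norm M f = esssup M (\<lambda>x. ennreal (norm (f x)))"

definition L2_orthonormal :: "'a measure \<Rightarrow> nat \<Rightarrow> (nat \<Rightarrow> 'a \<Rightarrow> complex) \<Rightarrow> bool" where
  "L2_orthonormal M m \<psi> \<longleftrightarrow>
     (\<forall>i<m. in_L2 M (\<psi> i)) \<and>
     (\<forall>i<m. \<forall>j<m. L2_inner M (\<psi> i) (\<psi> j) = (if i = j then 1 else 0))"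

definition function_span :: "nat \<Rightarrow> (nat \<Rightarrow> 'a \<Rightarrow> complex) \<Rightarrow> ('a \<Rightarrow> complex) set" where
  "function_span m \<psi> = {h. \<exists>a. h = (\<lambda>x. \<Sum>i<m. a i * \<psi> i x)}"

definition is_L2_projection ::
  "'a measure \<Rightarrow> ('a \<Rightarrow> complex) set \<Rightarrow> ('a \<Rightarrow> complex) \<Rightarrow> ('a \<Rightarrow> complex) \<Rightarrow> bool" where
  "is_L2_projection M V f g \<longleftrightarrow> g \<in> V \<and> (\<forall>h\<in>V. L2_inner M (\<lambda>x. f x - g x) h = 0)"

definition sum_sq :: "nat \<Rightarrow> (nat \<Rightarrow> 'a \<Rightarrow> complex) \<Rightarrow> 'a \<Rightarrow> real" where
  "sum_sq m \<psi> x = (\<Sum>i<m. (cmod (\<psi> i x))\<^sup>2)"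


subsection \<open>Koopman operator and data\<close>

text \<open>\<open>P \<tau> x\<close> is the law of \<open>x\<^sub>t\<^sub>+\<^sub>\<tau>\<close> conditional on \<open>x\<^sub>t = x\<close>. A deterministic
  system with flow \<open>F\<close> has \<open>P \<tau> x = return (state_space d X) (F \<tau> x)\<close>.\<close>

definition koopman ::
  "(real \<Rightarrow> 'a \<Rightarrow> 'a measure) \<Rightarrow> real \<Rightarrow> ('a \<Rightarrow> complex) \<Rightarrow> 'a \<Rightarrow> complex" where
  "koopman P \<tau> f x = (\<integral>y. f y \<partial>(P \<tau> x))"

definition pair_law ::
  "'a measure \<Rightarrow> (real \<Rightarrow> 'a \<Rightarrow> 'a measure) \<Rightarrow> real \<Rightarrow> ('a \<times> 'a) measure" where
  "pair_law \<rho> P \<tau> =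
     \<rho> \<bind> (\<lambda>x. P \<tau> x \<bind> (\<lambda>y. return (\<rho> \<Otimes>\<^sub>M \<rho>) (x, y)))"

text \<open>Law of \<open>n\<close> i.i.d. snapshot pairs; in a sample \<open>\<omega>\<close> the \<open>i\<close>-th pair is
  \<open>(x\<^sup>(\<^sup>i\<^sup>), y\<^sup>(\<^sup>i\<^sup>)) = \<omega> i\<close>. Snapshots and dictionary entries are indexed from 0.\<close>

definition data_law ::
  "'a measure \<Rightarrow> (real \<Rightarrow> 'a \<Rightarrow> 'a measure) \<Rightarrow> real \<Rightarrow> nat \<Rightarrow> (nat \<Rightarrow> 'a \<times> 'a) measure" where
  "data_law \<rho> P \<tau> n = (\<Pi>\<^sub>M i\<in>{..<n}. pair_law \<rho> P \<tau>)"

text \<open>The recorded values of \<open>f\<close> at the endpoints carry no noise given the initial points.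
  Deterministic systems satisfy this for every \<open>f\<close> (see below).\<close>

definition noise_free ::
  "'a measure \<Rightarrow> (real \<Rightarrow> 'a \<Rightarrow> 'a measure) \<Rightarrow> real \<Rightarrow> ('a \<Rightarrow> complex) \<Rightarrow> bool" where
  "noise_free \<rho> P \<tau> f \<longleftrightarrow> (AE x in \<rho>. AE y in P \<tau> x. f y = koopman P \<tau> f x)"

lemma noise_free_deterministic:
  assumes "sets \<rho> = sets S" and "F \<in> S \<rightarrow>\<^sub>M S"
    and "\<And>x. x \<in> space S \<Longrightarrow> P \<tau> x = return S (F x)"
    and f: "f \<in> borel_measurable S"
  shows "noise_free \<rho> P \<tau> f"
  unfolding noise_free_def
proof (rule AE_I2)
  fix x assume "x \<in> space \<rho>"
  then have x: "x \<in> space S"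
    using sets_eq_imp_space_eq[OF assms(1)] by simp
  then have Fx: "F x \<in> space S"
    using assms(2) by (rule measurable_space[rotated])
  have "koopman P \<tau> f x = f (F x)"
    using f Fx by (simp add: koopman_def assms(3)[OF x] integral_return)
  moreover have "Measurable.pred S (\<lambda>y. f y = f (F x))"
    using f by measurable
  then have "AE y in return S (F x). f y = f (F x)"
    using AE_return[OF Fx] by blast
  ultimately show "AE y in P \<tau> x. f y = koopman P \<tau> f x"
    unfolding assms(3)[OF x] by simp
qed


subsection \<open>EDMD\<close>

definition frobenius_norm :: "complex mat \<Rightarrow> real" where
  "frobenius_norm A = sqrt (\<Sum>i<dim_row A. \<Sum>j<dim_col A. (cmod (A $$ (i, j)))\<^sup>2)"

definition Psi_mat ::
  "nat \<Rightarrow> (nat \<Rightarrow> 'a \<Rightarrow> complex) \<Rightarrow> nat \<Rightarrow> (nat \<Rightarrow> 'a \<times> 'a) \<Rightarrow> complex mat" where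
  "Psi_mat m \<psi> n \<omega> = Matrix.mat m n (\<lambda>(i, j). \<psi> i (fst (\<omega> j)))"

definition Phi_mat ::
  "nat \<Rightarrow> (nat \<Rightarrow> 'a \<Rightarrow> complex) \<Rightarrow> nat \<Rightarrow> (nat \<Rightarrow> 'a \<times> 'a) \<Rightarrow> complex mat" where
  "Phi_mat l \<phi> n \<omega> = Matrix.mat l n (\<lambda>(i, j). \<phi> i (snd (\<omega> j)))"

definition is_edmd_solution :: "complex mat \<Rightarrow> complex mat \<Rightarrow> complex mat \<Rightarrow> bool" where
  "is_edmd_solution \<Phi> \<Psi> K \<longleftrightarrow>
     K \<in> carrier_mat (dim_row \<Phi>) (dim_row \<Psi>) \<and>
     (\<forall>K' \<in> carrier_mat (dim_row \<Phi>) (dim_row \<Psi>).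
        (frobenius_norm (\<Phi> - K * \<Psi>))\<^sup>2 \<le> (frobenius_norm (\<Phi> - K' * \<Psi>))\<^sup>2)"

text \<open>The image of \<open>\<phi>\<^sub>j\<close> under the operator that the matrix \<open>K\<close> induces.\<close>

definition mat_koopman ::
  "nat \<Rightarrow> (nat \<Rightarrow> 'a \<Rightarrow> complex) \<Rightarrow> complex mat \<Rightarrow> nat \<Rightarrow> 'a \<Rightarrow> complex" where
  "mat_koopman m \<psi> K j x = (\<Sum>i<m. K $$ (j, i) * \<psi> i x)"

definition is_projected_koopman_mat ::
  "'a measure \<Rightarrow> (real \<Rightarrow> 'a \<Rightarrow> 'a measure) \<Rightarrow> real \<Rightarrow> nat \<Rightarrow> (nat \<Rightarrow> 'a \<Rightarrow> complex) \<Rightarrow>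
    nat \<Rightarrow> (nat \<Rightarrow> 'a \<Rightarrow> complex) \<Rightarrow> complex mat \<Rightarrow> bool" where
  "is_projected_koopman_mat \<rho> P \<tau> m \<psi> l \<phi> K \<longleftrightarrow>
     K \<in> carrier_mat l m \<and>
     (\<forall>j<l. is_L2_projection \<rho> (function_span m \<psi>)
              (koopman P \<tau> (\<phi> j)) (mat_koopman m \<psi> K j))"

text \<open>In \<open>ennreal\<close>, \<open>L / 0 = \<infinity>\<close> for \<open>L > 0\<close>, so a zero norm gives the diagonal entry 1.\<close>

definition truncation_mat ::
  "'a measure \<Rightarrow> nat \<Rightarrow> (nat \<Rightarrow> 'a \<Rightarrow> complex) \<Rightarrow> nat \<Rightarrow> (nat \<Rightarrow> real) \<Rightarrow> complex mat \<Rightarrow> complex mat"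
  where
  "truncation_mat \<rho> m \<psi> l L K = Matrix.mat l l (\<lambda>(i, j).
     if i = j
     then complex_of_real (enn2real (min 1 (ennreal (L j) / L2_norm \<rho> (mat_koopman m \<psi> K j))))
     else 0)"

end

theory Submission
  imports Defs
begin

text \<open>Let \<open>v\<^sub>k = \<psi>(x\<^sub>k)\<close>. On the event that the empirical Gram matrix \<open>\<Sum>\<^sub>k v\<^sub>k v\<^sub>k\<^sup>*\<close> is at least
  \<open>(1 - \<delta>) n\<close>, the normal equations bound the error of row \<open>j\<close> by
  \<open>\<parallel>\<Sum>\<^sub>k r\<^sub>j(x\<^sub>k) v\<^sub>k\<^sup>*\<parallel> / ((1 - \<delta>) n)\<close>, where \<open>r\<^sub>j\<close> is the projection residual. The summands are
  i.i.d. and centred because \<open>r\<^sub>j\<close> is orthogonal to the dictionary, so the second moment is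
  \<open>n \<integral>|r\<^sub>j|\<^sup>2 |\<psi>|\<^sup>2\<close>, and Cauchy-Schwarz gives the first term of the bound. Off this event
  truncation keeps the squared error below \<open>4 L\<^sub>j\<^sup>2\<close>.

  The event fails with probability at most \<open>\<epsilon>\<close>. Instead of a matrix Chernoff bound through matrix
  exponentials, this uses the trace moments of \<open>Z = \<Sum>\<^sub>k Y\<^sub>k\<close> with \<open>Y\<^sub>k = 1 - v\<^sub>k v\<^sub>k\<^sup>*\<close>: since \<open>Y\<^sub>k\<close> is
  centred and independent of \<open>W\<^sub>k = Z - Y\<^sub>k\<close>, the expectation of \<open>tr Z\<^sup>2\<^sup>q\<^sup>+\<^sup>2\<close> equals the sum over \<open>k\<close> of
  the expectations of \<open>tr Y\<^sub>k (Z\<^sup>2\<^sup>q\<^sup>+\<^sup>1 - W\<^sub>k\<^sup>2\<^sup>q\<^sup>+\<^sup>1)\<close>. Telescoping the difference bounds each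
  moment by the preceding one, and Markov's inequality is applied to a moment of order
  \<open>log (m / \<epsilon>)\<close>.

  The integral in the claim does not depend on the outer sample, so its event has probability
  \<open>0\<close> or \<open>1\<close>, and the inequality holds surely.\<close>


subsection \<open>Matrices as functions\<close>

text \<open>An \<open>m \<times> m\<close> matrix is a function of two indices, so that sums of matrices are plain pointwise
  sums. Products only read indices below \<open>m\<close>; \<open>fone\<close> is therefore neutral only for matrices
  that vanish outside this range (\<open>supported\<close>).\<close>

type_synonym fmat = "nat \<Rightarrow> nat \<Rightarrow> complex"

context
  fixes m :: nat
begin

definition fmult :: "fmat \<Rightarrow> fmat \<Rightarrow> fmat"  (infixl "\<diamondop>" 70)
  where "A \<diamondop> B = (\<lambda>i j. \<Sum>k<m. A i k * B k j)"

definition fone :: fmat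
  where "fone = (\<lambda>i j. if i < m \<and> i = j then 1 else 0)"

primrec fpow :: "fmat \<Rightarrow> nat \<Rightarrow> fmat" where
  "fpow A 0 = fone"
| "fpow A (Suc k) = fpow A k \<diamondop> A"

definition ftrace :: "fmat \<Rightarrow> complex"
  where "ftrace A = (\<Sum>i<m. A i i)"

definition fadj :: "fmat \<Rightarrow> fmat"
  where "fadj A = (\<lambda>i j. cnj (A j i))"

text \<open>The squared Hilbert-Schmidt norm. For self-adjoint \<open>Z\<close>,
  \<open>fnorm2 (fpow Z q)\<close> is the trace of the power 2q of \<open>Z\<close>, so even trace
  moments can be handled as squared norms.\<close>

definition fnorm2 :: "fmat \<Rightarrow> real"
  where "fnorm2 A = (\<Sum>i<m. \<Sum>j<m. (cmod (A i j))\<^sup>2)"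

definition supported :: "fmat \<Rightarrow> bool"
  where "supported A \<longleftrightarrow> (\<forall>i j. A i j \<noteq> 0 \<longrightarrow> i < m \<and> j < m)"

section \<open>Algebra of products, powers, adjoints and traces\<close>

lemma fmult_assoc: "A \<diamondop> B \<diamondop> C = A \<diamondop> (B \<diamondop> C)"
  unfolding fmult_def
  by (intro ext, simp add: sum_distrib_left sum_distrib_right mult.assoc, rule sum.swap)

lemma fmult_sum_left: "(\<lambda>i j. \<Sum>k\<in>I. F k i j) \<diamondop> B = (\<lambda>i j. \<Sum>k\<in>I. (F k \<diamondop> B) i j)"
  unfolding fmult_def by (intro ext, simp add: sum_distrib_right, rule sum.swap)

lemma fmult_add_left: "(\<lambda>i j. A i j + B i j) \<diamondop> C = (\<lambda>i j. (A \<diamondop> C) i j + (B \<diamondop> C) i j)"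
  unfolding fmult_def by (simp add: ring_distribs sum.distrib)

lemma fmult_add_right: "C \<diamondop> (\<lambda>i j. A i j + B i j) = (\<lambda>i j. (C \<diamondop> A) i j + (C \<diamondop> B) i j)"
  unfolding fmult_def by (simp add: ring_distribs sum.distrib)

lemma fmult_one_right: "supported A \<Longrightarrow> A \<diamondop> fone = A"
  unfolding fmult_def fone_def supported_def
  by (intro ext) (auto simp: if_distrib[of "\<lambda>x. _ * x"] cong: if_cong)

lemma fmult_one_left: "supported A \<Longrightarrow> fone \<diamondop> A = A"
proof (intro ext)
  fix i j assume "supported A"
  then show "(fone \<diamondop> A) i j = A i j"
    unfolding fmult_def fone_def supported_def
    by (cases "i < m") (auto simp: if_distrib[of "\<lambda>x. x * _"] cong: if_cong)
qed

lemma supported_fone: "supported fone"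
  by (auto simp: supported_def fone_def split: if_splits)

lemma supported_fmult:
  assumes "supported A" "supported B" shows "supported (A \<diamondop> B)"
  unfolding supported_def
proof (intro allI impI)
  fix i j assume "(A \<diamondop> B) i j \<noteq> 0"
  then obtain k where "A i k * B k j \<noteq> 0"
    unfolding fmult_def by (meson sum.not_neutral_contains_not_neutral)
  then show "i < m \<and> j < m" using assms unfolding supported_def by auto
qed

lemma supported_fpow: "supported A \<Longrightarrow> supported (fpow A k)"
  by (induction k) (auto intro: supported_fone supported_fmult)

lemma fpow_add: "supported A \<Longrightarrow> fpow A (a + b) = fpow A a \<diamondop> fpow A b"
  by (induction b) (simp_all add: fmult_one_right supported_fpow fmult_assoc)

lemma fpow_1: "supported A \<Longrightarrow> fpow A 1 = A"
  by (simp add: fmult_one_left)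

lemma fpow_Suc_left: "supported A \<Longrightarrow> fpow A (Suc k) = A \<diamondop> fpow A k"
  using fpow_add[of A 1 k] by (simp add: fmult_one_left)

lemma fadj_fmult: "fadj (A \<diamondop> B) = fadj B \<diamondop> fadj A"
  unfolding fadj_def fmult_def by (simp add: mult.commute)

lemma fadj_fone: "fadj fone = fone"
  unfolding fadj_def fone_def by (intro ext) auto

lemma fadj_fpow:
  assumes "supported A" "fadj A = A" shows "fadj (fpow A k) = fpow A k"
  by (induction k) (use assms in \<open>auto simp: fadj_fone fadj_fmult fpow_Suc_left simp del: fpow.simps(2)\<close>,
     metis fadj_fmult fpow.simps(2) fpow_Suc_left)

lemma ftrace_comm: "ftrace (A \<diamondop> B) = ftrace (B \<diamondop> A)"
  unfolding ftrace_def fmult_def by (subst sum.swap) (simp add: mult.commute)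

lemma ftrace_sum: "ftrace (\<lambda>i j. \<Sum>k\<in>I. F k i j) = (\<Sum>k\<in>I. ftrace (F k))"
  unfolding ftrace_def by (rule sum.swap)

lemma ftrace_add: "ftrace (\<lambda>i j. A i j + B i j) = ftrace A + ftrace B"
  unfolding ftrace_def by (simp add: sum.distrib)

section \<open>Hilbert-Schmidt norm and trace pairing\<close>

lemma fnorm2_nonneg: "0 \<le> fnorm2 A"
  unfolding fnorm2_def by (intro sum_nonneg) auto

lemma fnorm2_fadj: "fnorm2 (fadj A) = fnorm2 A"
  unfolding fnorm2_def fadj_def by (subst sum.swap) simp

lemma ftrace_fadj_self: "ftrace (A \<diamondop> fadj A) = complex_of_real (fnorm2 A)"
  unfolding ftrace_def fmult_def fadj_def fnorm2_def
  by (simp add: complex_norm_square mult.commute del: of_real_power)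

text \<open>Young's inequality, entry by entry. The weight stays free: 1 serves for the convexity of
  mixed traces, while the moment recursion takes \<open>1 / D\<close> in order to absorb the higher
  moment.\<close>

lemma cmod_ftrace_fadj_le:
  assumes "0 < s"
  shows "cmod (ftrace (A \<diamondop> fadj B)) \<le> (s * fnorm2 A + fnorm2 B / s) / 2"
proof -
  have amgm: "cmod (x * cnj y) \<le> (s * (cmod x)\<^sup>2 + (cmod y)\<^sup>2 / s) / 2" for x y
  proof -
    have "0 \<le> (s * cmod x - cmod y)\<^sup>2 / s" using assms by simp
    then show ?thesis using assms by (simp add: norm_mult power2_eq_square field_simps)
  qed
  have "cmod (ftrace (A \<diamondop> fadj B)) \<le> (\<Sum>i<m. \<Sum>j<m. cmod (A i j * cnj (B i j)))"
    unfolding ftrace_def fmult_def fadj_def by (intro order.trans[OF norm_sum] sum_mono norm_sum)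
  also have "\<dots> \<le> (\<Sum>i<m. \<Sum>j<m. (s * (cmod (A i j))\<^sup>2 + (cmod (B i j))\<^sup>2 / s) / 2)"
    by (intro sum_mono amgm)
  also have "\<dots> = (s * fnorm2 A + fnorm2 B / s) / 2"
    unfolding fnorm2_def
    by (simp add: sum.distrib sum_distrib_left add_divide_distrib flip: sum_divide_distrib)
  finally show ?thesis .
qed

section \<open>Perturbation of powers: telescoping and mixed traces\<close>

lemma fpow_telescope:
  assumes Y: "supported Y" and Z: "Z = (\<lambda>i j. W i j + Y i j)"
  shows "fpow Z q = (\<lambda>i j. fpow W q i j + (\<Sum>a<q. (fpow Z a \<diamondop> Y \<diamondop> fpow W (q - 1 - a)) i j))"
proof (induction q)
  case (Suc q)
  \<comment> \<open>The new last factor is split as W + Y. Its W part lengthens every old term by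
    one power of W; its Y part is the new term a = q.\<close>
  have "fpow Z (Suc q) = fpow Z q \<diamondop> (\<lambda>i j. W i j + Y i j)" using Z by simp
  also have "\<dots> = (\<lambda>i j. (fpow Z q \<diamondop> W) i j + (fpow Z q \<diamondop> Y) i j)"
    by (rule fmult_add_right)
  also have "fpow Z q \<diamondop> W
      = (\<lambda>i j. fpow W (Suc q) i j + (\<Sum>a<q. (fpow Z a \<diamondop> Y \<diamondop> fpow W (Suc q - 1 - a)) i j))"
  proof -
    have "fpow Z q \<diamondop> W = (\<lambda>i j. fpow W (Suc q) i j
        + (\<Sum>a<q. (fpow Z a \<diamondop> Y \<diamondop> fpow W (q - 1 - a) \<diamondop> W) i j))"
      by (subst Suc.IH) (simp add: fmult_add_left fmult_sum_left)
    moreover have "fpow Z a \<diamondop> Y \<diamondop> fpow W (q - 1 - a) \<diamondop> W = fpow Z a \<diamondop> Y \<diamondop> fpow W (Suc q - 1 - a)"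
      if "a < q" for a
    proof -
      have "Suc q - 1 - a = Suc (q - 1 - a)" using that by simp
      then show ?thesis by (simp add: fmult_assoc)
    qed
    ultimately show ?thesis by simp
  qed
  finally show ?case
    using Y by (simp add: fmult_assoc fmult_one_right add.assoc)
qed simp

text \<open>A discrete maximum principle: an interior maximum, taken at its leftmost position, has a
  strictly smaller left neighbour, and convexity at that position forbids this.\<close>

lemma discrete_convex_le:
  fixes e :: "nat \<Rightarrow> real"
  assumes conv: "\<And>s. 0 < s \<Longrightarrow> s < q \<Longrightarrow> 2 * e s \<le> e (s - 1) + e (s + 1)"
    and "s \<le> q"
  shows "e s \<le> max (e 0) (e q)"
proof (rule ccontr)
  assume contra: "\<not> ?thesis"
  define M where "M = Max (e ` {0..q})"
  have le: "e t \<le> M" if "t \<le> q" for t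
    unfolding M_def using that by (intro Max_ge) auto
  have "M \<in> e ` {0..q}" unfolding M_def by (intro Max_in) auto
  then have ex: "\<exists>t. t \<le> q \<and> e t = M" by auto
  define t where "t = (LEAST t. t \<le> q \<and> e t = M)"
  have t: "t \<le> q" "e t = M" using LeastI_ex[OF ex] unfolding t_def by auto
  have "M > e 0" "M > e q" using contra le[OF \<open>s \<le> q\<close>] by auto
  then have "0 < t" "t < q" using t by (metis gr0I less_irrefl, metis le_neq_implies_less less_irrefl)
  then have "e (t - 1) \<noteq> M"
    using not_less_Least[of "t - 1" "\<lambda>t. t \<le> q \<and> e t = M"] unfolding t_def by auto
  then have "e (t - 1) < M" using le[of "t - 1"] t by (simp add: less_le)
  moreover have "e (t + 1) \<le> M" using le \<open>t < q\<close> by simp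
  ultimately show False using conv[OF \<open>0 < t\<close> \<open>t < q\<close>] t by simp
qed

text \<open>The squared Hilbert-Schmidt norms of \<open>Z\<^sup>s Y W\<^sup>q\<^sup>-\<^sup>s\<close> form a convex sequence in \<open>s\<close>, so
  each mixed trace is controlled by the two extreme ones.\<close>

lemma cmod_mixed_trace_le:
  assumes Y: "supported Y" "fadj Y = Y" and W: "supported W" "fadj W = W"
    and Z: "supported Z" "fadj Z = Z" and a: "a \<le> 2 * q"
  shows "cmod (ftrace (Y \<diamondop> (fpow Z a \<diamondop> Y \<diamondop> fpow W (2 * q - a))))
    \<le> fnorm2 (Y \<diamondop> fpow W q) + fnorm2 (fpow Z q \<diamondop> Y)"
proof -
  define X where "X s = fpow Z s \<diamondop> Y \<diamondop> fpow W (q - s)" for s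
  define e where "e s = fnorm2 (X s)" for s
  \<comment> \<open>Moving \<open>fpow Z t\<close> and then Y around the trace shows that the
    pairing of \<open>X s\<close> with \<open>X t\<close> depends only on
    \<open>s + t\<close>.\<close>
  have tr: "ftrace (X s \<diamondop> fadj (X t)) = ftrace (Y \<diamondop> (fpow Z (s + t) \<diamondop> Y \<diamondop> fpow W (2 * q - (s + t))))"
    if "s \<le> q" "t \<le> q" for s t
  proof -
    have "X s \<diamondop> fadj (X t)
        = (fpow Z s \<diamondop> Y \<diamondop> (fpow W (q - s) \<diamondop> fpow W (q - t)) \<diamondop> Y) \<diamondop> fpow Z t"
      unfolding X_def using Y W Z by (simp add: fadj_fmult fadj_fpow fmult_assoc)
    also have "fpow W (q - s) \<diamondop> fpow W (q - t) = fpow W (2 * q - (s + t))"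
      using that W by (subst fpow_add[symmetric]) (auto intro!: arg_cong[of _ _ "fpow W"])
    finally have "ftrace (X s \<diamondop> fadj (X t))
        = ftrace (fpow Z t \<diamondop> (fpow Z s \<diamondop> Y \<diamondop> fpow W (2 * q - (s + t)) \<diamondop> Y))"
      by (simp add: ftrace_comm)
    also have "fpow Z t \<diamondop> (fpow Z s \<diamondop> Y \<diamondop> fpow W (2 * q - (s + t)) \<diamondop> Y)
        = (fpow Z (s + t) \<diamondop> Y \<diamondop> fpow W (2 * q - (s + t))) \<diamondop> Y"
      using Z by (simp add: add.commute[of s] fpow_add fmult_assoc)
    finally show ?thesis by (simp add: ftrace_comm)
  qed
  have pair: "cmod (ftrace (Y \<diamondop> (fpow Z (s + t) \<diamondop> Y \<diamondop> fpow W (2 * q - (s + t))))) \<le> (e s + e t) / 2"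
    if "s \<le> q" "t \<le> q" for s t
    using cmod_ftrace_fadj_le[of 1 "X s" "X t"] unfolding tr[OF that] e_def by simp
  have conv: "2 * e s \<le> e (s - 1) + e (s + 1)" if "0 < s" "s < q" for s
  proof -
    have diag: "cmod (ftrace (X s \<diamondop> fadj (X s))) = e s"
      unfolding ftrace_fadj_self e_def using fnorm2_nonneg by simp
    \<comment> \<open>Hence the squared norm of \<open>X s\<close> is also the pairing of its two
      neighbours, and Young's inequality with weight 1 gives convexity.\<close>
    have "(s - 1) + (s + 1) = s + s" using that by simp
    then have "cmod (ftrace (X s \<diamondop> fadj (X s))) \<le> (e (s - 1) + e (s + 1)) / 2"
      using pair[of "s - 1" "s + 1"] that unfolding tr[OF less_imp_le less_imp_le, OF that(2) that(2)]
      by (simp only:)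
    then show ?thesis unfolding diag by simp
  qed
  have e_le: "e s \<le> e 0 + e q" if "s \<le> q" for s
  proof -
    have "e s \<le> max (e 0) (e q)" by (rule discrete_convex_le) (use conv that in auto)
    moreover have "0 \<le> e 0" "0 \<le> e q" unfolding e_def by (auto intro: fnorm2_nonneg)
    ultimately show ?thesis by simp
  qed
  \<comment> \<open>Since \<open>a\<close> is at most 2q, both halves are at most q, so the mixed
    trace is a pairing of two members of the sequence.\<close>
  define b c where "b = a div 2" and "c = a - a div 2"
  have bc: "b + c = a" "b \<le> q" "c \<le> q" using a unfolding b_def c_def by auto
  then have "cmod (ftrace (Y \<diamondop> (fpow Z a \<diamondop> Y \<diamondop> fpow W (2 * q - a)))) \<le> (e b + e c) / 2"
    using pair[OF bc(2,3)] bc(1) by simp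
  also have "\<dots> \<le> e 0 + e q" using e_le[OF bc(2)] e_le[OF bc(3)] by simp
  also have "e 0 = fnorm2 (Y \<diamondop> fpow W q)" unfolding e_def X_def using Y by (simp add: fmult_one_left)
  also have "e q = fnorm2 (fpow Z q \<diamondop> Y)"
    unfolding e_def X_def using Y Z by (simp add: fmult_one_right supported_fmult supported_fpow)
  finally show ?thesis .
qed

text \<open>Telescoping produces 2q + 1 mixed traces whose exponents of Z and W add up to 2q, and
  each is bounded by the two extreme terms. In the moment recursion the trace containing only W
  averages to zero, which is why the difference is the right quantity.\<close>

lemma ftrace_fpow_diff_le:
  assumes Y: "supported Y" "fadj Y = Y" and W: "supported W" "fadj W = W"
    and Z: "supported Z" "fadj Z = Z" "Z = (\<lambda>i j. W i j + Y i j)"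
  shows "cmod (ftrace (Y \<diamondop> fpow Z (2 * q + 1)) - ftrace (Y \<diamondop> fpow W (2 * q + 1)))
    \<le> real (2 * q + 1) * (fnorm2 (Y \<diamondop> fpow W q) + fnorm2 (fpow Z q \<diamondop> Y))"
proof -
  have sumr: "Y \<diamondop> (\<lambda>i j. \<Sum>k\<in>I. F k i j) = (\<lambda>i j. \<Sum>k\<in>I. (Y \<diamondop> F k) i j)" for I :: "nat set" and F
    unfolding fmult_def by (intro ext, simp add: sum_distrib_left, rule sum.swap)
  have "ftrace (Y \<diamondop> fpow Z (2 * q + 1)) = ftrace (Y \<diamondop> fpow W (2 * q + 1))
      + (\<Sum>a<2*q+1. ftrace (Y \<diamondop> (fpow Z a \<diamondop> Y \<diamondop> fpow W (2 * q + 1 - 1 - a))))"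
    unfolding fpow_telescope[OF Y(1) Z(3), of "2 * q + 1"]
    by (simp only: fmult_add_right ftrace_add sumr ftrace_sum)
  then have "cmod (ftrace (Y \<diamondop> fpow Z (2 * q + 1)) - ftrace (Y \<diamondop> fpow W (2 * q + 1)))
      = cmod (\<Sum>a<2*q+1. ftrace (Y \<diamondop> (fpow Z a \<diamondop> Y \<diamondop> fpow W (2 * q - a))))"
    by simp
  also have "\<dots> \<le> (\<Sum>a<2*q+1. fnorm2 (Y \<diamondop> fpow W q) + fnorm2 (fpow Z q \<diamondop> Y))"
    by (intro order.trans[OF norm_sum] sum_mono cmod_mixed_trace_le Y W Z(1,2)) auto
  finally show ?thesis by (simp add: add.commute)
qed

section \<open>The deviation 1 - v v^* of a rank-one matrix from the identity\<close>

definition rank_one_defect :: "(nat \<Rightarrow> complex) \<Rightarrow> fmat"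
  where "rank_one_defect v = (\<lambda>i j. if i < m \<and> j < m then (if i = j then 1 else 0) - v i * cnj (v j) else 0)"

lemma supported_rank_one_defect: "supported (rank_one_defect v)"
  by (auto simp: supported_def rank_one_defect_def)

lemma fadj_rank_one_defect: "fadj (rank_one_defect v) = rank_one_defect v"
  by (intro ext) (auto simp: fadj_def rank_one_defect_def)

lemma vec_rank_one_defect:
  "j < m \<Longrightarrow> (\<Sum>i<m. r i * rank_one_defect v i j) = r j - (\<Sum>i<m. r i * v i) * cnj (v j)"
  unfolding rank_one_defect_def
  by (auto simp: ring_distribs sum_subtractf sum_distrib_right if_distrib[of "\<lambda>x. _ * x"] mult.assoc
      cong: if_cong)

text \<open>With c the product of r and v, the left side equals |r|^2 - |c|^2 (2 - |v|^2) exactly,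
  and the negative part is dropped. Keeping |c|^2 pays off later: isotropy gives it mean |r|^2, so
  the variance is linear in \<kappa> rather than quadratic.\<close>

lemma norm2_vec_rank_one_defect_le:
  assumes "(\<Sum>i<m. (cmod (v i))\<^sup>2) \<le> \<kappa>"
  shows "(\<Sum>j<m. (cmod (\<Sum>i<m. r i * rank_one_defect v i j))\<^sup>2)
    \<le> (\<Sum>i<m. (cmod (r i))\<^sup>2) + \<kappa> * (cmod (\<Sum>i<m. r i * v i))\<^sup>2"
proof -
  define c where "c = (\<Sum>i<m. r i * v i)"
  have "complex_of_real (\<Sum>j<m. (cmod (\<Sum>i<m. r i * rank_one_defect v i j))\<^sup>2)
      = (\<Sum>j<m. (r j - c * cnj (v j)) * (cnj (r j) - cnj c * v j))"
    by (simp add: vec_rank_one_defect c_def complex_norm_square del: of_real_power)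
  also have "\<dots> = (\<Sum>j<m. r j * cnj (r j)) - cnj c * (\<Sum>j<m. r j * v j)
      - c * (\<Sum>j<m. cnj (r j) * cnj (v j)) + c * cnj c * (\<Sum>j<m. v j * cnj (v j))"
    by (simp add: algebra_simps sum.distrib sum_subtractf sum_distrib_left)
  also have "(\<Sum>j<m. cnj (r j) * cnj (v j)) = cnj c" unfolding c_def by simp
  also have "(\<Sum>j<m. r j * v j) = c" unfolding c_def by simp
  also have "(\<Sum>j<m. r j * cnj (r j)) - cnj c * c - c * cnj c + c * cnj c * (\<Sum>j<m. v j * cnj (v j))
      = complex_of_real ((\<Sum>i<m. (cmod (r i))\<^sup>2) - (cmod c)\<^sup>2 * (2 - (\<Sum>i<m. (cmod (v i))\<^sup>2)))"
    by (simp add: complex_norm_square algebra_simps del: of_real_power)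
  finally have "(\<Sum>j<m. (cmod (\<Sum>i<m. r i * rank_one_defect v i j))\<^sup>2)
      = (\<Sum>i<m. (cmod (r i))\<^sup>2) - (cmod c)\<^sup>2 * (2 - (\<Sum>i<m. (cmod (v i))\<^sup>2))"
    by (simp only: of_real_eq_iff)
  also have "\<dots> \<le> (\<Sum>i<m. (cmod (r i))\<^sup>2) + (cmod c)\<^sup>2 * (\<Sum>i<m. (cmod (v i))\<^sup>2)"
    by (simp add: algebra_simps)
  also have "\<dots> \<le> (\<Sum>i<m. (cmod (r i))\<^sup>2) + \<kappa> * (cmod c)\<^sup>2"
    using mult_right_mono[OF assms, of "(cmod c)\<^sup>2"] by (simp add: mult.commute)
  finally show ?thesis unfolding c_def .
qed

lemma fnorm2_mult_rank_one_defect_le: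
  assumes "(\<Sum>i<m. (cmod (v i))\<^sup>2) \<le> \<kappa>"
  shows "fnorm2 (C \<diamondop> rank_one_defect v) \<le> fnorm2 C + \<kappa> * (\<Sum>i<m. (cmod (\<Sum>j<m. C i j * v j))\<^sup>2)"
proof -
  have "fnorm2 (C \<diamondop> rank_one_defect v)
      \<le> (\<Sum>i<m. (\<Sum>j<m. (cmod (C i j))\<^sup>2) + \<kappa> * (cmod (\<Sum>j<m. C i j * v j))\<^sup>2)"
    unfolding fnorm2_def fmult_def by (rule sum_mono) (rule norm2_vec_rank_one_defect_le[OF assms])
  then show ?thesis by (simp only: sum.distrib sum_distrib_left fnorm2_def)
qed

text \<open>Taking adjoints turns multiplication from the left into multiplication of
  \<open>fadj C\<close> from the right.\<close>

lemma fnorm2_rank_one_defect_mult_le: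
  assumes "(\<Sum>i<m. (cmod (v i))\<^sup>2) \<le> \<kappa>"
  shows "fnorm2 (rank_one_defect v \<diamondop> C) \<le> fnorm2 C + \<kappa> * (\<Sum>i<m. (cmod (\<Sum>j<m. cnj (C j i) * v j))\<^sup>2)"
proof -
  have "fnorm2 (rank_one_defect v \<diamondop> C) = fnorm2 (fadj C \<diamondop> rank_one_defect v)"
    using fnorm2_fadj[of "rank_one_defect v \<diamondop> C"] by (simp only: fadj_fmult fadj_rank_one_defect)
  also have "\<dots> \<le> fnorm2 (fadj C) + \<kappa> * (\<Sum>i<m. (cmod (\<Sum>j<m. fadj C i j * v j))\<^sup>2)"
    by (rule fnorm2_mult_rank_one_defect_le[OF assms])
  finally show ?thesis unfolding fnorm2_fadj by (simp only: fadj_def)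
qed

text \<open>Each row r of C contributes |r|^2 - |r v|^2. This exact identity converts sums of
  quadratic forms over the samples into a trace against the summed deviation, and back.\<close>

lemma ftrace_rank_one_defect:
  "ftrace (C \<diamondop> rank_one_defect v \<diamondop> fadj C)
    = complex_of_real (fnorm2 C - (\<Sum>i<m. (cmod (\<Sum>j<m. C i j * v j))\<^sup>2))"
proof -
  have row: "(\<Sum>j<m. (\<Sum>k<m. r k * rank_one_defect v k j) * cnj (r j))
      = complex_of_real ((\<Sum>j<m. (cmod (r j))\<^sup>2) - (cmod (\<Sum>j<m. r j * v j))\<^sup>2)" for r
  proof -
    define c where "c = (\<Sum>j<m. r j * v j)"
    have "(\<Sum>j<m. (\<Sum>k<m. r k * rank_one_defect v k j) * cnj (r j))
        = (\<Sum>j<m. (r j - c * cnj (v j)) * cnj (r j))"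
      by (simp add: vec_rank_one_defect c_def)
    also have "\<dots> = (\<Sum>j<m. r j * cnj (r j)) - c * cnj c"
      unfolding c_def by (simp add: ring_distribs sum_subtractf sum_distrib_left mult_ac)
    finally show ?thesis unfolding c_def by (simp add: complex_norm_square del: of_real_power)
  qed
  have "ftrace (C \<diamondop> rank_one_defect v \<diamondop> fadj C)
      = (\<Sum>i<m. \<Sum>j<m. (\<Sum>k<m. C i k * rank_one_defect v k j) * cnj (C i j))"
    by (simp add: ftrace_def fmult_def fadj_def)
  then show ?thesis unfolding row fnorm2_def by (simp add: sum_subtractf)
qed

section \<open>Power iteration for self-adjoint matrices\<close>

lemma cmod_ftrace_fadj_Cauchy_Schwarz: "(cmod (ftrace (A \<diamondop> fadj B)))\<^sup>2 \<le> fnorm2 A * fnorm2 B"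
proof -
  have "cmod (ftrace (A \<diamondop> fadj B)) \<le> (\<Sum>i<m. \<Sum>j<m. cmod (A i j) * cmod (B i j))"
    unfolding ftrace_def fmult_def fadj_def
    by (intro order.trans[OF norm_sum] sum_mono) (simp add: norm_mult)
  then have "(cmod (ftrace (A \<diamondop> fadj B)))\<^sup>2 \<le> (\<Sum>(i,j)\<in>{..<m}\<times>{..<m}. cmod (A i j) * cmod (B i j))\<^sup>2"
    by (intro power_mono) (simp_all add: sum.cartesian_product)
  also have "\<dots> = (\<Sum>p\<in>{..<m}\<times>{..<m}. cmod (A (fst p) (snd p)) * cmod (B (fst p) (snd p)))\<^sup>2"
    by (simp add: case_prod_beta)
  also have "\<dots> \<le> (\<Sum>p\<in>{..<m}\<times>{..<m}. (cmod (A (fst p) (snd p)))\<^sup>2)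
      * (\<Sum>p\<in>{..<m}\<times>{..<m}. (cmod (B (fst p) (snd p)))\<^sup>2)"
    by (rule Cauchy_Schwarz_ineq_sum)
  also have "\<dots> = fnorm2 A * fnorm2 B"
    unfolding fnorm2_def by (simp add: sum.cartesian_product case_prod_beta)
  finally show ?thesis .
qed

lemma fnorm2_fmult_le: "fnorm2 (A \<diamondop> B) \<le> fnorm2 A * fnorm2 B"
proof -
  have "(cmod (\<Sum>k<m. A i k * B k j))\<^sup>2 \<le> (\<Sum>k<m. (cmod (A i k))\<^sup>2) * (\<Sum>k<m. (cmod (B k j))\<^sup>2)" for i j
  proof -
    have "(cmod (\<Sum>k<m. A i k * B k j))\<^sup>2 \<le> (\<Sum>k<m. cmod (A i k) * cmod (B k j))\<^sup>2"
      by (intro power_mono order.trans[OF norm_sum]) (simp_all add: norm_mult)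
    then show ?thesis by (rule order.trans[OF _ Cauchy_Schwarz_ineq_sum])
  qed
  then have "fnorm2 (A \<diamondop> B)
      \<le> (\<Sum>i<m. \<Sum>j<m. (\<Sum>k<m. (cmod (A i k))\<^sup>2) * (\<Sum>k<m. (cmod (B k j))\<^sup>2))"
    unfolding fnorm2_def fmult_def by (intro sum_mono)
  also have "\<dots> = fnorm2 A * (\<Sum>j<m. \<Sum>k<m. (cmod (B k j))\<^sup>2)"
    unfolding fnorm2_def by (simp only: sum_distrib_left[symmetric] sum_distrib_right[symmetric])
  also have "(\<Sum>j<m. \<Sum>k<m. (cmod (B k j))\<^sup>2) = fnorm2 B"
    unfolding fnorm2_def by (rule sum.swap)
  finally show ?thesis .
qed

text \<open>Power iteration in place of an eigenvector: the numbers \<open>g k\<close> are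
  log-convex by Cauchy-Schwarz, so each is at least t^2 times its predecessor once this holds for
  the first pair, where it is Cauchy-Schwarz applied to the hypothesis on U. Submultiplicativity of
  the norm finally removes U.\<close>

lemma fnorm2_fpow_ge:
  assumes Z: "supported Z" "fadj Z = Z" and U: "supported U" "0 < fnorm2 U"
    and t: "0 \<le> t" "t * fnorm2 U \<le> cmod (ftrace (U \<diamondop> Z \<diamondop> fadj U))"
  shows "t ^ (2 * p) \<le> fnorm2 (fpow Z p)"
proof -
  define g where "g k = fnorm2 (U \<diamondop> fpow Z k)" for k
  have g0: "g 0 = fnorm2 U" unfolding g_def using U by (simp add: fmult_one_right)
  have gn: "0 \<le> g k" for k unfolding g_def by (rule fnorm2_nonneg)
  have step: "t\<^sup>2 * g k \<le> g (Suc k)" for k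
  proof (induction k)
    case 0
    have "(t * fnorm2 U)\<^sup>2 \<le> (cmod (ftrace (U \<diamondop> Z \<diamondop> fadj U)))\<^sup>2"
      using t U by (intro power_mono) auto
    also have "\<dots> \<le> fnorm2 (U \<diamondop> Z) * fnorm2 U" by (rule cmod_ftrace_fadj_Cauchy_Schwarz)
    also have "fnorm2 (U \<diamondop> Z) = g 1" unfolding g_def fpow_1[OF Z(1)] ..
    finally have "fnorm2 U * (t\<^sup>2 * fnorm2 U) \<le> fnorm2 U * g 1"
      by (simp add: power2_eq_square mult_ac)
    then show ?case using U g0 by simp
  next
    case (Suc k)
    \<comment> \<open>Shifting one factor Z across the adjoint writes \<open>g (Suc k)\<close> as a
      pairing of the two neighbouring iterates; this yields log-convexity.\<close>
    have "U \<diamondop> fpow Z (Suc k) \<diamondop> fadj (U \<diamondop> fpow Z (Suc k))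
        = U \<diamondop> fpow Z k \<diamondop> fadj (U \<diamondop> fpow Z (Suc (Suc k)))"
    proof -
      have "fpow Z (Suc k) \<diamondop> fpow Z (Suc k) = fpow Z k \<diamondop> fpow Z (Suc (Suc k))"
        by (simp only: fpow_add[OF Z(1), symmetric]) simp
      then have "fpow Z (Suc k) \<diamondop> (fpow Z (Suc k) \<diamondop> X) = fpow Z k \<diamondop> (fpow Z (Suc (Suc k)) \<diamondop> X)" for X
        by (simp only: fmult_assoc[symmetric])
      then show ?thesis by (simp only: fadj_fmult fadj_fpow[OF Z] fmult_assoc)
    qed
    then have "ftrace (U \<diamondop> fpow Z k \<diamondop> fadj (U \<diamondop> fpow Z (Suc (Suc k)))) = complex_of_real (g (Suc k))"
      unfolding g_def using ftrace_fadj_self[of "U \<diamondop> fpow Z (Suc k)"] by simp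
    then have sq: "(g (Suc k))\<^sup>2 \<le> g k * g (Suc (Suc k))"
      using cmod_ftrace_fadj_Cauchy_Schwarz[of "U \<diamondop> fpow Z k" "U \<diamondop> fpow Z (Suc (Suc k))"]
      unfolding g_def by (simp del: fpow.simps)
    show ?case
    proof (cases "g k = 0")
      case True
      then have "g (Suc k) = 0" using sq by simp
      then show ?thesis using gn by simp
    next
      case False
      have "g k * (t\<^sup>2 * g (Suc k)) \<le> g (Suc k) * g (Suc k)"
        using mult_right_mono[OF Suc gn[of "Suc k"]] by (simp add: mult_ac)
      also have "\<dots> \<le> g k * g (Suc (Suc k))" using sq by (simp add: power2_eq_square)
      finally show ?thesis using False gn[of k] by simp
    qed
  qed
  have "t ^ (2 * k) * fnorm2 U \<le> g k" for k
  proof (induction k)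
    case (Suc k)
    have "t ^ (2 * Suc k) * fnorm2 U = t\<^sup>2 * (t ^ (2 * k) * fnorm2 U)"
      by (simp add: power2_eq_square mult_ac)
    also have "\<dots> \<le> t\<^sup>2 * g k" using Suc by (intro mult_left_mono) auto
    finally show ?case using step[of k] by simp
  qed (simp add: g0)
  from this[of p] have "fnorm2 U * t ^ (2 * p) \<le> fnorm2 U * fnorm2 (fpow Z p)"
    using fnorm2_fmult_le[of U "fpow Z p"] unfolding g_def by (simp add: mult.commute)
  then show ?thesis using U by simp
qed

end


subsection \<open>Bounded measurable functions\<close>

lemma borel_measurable_cnj [measurable (raw)]:
  "f \<in> borel_measurable M \<Longrightarrow> (\<lambda>x. cnj (f x)) \<in> borel_measurable M"
  by (rule measurable_compose[of f M borel cnj borel])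
    (simp_all add: borel_measurable_continuous_onI continuous_intros)

text \<open>A class closed under the ring operations, so that integrability of polynomial
  expressions in the sample on a probability space follows from closure rules alone. The bound is
  demanded at every point of the space, hence it survives composition with any measurable
  map.\<close>

definition bdd_measurable :: "'a measure \<Rightarrow> ('a \<Rightarrow> 'b::real_normed_vector) \<Rightarrow> bool"
  where "bdd_measurable M f \<longleftrightarrow> f \<in> borel_measurable M \<and> (\<exists>B. \<forall>x\<in>space M. norm (f x) \<le> B)"

lemma bdd_measurableD: "bdd_measurable M f \<Longrightarrow> f \<in> borel_measurable M"
  by (simp add: bdd_measurable_def)

lemma bdd_measurable_const: "bdd_measurable M (\<lambda>_. c)"
  by (auto simp: bdd_measurable_def)

lemma bdd_measurable_add:
  fixes f g :: "'a \<Rightarrow> 'b::{real_normed_vector, second_countable_topology}"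
  assumes "bdd_measurable M f" "bdd_measurable M g"
  shows "bdd_measurable M (\<lambda>x. f x + g x)"
proof -
  obtain B C where "\<forall>x\<in>space M. norm (f x) \<le> B" "\<forall>x\<in>space M. norm (g x) \<le> C"
    using assms unfolding bdd_measurable_def by blast
  then have "\<forall>x\<in>space M. norm (f x + g x) \<le> B + C"
    by (meson norm_triangle_mono)
  then show ?thesis using assms unfolding bdd_measurable_def by (auto intro!: borel_measurable_add)
qed

lemma bdd_measurable_mult:
  fixes f g :: "'a \<Rightarrow> 'b::{real_normed_algebra, second_countable_topology}"
  assumes "bdd_measurable M f" "bdd_measurable M g"
  shows "bdd_measurable M (\<lambda>x. f x * g x)"
proof -
  obtain B C where BC: "\<forall>x\<in>space M. norm (f x) \<le> B" "\<forall>x\<in>space M. norm (g x) \<le> C"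
    using assms unfolding bdd_measurable_def by blast
  have "norm (f x * g x) \<le> B * C" if "x \<in> space M" for x
    using BC that order.trans[OF norm_ge_zero, of "f x" B]
    by (intro order.trans[OF norm_mult_ineq] mult_mono) auto
  then show ?thesis using assms unfolding bdd_measurable_def by (auto intro!: borel_measurable_times)
qed

lemma bdd_measurable_uminus:
  fixes f :: "'a \<Rightarrow> 'b::{real_normed_vector, second_countable_topology}"
  assumes "bdd_measurable M f"
  shows "bdd_measurable M (\<lambda>x. - f x)"
  using assms unfolding bdd_measurable_def by auto

lemma bdd_measurable_diff:
  fixes f g :: "'a \<Rightarrow> 'b::{real_normed_vector, second_countable_topology}"
  assumes "bdd_measurable M f" "bdd_measurable M g"
  shows "bdd_measurable M (\<lambda>x. f x - g x)"
  using bdd_measurable_add[OF assms(1) bdd_measurable_uminus[OF assms(2)]] by simp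

lemma bdd_measurable_sum:
  fixes f :: "'i \<Rightarrow> 'a \<Rightarrow> 'b::{real_normed_vector, second_countable_topology}"
  assumes "\<And>i. i \<in> I \<Longrightarrow> bdd_measurable M (f i)"
  shows "bdd_measurable M (\<lambda>x. \<Sum>i\<in>I. f i x)"
  using assms by (induction I rule: infinite_finite_induct)
    (simp_all add: bdd_measurable_const bdd_measurable_add)

lemma bdd_measurable_cnj: "bdd_measurable M f \<Longrightarrow> bdd_measurable M (\<lambda>x. cnj (f x))"
  unfolding bdd_measurable_def by (auto intro: borel_measurable_cnj)

lemma bdd_measurable_Re: "bdd_measurable M f \<Longrightarrow> bdd_measurable M (\<lambda>x. Re (f x))"
  unfolding bdd_measurable_def by (auto intro: order.trans[OF abs_Re_le_cmod])

lemma bdd_measurable_norm: "bdd_measurable M f \<Longrightarrow> bdd_measurable M (\<lambda>x. norm (f x))"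
  unfolding bdd_measurable_def by auto

lemma bdd_measurable_power:
  fixes f :: "'a \<Rightarrow> 'b::{real_normed_algebra_1, second_countable_topology}"
  shows "bdd_measurable M f \<Longrightarrow> bdd_measurable M (\<lambda>x. f x ^ k)"
  by (induction k) (simp_all add: bdd_measurable_const bdd_measurable_mult)

lemma bdd_measurable_compose:
  assumes "g \<in> measurable M N" "bdd_measurable N f"
  shows "bdd_measurable M (\<lambda>x. f (g x))"
  using assms measurable_compose[OF assms(1), of f borel] measurable_space[OF assms(1)]
  unfolding bdd_measurable_def by blast

lemma bdd_measurable_integrable:
  fixes f :: "'a \<Rightarrow> 'b::{banach, second_countable_topology}"
  assumes "prob_space M" "bdd_measurable M f" shows "integrable M f"
proof -
  interpret prob_space M by fact
  obtain B where "\<forall>x\<in>space M. norm (f x) \<le> B" using assms unfolding bdd_measurable_def by blast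
  then show ?thesis
    using assms unfolding bdd_measurable_def by (intro integrable_const_bound[of _ B]) auto
qed

lemmas bdd_measurable_intros = bdd_measurable_const bdd_measurable_add bdd_measurable_mult
  bdd_measurable_diff bdd_measurable_sum bdd_measurable_cnj bdd_measurable_Re bdd_measurable_norm
  bdd_measurable_power

lemma bdd_measurable_fmult:
  assumes "\<And>i j. bdd_measurable M (\<lambda>\<omega>. A \<omega> i j)" "\<And>i j. bdd_measurable M (\<lambda>\<omega>. B \<omega> i j)"
  shows "bdd_measurable M (\<lambda>\<omega>. fmult m (A \<omega>) (B \<omega>) i j)"
  unfolding fmult_def by (intro bdd_measurable_intros assms)

lemma bdd_measurable_fpow:
  assumes "\<And>i j. bdd_measurable M (\<lambda>\<omega>. A \<omega> i j)"
  shows "bdd_measurable M (\<lambda>\<omega>. fpow m (A \<omega>) k i j)"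
  by (induction k arbitrary: i j)
    (auto intro!: bdd_measurable_const bdd_measurable_fmult assms)

lemma bdd_measurable_ftrace:
  assumes "\<And>i j. bdd_measurable M (\<lambda>\<omega>. A \<omega> i j)"
  shows "bdd_measurable M (\<lambda>\<omega>. ftrace m (A \<omega>))"
  unfolding ftrace_def by (intro bdd_measurable_intros assms)

lemma bdd_measurable_fnorm2:
  assumes "\<And>i j. bdd_measurable M (\<lambda>\<omega>. A \<omega> i j)"
  shows "bdd_measurable M (\<lambda>\<omega>. fnorm2 m (A \<omega>))"
  unfolding fnorm2_def by (intro bdd_measurable_intros assms)


subsection \<open>Trace moments of isotropic rank-one sums\<close>

text \<open>Linearity in the shape of the pointwise estimate behind the moment recursion, with
  abstract functions standing for the long trace expressions.\<close>

lemma integral_sum_affine: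
  fixes F G :: "'i \<Rightarrow> 'a \<Rightarrow> real"
  assumes "\<And>k. k \<in> I \<Longrightarrow> integrable M (F k)" "\<And>k. k \<in> I \<Longrightarrow> integrable M (G k)" "integrable M H"
  shows "(\<integral>x. (\<Sum>k\<in>I. F k x) + c * ((\<Sum>k\<in>I. G k x) + H x) \<partial>M)
    = (\<Sum>k\<in>I. \<integral>x. F k x \<partial>M) + c * ((\<Sum>k\<in>I. \<integral>x. G k x \<partial>M) + (\<integral>x. H x \<partial>M))"
  using assms by simp

text \<open>The setting is used twice: for the state distribution, where it provides Parseval's
  identity, and for the law of snapshot pairs, where it provides the tail bound.\<close>

locale bounded_isotropic = prob_space N for N :: "'a measure" +
  fixes m :: nat and v :: "nat \<Rightarrow> 'a \<Rightarrow> complex" and \<kappa> :: real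
  assumes v_meas: "\<And>i. i < m \<Longrightarrow> v i \<in> borel_measurable N"
    and v_bound: "\<And>x. x \<in> space N \<Longrightarrow> (\<Sum>i<m. (cmod (v i x))\<^sup>2) \<le> \<kappa>"
    and isotropic: "\<And>i j. i < m \<Longrightarrow> j < m \<Longrightarrow> (\<integral>x. v i x * cnj (v j x) \<partial>N) = (if i = j then 1 else 0)"
    and m_pos: "0 < m"
begin

abbreviation sample :: "nat set \<Rightarrow> (nat \<Rightarrow> 'a) measure"
  where "sample I \<equiv> PiM I (\<lambda>_. N)"

lemma prob_space_sample: "prob_space (sample I)"
  by (intro prob_space_PiM prob_space_axioms)

lemmas integrableI = bdd_measurable_integrable[OF prob_space_axioms]

lemmas sample_integrableI = bdd_measurable_integrable[OF prob_space_sample]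

text \<open>Fubini in one coordinate: a single sample is averaged while all others are
  frozen.\<close>

lemma integral_sample_insert:
  fixes f :: "_ \<Rightarrow> 'b::{banach, second_countable_topology}"
  assumes "finite I" "k \<notin> I" "bdd_measurable (sample (insert k I)) f"
  shows "(\<integral>\<omega>. f \<omega> \<partial>sample (insert k I)) = (\<integral>\<omega>. (\<integral>y. f (fun_upd \<omega> k y) \<partial>N) \<partial>sample I)"
proof -
  interpret product_sigma_finite "\<lambda>_. N" by unfold_locales
  show ?thesis by (intro product_integral_insert sample_integrableI assms)
qed

definition defect :: "'a \<Rightarrow> fmat"
  where "defect x = rank_one_defect m (\<lambda>i. v i x)"

text \<open>Within the index range this is \<open>card I\<close> times the identity minus the
  empirical Gram matrix. A large positive value in some direction therefore signals a small Gram
  form there.\<close>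

definition total_defect :: "nat set \<Rightarrow> (nat \<Rightarrow> 'a) \<Rightarrow> fmat"
  where "total_defect I \<omega> = (\<lambda>i j. \<Sum>k\<in>I. defect (\<omega> k) i j)"

lemma supported_defect: "supported m (defect x)"
  unfolding defect_def by (rule supported_rank_one_defect)

lemma fadj_defect: "fadj (defect x) = defect x"
  unfolding defect_def by (rule fadj_rank_one_defect)

lemma supported_total_defect: "supported m (total_defect I \<omega>)"
proof -
  have "total_defect I \<omega> i j = 0" if "\<not> (i < m \<and> j < m)" for i j
    unfolding total_defect_def using supported_defect that by (auto simp: supported_def intro!: sum.neutral)
  then show ?thesis unfolding supported_def by blast
qed

lemma fadj_total_defect: "fadj (total_defect I \<omega>) = total_defect I \<omega>"
proof -
  have "cnj (defect x j i) = defect x i j" for x i j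
    using fadj_defect[of x] unfolding fadj_def by metis
  then show ?thesis unfolding fadj_def total_defect_def by simp
qed

lemma v_bdd: assumes "i < m" shows "bdd_measurable N (v i)"
proof -
  have "cmod (v i x) \<le> sqrt \<kappa>" if "x \<in> space N" for x
  proof (rule real_le_rsqrt)
    have "(cmod (v i x))\<^sup>2 \<le> (\<Sum>i<m. (cmod (v i x))\<^sup>2)"
      using assms by (intro member_le_sum) auto
    then show "(cmod (v i x))\<^sup>2 \<le> \<kappa>" using v_bound[OF that] by simp
  qed
  then show ?thesis using v_meas[OF assms] unfolding bdd_measurable_def by blast
qed

lemma defect_bdd: "bdd_measurable N (\<lambda>x. defect x i j)"
proof (cases "i < m \<and> j < m")
  case True
  then show ?thesis unfolding defect_def rank_one_defect_def
    by (auto simp del: diff_0 intro!: bdd_measurable_intros v_bdd)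
qed (auto simp: defect_def rank_one_defect_def bdd_measurable_const)

lemma defect_bdd_sample: "k \<in> I \<Longrightarrow> bdd_measurable (sample I) (\<lambda>\<omega>. defect (\<omega> k) i j)"
  by (rule bdd_measurable_compose[OF _ defect_bdd]) (rule measurable_component_singleton)

lemma total_defect_bdd: "J \<subseteq> I \<Longrightarrow> bdd_measurable (sample I) (\<lambda>\<omega>. total_defect J \<omega> i j)"
  unfolding total_defect_def by (intro bdd_measurable_sum defect_bdd_sample) auto

lemma integral_defect: "(\<integral>x. defect x i j \<partial>N) = 0"
proof (cases "i < m \<and> j < m")
  case True
  then have "integrable N (\<lambda>x. v i x * cnj (v j x))"
    by (intro integrableI bdd_measurable_intros v_bdd) auto
  then show ?thesis
    using True isotropic prob_space unfolding defect_def rank_one_defect_def by simp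
qed (auto simp: defect_def rank_one_defect_def)

text \<open>Parseval's identity, obtained by expanding the square and using isotropy. It serves the
  variance estimates and later identifies the norm of a function in the span with the Euclidean norm
  of its coefficients.\<close>

lemma integral_linear_form_sq:
  "(\<integral>x. (cmod (\<Sum>i<m. r i * v i x))\<^sup>2 \<partial>N) = (\<Sum>i<m. (cmod (r i))\<^sup>2)"
proof -
  have int: "integrable N (\<lambda>x. v i x * cnj (v j x))" if "i < m" "j < m" for i j
    by (intro integrableI bdd_measurable_intros v_bdd that)
  have "complex_of_real (\<integral>x. (cmod (\<Sum>i<m. r i * v i x))\<^sup>2 \<partial>N)
      = (\<integral>x. complex_of_real ((cmod (\<Sum>i<m. r i * v i x))\<^sup>2) \<partial>N)" by (rule integral_complex_of_real[symmetric])
  also have "\<dots> = (\<integral>x. (\<Sum>i<m. \<Sum>j<m. r i * cnj (r j) * (v i x * cnj (v j x))) \<partial>N)"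
    by (simp add: complex_norm_square sum_product mult_ac del: of_real_power)
  also have "\<dots> = (\<Sum>i<m. \<Sum>j<m. r i * cnj (r j) * (\<integral>x. v i x * cnj (v j x) \<partial>N))"
    by (subst Bochner_Integration.integral_sum)
      (auto intro!: Bochner_Integration.integrable_sum sum.cong integrable_mult_right int
        simp: Bochner_Integration.integral_sum int)
  also have "\<dots> = (\<Sum>i<m. r i * cnj (r i))"
    by (intro sum.cong refl) (simp add: isotropic if_distrib[of "\<lambda>x. _ * x"] cong: if_cong)
  also have "\<dots> = complex_of_real (\<Sum>i<m. (cmod (r i))\<^sup>2)"
    by (simp add: complex_norm_square del: of_real_power)
  finally show ?thesis by (simp only: of_real_eq_iff)
qed

text \<open>The function \<open>v 0\<close> has mean square 1 and its square is at most \<kappa>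
  everywhere.\<close>

lemma kappa_ge_1: "1 \<le> \<kappa>"
proof -
  have "1 = (\<integral>x. (cmod (\<Sum>i<m. (if i = 0 then 1 else 0) * v i x))\<^sup>2 \<partial>N)"
  proof -
    have "(\<Sum>i<m. (cmod (if i = 0 then 1 else 0))\<^sup>2) = (\<Sum>i<m. if i = 0 then 1 else 0)"
      by (intro sum.cong) auto
    then show ?thesis unfolding integral_linear_form_sq using m_pos by simp
  qed
  also have "\<dots> = (\<integral>x. (cmod (v 0 x))\<^sup>2 \<partial>N)"
    using m_pos by (simp add: if_distrib[of "\<lambda>x. x * _"] cong: if_cong)
  also have "\<dots> \<le> (\<integral>x. \<kappa> \<partial>N)"
  proof (rule integral_mono)
    show "integrable N (\<lambda>x. (cmod (v 0 x))\<^sup>2)"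
      using m_pos by (intro integrableI bdd_measurable_intros v_bdd)
    fix x assume x: "x \<in> space N"
    have "(cmod (v 0 x))\<^sup>2 \<le> (\<Sum>i<m. (cmod (v i x))\<^sup>2)"
      using m_pos by (intro member_le_sum) auto
    then show "(cmod (v 0 x))\<^sup>2 \<le> \<kappa>" using v_bound[OF x] by simp
  qed simp
  finally show ?thesis using prob_space by simp
qed

text \<open>For a fixed C the quadratic forms in the pointwise bound integrate, by Parseval, to
  \<open>fnorm2 m C\<close> once more.\<close>

lemma integral_fnorm2_defect_fmult_le:
  "(\<integral>x. fnorm2 m (fmult m (defect x) C) \<partial>N) \<le> (1 + \<kappa>) * fnorm2 m C"
proof -
  let ?q = "\<lambda>x. \<Sum>i<m. (cmod (\<Sum>j<m. cnj (C j i) * v j x))\<^sup>2"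
  have int: "integrable N (\<lambda>x. (cmod (\<Sum>j<m. cnj (C j i) * v j x))\<^sup>2)" for i
    by (intro integrableI bdd_measurable_intros v_bdd) auto
  have "(\<integral>x. fnorm2 m (fmult m (defect x) C) \<partial>N) \<le> (\<integral>x. fnorm2 m C + \<kappa> * ?q x \<partial>N)"
  proof (rule integral_mono)
    show "integrable N (\<lambda>x. fnorm2 m (fmult m (defect x) C))"
      by (intro integrableI bdd_measurable_fnorm2 bdd_measurable_fmult
          defect_bdd bdd_measurable_const)
    show "integrable N (\<lambda>x. fnorm2 m C + \<kappa> * ?q x)" using int by simp
  qed (simp add: defect_def fnorm2_rank_one_defect_mult_le v_bound)
  also have "\<dots> = fnorm2 m C + \<kappa> * (\<integral>x. ?q x \<partial>N)" using int prob_space by simp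
  also have "(\<integral>x. ?q x \<partial>N) = (\<Sum>i<m. \<Sum>j<m. (cmod (C j i))\<^sup>2)"
    using int by (simp add: integral_linear_form_sq)
  also have "\<dots> = fnorm2 m C" unfolding fnorm2_def by (rule sum.swap)
  finally show ?thesis by (simp add: ring_distribs)
qed

lemma integral_ftrace_defect_fmult: "(\<integral>x. ftrace m (fmult m (defect x) C) \<partial>N) = 0"
proof -
  have int: "integrable N (\<lambda>x. defect x i j * C j i)" for i j
    by (intro integrableI bdd_measurable_intros defect_bdd)
  then show ?thesis
    unfolding ftrace_def fmult_def
    by (simp add: integral_defect)
qed

section \<open>Averaging one summand independently of the others\<close>

lemma total_defect_upd: "k \<notin> I \<Longrightarrow> total_defect I (fun_upd \<omega> k y) = total_defect I \<omega>"
  unfolding total_defect_def by (intro ext sum.cong) auto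

lemma integral_fnorm2_indep_le:
  assumes I: "finite I" "k \<notin> I"
  shows "(\<integral>\<omega>. fnorm2 m (fmult m (defect (\<omega> k)) (fpow m (total_defect I \<omega>) q)) \<partial>sample (insert k I))
    \<le> (1 + \<kappa>) * (\<integral>\<omega>. fnorm2 m (fpow m (total_defect I \<omega>) q) \<partial>sample I)"
proof -
  have "(\<integral>\<omega>. fnorm2 m (fmult m (defect (\<omega> k)) (fpow m (total_defect I \<omega>) q)) \<partial>sample (insert k I))
      = (\<integral>\<omega>. (\<integral>y. fnorm2 m (fmult m (defect y) (fpow m (total_defect I \<omega>) q)) \<partial>N) \<partial>sample I)"
    using I by (subst integral_sample_insert)
      (auto intro!: bdd_measurable_fnorm2 bdd_measurable_fmult
        bdd_measurable_fpow defect_bdd_sample total_defect_bdd simp: total_defect_upd)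
  also have "\<dots> \<le> (\<integral>\<omega>. (1 + \<kappa>) * fnorm2 m (fpow m (total_defect I \<omega>) q) \<partial>sample I)"
  proof (rule integral_mono')
    show "integrable (sample I) (\<lambda>\<omega>. (1 + \<kappa>) * fnorm2 m (fpow m (total_defect I \<omega>) q))"
      by (intro sample_integrableI bdd_measurable_intros bdd_measurable_fnorm2
        bdd_measurable_fpow total_defect_bdd order.refl)
  qed (use kappa_ge_1 in \<open>auto intro!: integral_fnorm2_defect_fmult_le mult_nonneg_nonneg fnorm2_nonneg\<close>)
  finally show ?thesis by simp
qed

lemma integral_ftrace_indep:
  assumes I: "finite I" "k \<notin> I"
  shows "(\<integral>\<omega>. ftrace m (fmult m (defect (\<omega> k)) (fpow m (total_defect I \<omega>) q)) \<partial>sample (insert k I)) = 0"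
  using I by (subst integral_sample_insert)
      (auto intro!: bdd_measurable_ftrace bdd_measurable_fmult
        bdd_measurable_fpow defect_bdd_sample total_defect_bdd
        simp: total_defect_upd integral_ftrace_defect_fmult)

text \<open>Here C may depend on the sample, so the quadratic forms cannot be averaged one at a
  time. Their sum over k is instead known exactly: it is \<open>card I * fnorm2 m C\<close> minus
  the trace of C Z C^* with Z the total defect, so the fluctuation is again expressed through
  Z.\<close>

lemma sum_fnorm2_fmult_defect_le:
  assumes "\<omega> \<in> space (sample I)" "finite I"
  shows "(\<Sum>k\<in>I. fnorm2 m (fmult m C (defect (\<omega> k))))
    \<le> (1 + \<kappa>) * card I * fnorm2 m C + \<kappa> * cmod (ftrace m (fmult m (fmult m C (total_defect I \<omega>)) (fadj C)))"
proof -
  define q where "q k = (\<Sum>i<m. (cmod (\<Sum>j<m. C i j * v j (\<omega> k)))\<^sup>2)" for k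
  have "fnorm2 m (fmult m C (defect (\<omega> k))) \<le> fnorm2 m C + \<kappa> * q k" if "k \<in> I" for k
    unfolding q_def defect_def
    by (rule fnorm2_mult_rank_one_defect_le, rule v_bound) (use assms that in \<open>auto simp: space_PiM\<close>)
  then have "(\<Sum>k\<in>I. fnorm2 m (fmult m C (defect (\<omega> k)))) \<le> (\<Sum>k\<in>I. fnorm2 m C + \<kappa> * q k)"
    by (rule sum_mono)
  also have "\<dots> = card I * fnorm2 m C + \<kappa> * (\<Sum>k\<in>I. q k)"
    by (simp add: sum.distrib sum_distrib_left)
  also have "(\<Sum>k\<in>I. q k) \<le> card I * fnorm2 m C + cmod (ftrace m (fmult m (fmult m C (total_defect I \<omega>)) (fadj C)))"
  proof -
    have "fmult m C (total_defect I \<omega>) = (\<lambda>i j. \<Sum>k\<in>I. fmult m C (defect (\<omega> k)) i j)"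
      unfolding total_defect_def fmult_def by (intro ext, simp add: sum_distrib_left, rule sum.swap)
    then have "ftrace m (fmult m (fmult m C (total_defect I \<omega>)) (fadj C))
        = (\<Sum>k\<in>I. ftrace m (fmult m (fmult m C (defect (\<omega> k))) (fadj C)))"
      by (simp only: fmult_sum_left ftrace_sum)
    also have "\<dots> = complex_of_real (\<Sum>k\<in>I. fnorm2 m C - q k)"
      unfolding defect_def ftrace_rank_one_defect q_def by simp
    finally have "cmod (ftrace m (fmult m (fmult m C (total_defect I \<omega>)) (fadj C))) = \<bar>card I * fnorm2 m C - (\<Sum>k\<in>I. q k)\<bar>"
      by (simp only: norm_of_real) (simp add: sum_subtractf)
    then show ?thesis by simp
  qed
  finally show ?thesis using kappa_ge_1 by (simp add: algebra_simps mult_left_mono)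
qed

text \<open>The total defect is self-adjoint, so this is the expectation of the trace of its power
  2q.\<close>

definition moment :: "nat \<Rightarrow> nat set \<Rightarrow> real"
  where "moment q I = (\<integral>\<omega>. fnorm2 m (fpow m (total_defect I \<omega>) q) \<partial>sample I)"

lemma moment_nonneg: "0 \<le> moment q I"
  unfolding moment_def by (intro Bochner_Integration.integral_nonneg fnorm2_nonneg)

lemma fnorm2_fone: "fnorm2 m (fone m) = m"
proof -
  have "fnorm2 m (fone m) = (\<Sum>i<m. \<Sum>j<m. if i = j then 1 else 0)"
    unfolding fnorm2_def fone_def by (intro sum.cong refl) auto
  then show ?thesis by simp
qed

lemma moment_0: "moment 0 I = m"
  unfolding moment_def using prob_space.prob_space[OF prob_space_sample] by (simp add: fnorm2_fone)

text \<open>One factor Z of the trace is expanded into its summands Y. In each term the remaining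
  odd power of Z is compared with that of W = Z - Y. The trace with W has mean zero, the norm of Y
  W^q is averaged by independence and bounded through X, and the norm of Z^q Y, whose factors are
  dependent, is left as an integral.\<close>

lemma moment_Suc_le_aux:
  assumes I: "finite I" and X: "\<And>k. k \<in> I \<Longrightarrow> moment q (I - {k}) \<le> X"
  shows "moment (Suc q) I \<le> real (2 * q + 1) * ((1 + \<kappa>) * card I * X
    + (\<integral>\<omega>. (\<Sum>k\<in>I. fnorm2 m (fmult m (fpow m (total_defect I \<omega>) q) (defect (\<omega> k)))) \<partial>sample I))"
proof -
  let ?Z = "total_defect I" and ?W = "\<lambda>k. total_defect (I - {k})"
  note bdd = bdd_measurable_intros bdd_measurable_fnorm2 bdd_measurable_ftrace
        bdd_measurable_fmult bdd_measurable_fpow defect_bdd_sample total_defect_bdd order.refl Diff_subset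
  have ptw: "fnorm2 m (fpow m (?Z \<omega>) (Suc q)) \<le>
      (\<Sum>k\<in>I. Re (ftrace m (fmult m (defect (\<omega> k)) (fpow m (?W k \<omega>) (2 * q + 1)))))
      + real (2 * q + 1) * ((\<Sum>k\<in>I. fnorm2 m (fmult m (defect (\<omega> k)) (fpow m (?W k \<omega>) q)))
        + (\<Sum>k\<in>I. fnorm2 m (fmult m (fpow m (?Z \<omega>) q) (defect (\<omega> k)))))" for \<omega>
  proof -
    have "complex_of_real (fnorm2 m (fpow m (?Z \<omega>) (Suc q)))
        = ftrace m (fpow m (?Z \<omega>) (Suc q + Suc q))"
      unfolding ftrace_fadj_self[symmetric]
      by (simp only: fadj_fpow[OF supported_total_defect fadj_total_defect]
          fpow_add[OF supported_total_defect])
    \<comment> \<open>One factor is split off because the comparison of traces is made for the odd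
      exponent \<open>2 * q + 1\<close>.\<close>
    also have "Suc q + Suc q = Suc (2 * q + 1)" by simp
    also have "fpow m (?Z \<omega>) (Suc (2 * q + 1)) = fmult m (?Z \<omega>) (fpow m (?Z \<omega>) (2 * q + 1))"
      by (rule fpow_Suc_left[OF supported_total_defect])
    also have "ftrace m \<dots> = (\<Sum>k\<in>I. ftrace m (fmult m (defect (\<omega> k)) (fpow m (?Z \<omega>) (2 * q + 1))))"
    proof -
      have "fmult m (?Z \<omega>) C = (\<lambda>i j. \<Sum>k\<in>I. fmult m (defect (\<omega> k)) C i j)" for C
        unfolding total_defect_def by (rule fmult_sum_left)
      then show ?thesis by (simp only: ftrace_sum)
    qed
    finally have "fnorm2 m (fpow m (?Z \<omega>) (Suc q))
        = (\<Sum>k\<in>I. Re (ftrace m (fmult m (defect (\<omega> k)) (fpow m (?Z \<omega>) (2 * q + 1)))))"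
      by (metis Re_complex_of_real Re_sum)
    also have "\<dots> \<le> (\<Sum>k\<in>I. Re (ftrace m (fmult m (defect (\<omega> k)) (fpow m (?W k \<omega>) (2 * q + 1))))
        + real (2 * q + 1) * (fnorm2 m (fmult m (defect (\<omega> k)) (fpow m (?W k \<omega>) q))
          + fnorm2 m (fmult m (fpow m (?Z \<omega>) q) (defect (\<omega> k)))))"
    proof (rule sum_mono)
      fix k assume "k \<in> I"
      then have "?Z \<omega> = (\<lambda>i j. ?W k \<omega> i j + defect (\<omega> k) i j)"
        unfolding total_defect_def using I by (simp add: sum.remove[of I k] add.commute)
      from ftrace_fpow_diff_le[OF supported_defect fadj_defect supported_total_defect
          fadj_total_defect supported_total_defect fadj_total_defect this, of q]
      show "Re (ftrace m (fmult m (defect (\<omega> k)) (fpow m (?Z \<omega>) (2 * q + 1))))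
        \<le> Re (ftrace m (fmult m (defect (\<omega> k)) (fpow m (?W k \<omega>) (2 * q + 1))))
        + real (2 * q + 1) * (fnorm2 m (fmult m (defect (\<omega> k)) (fpow m (?W k \<omega>) q))
          + fnorm2 m (fmult m (fpow m (?Z \<omega>) q) (defect (\<omega> k))))"
        using complex_Re_le_cmod[of "ftrace m (fmult m (defect (\<omega> k)) (fpow m (?Z \<omega>) (2 * q + 1)))
          - ftrace m (fmult m (defect (\<omega> k)) (fpow m (?W k \<omega>) (2 * q + 1)))"]
        unfolding minus_complex.sel by linarith
    qed
    finally show ?thesis by (simp only: sum.distrib sum_distrib_left[symmetric])
  qed
  have int1: "integrable (sample I) (\<lambda>\<omega>. ftrace m (fmult m (defect (\<omega> k)) (fpow m (?W k \<omega>) r)))"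
    if "k \<in> I" for k r by (intro sample_integrableI bdd that)
  have int2: "integrable (sample I) (\<lambda>\<omega>. fnorm2 m (fmult m (defect (\<omega> k)) (fpow m (?W k \<omega>) q)))"
    if "k \<in> I" for k by (intro sample_integrableI bdd that)
  have int3: "integrable (sample I) (\<lambda>\<omega>. fnorm2 m (fmult m (fpow m (?Z \<omega>) q) (defect (\<omega> k))))"
    if "k \<in> I" for k by (intro sample_integrableI bdd that)
  \<comment> \<open>Reading I as \<open>I - {k}\<close> with k inserted makes W a function of the
    other samples, so the centred factor can be averaged first.\<close>
  have E1: "(\<integral>\<omega>. Re (ftrace m (fmult m (defect (\<omega> k)) (fpow m (?W k \<omega>) r))) \<partial>sample I) = 0"
    if "k \<in> I" for k r
    using integral_ftrace_indep[of "I - {k}" k r] I that int1[OF that] by (simp add: insert_absorb)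
  have E2: "(\<integral>\<omega>. fnorm2 m (fmult m (defect (\<omega> k)) (fpow m (?W k \<omega>) q)) \<partial>sample I) \<le> (1 + \<kappa>) * X"
    if "k \<in> I" for k
  proof -
    have "(\<integral>\<omega>. fnorm2 m (fmult m (defect (\<omega> k)) (fpow m (?W k \<omega>) q)) \<partial>sample I)
        \<le> (1 + \<kappa>) * moment q (I - {k})"
      using integral_fnorm2_indep_le[of "I - {k}" k q] I that unfolding moment_def
      by (simp add: insert_absorb)
    also have "\<dots> \<le> (1 + \<kappa>) * X" using X[OF that] kappa_ge_1 by (intro mult_left_mono) auto
    finally show ?thesis .
  qed
  have "moment (Suc q) I \<le> (\<integral>\<omega>.
      (\<Sum>k\<in>I. Re (ftrace m (fmult m (defect (\<omega> k)) (fpow m (?W k \<omega>) (2 * q + 1)))))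
      + real (2 * q + 1) * ((\<Sum>k\<in>I. fnorm2 m (fmult m (defect (\<omega> k)) (fpow m (?W k \<omega>) q)))
        + (\<Sum>k\<in>I. fnorm2 m (fmult m (fpow m (?Z \<omega>) q) (defect (\<omega> k))))) \<partial>sample I)"
    unfolding moment_def by (rule integral_mono) (intro sample_integrableI bdd ptw | assumption)+
  also have "\<dots> = (\<Sum>k\<in>I. \<integral>\<omega>. Re (ftrace m (fmult m (defect (\<omega> k)) (fpow m (?W k \<omega>) (2 * q + 1)))) \<partial>sample I)
      + real (2 * q + 1) * ((\<Sum>k\<in>I. \<integral>\<omega>. fnorm2 m (fmult m (defect (\<omega> k)) (fpow m (?W k \<omega>) q)) \<partial>sample I)
        + (\<integral>\<omega>. (\<Sum>k\<in>I. fnorm2 m (fmult m (fpow m (?Z \<omega>) q) (defect (\<omega> k)))) \<partial>sample I))"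
    by (rule integral_sum_affine) (intro integrable_Re int1 int2 int3 Bochner_Integration.integrable_sum | assumption)+
  also have "\<dots> \<le> 0 + real (2 * q + 1) * ((\<Sum>k\<in>I. (1 + \<kappa>) * X)
        + (\<integral>\<omega>. (\<Sum>k\<in>I. fnorm2 m (fmult m (fpow m (?Z \<omega>) q) (defect (\<omega> k)))) \<partial>sample I))"
  proof (intro add_mono mult_left_mono sum_mono E2 order.refl)
    show "(\<Sum>k\<in>I. \<integral>\<omega>. Re (ftrace m (fmult m (defect (\<omega> k)) (fpow m (?W k \<omega>) (2 * q + 1)))) \<partial>sample I) \<le> 0"
      by (rule order.eq_iff[THEN iffD1, THEN conjunct1]) (intro sum.neutral ballI E1)
  qed simp_all
  finally show ?thesis by (simp add: mult_ac)
qed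

text \<open>The dependent term left by the previous estimate contributes the odd moment between q
  and q + 1. Young's inequality splits it, and D is large enough that at most half of
  \<open>moment (Suc q) I\<close> comes back on the right, where it can be absorbed.\<close>

lemma moment_Suc_le:
  assumes I: "finite I" and X: "\<And>k. k \<in> I \<Longrightarrow> moment q (I - {k}) \<le> X" "moment q I \<le> X"
    and D: "real (2 * q + 1) * \<kappa> \<le> D"
  shows "moment (Suc q) I \<le> (8 * D * card I + D\<^sup>2) * X"
proof -
  let ?Z = "total_defect I"
  have D0: "0 < D" using kappa_ge_1 by (intro less_le_trans[OF _ D] mult_pos_pos) auto
  have X0: "0 \<le> X" by (rule order.trans[OF moment_nonneg X(2)])
  have int: "integrable (sample I) (\<lambda>\<omega>. fnorm2 m (fpow m (?Z \<omega>) p))" for p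
    by (intro sample_integrableI bdd_measurable_fnorm2 bdd_measurable_fpow total_defect_bdd order.refl)
  have "(\<integral>\<omega>. (\<Sum>k\<in>I. fnorm2 m (fmult m (fpow m (?Z \<omega>) q) (defect (\<omega> k)))) \<partial>sample I)
      \<le> (\<integral>\<omega>. (1 + \<kappa>) * card I * fnorm2 m (fpow m (?Z \<omega>) q)
        + \<kappa> * ((1 / D * fnorm2 m (fpow m (?Z \<omega>) (Suc q)) + fnorm2 m (fpow m (?Z \<omega>) q) / (1 / D)) / 2) \<partial>sample I)"
  proof (rule integral_mono)
    show "integrable (sample I) (\<lambda>\<omega>. (\<Sum>k\<in>I. fnorm2 m (fmult m (fpow m (?Z \<omega>) q) (defect (\<omega> k)))))"
      by (intro sample_integrableI bdd_measurable_sum bdd_measurable_fnorm2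
        bdd_measurable_fmult bdd_measurable_fpow defect_bdd_sample total_defect_bdd order.refl)
    show "integrable (sample I) (\<lambda>\<omega>. (1 + \<kappa>) * card I * fnorm2 m (fpow m (?Z \<omega>) q)
        + \<kappa> * ((1 / D * fnorm2 m (fpow m (?Z \<omega>) (Suc q)) + fnorm2 m (fpow m (?Z \<omega>) q) / (1 / D)) / 2))"
      by (intro Bochner_Integration.integrable_add integrable_mult_right integrable_divide int)
  next
    fix \<omega> assume w: "\<omega> \<in> space (sample I)"
    \<comment> \<open>This trace pairs Z^(q+1) with Z^q. The weight \<open>1 / D\<close> makes the
      share of the higher moment small at the price of a factor D on the lower one.\<close>
    have "cmod (ftrace m (fmult m (fmult m (fpow m (?Z \<omega>) q) (?Z \<omega>)) (fadj (fpow m (?Z \<omega>) q))))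
        \<le> (1 / D * fnorm2 m (fpow m (?Z \<omega>) (Suc q)) + fnorm2 m (fpow m (?Z \<omega>) q) / (1 / D)) / 2"
      using cmod_ftrace_fadj_le[of "1 / D" m "fpow m (?Z \<omega>) (Suc q)"] D0 by simp
    then show "(\<Sum>k\<in>I. fnorm2 m (fmult m (fpow m (?Z \<omega>) q) (defect (\<omega> k))))
      \<le> (1 + \<kappa>) * card I * fnorm2 m (fpow m (?Z \<omega>) q)
        + \<kappa> * ((1 / D * fnorm2 m (fpow m (?Z \<omega>) (Suc q)) + fnorm2 m (fpow m (?Z \<omega>) q) / (1 / D)) / 2)"
      by (intro order.trans[OF sum_fnorm2_fmult_defect_le[OF w I]] add_mono order.refl mult_left_mono)
        (use kappa_ge_1 in auto)
  qed
  also have "\<dots> = (1 + \<kappa>) * card I * moment q I + \<kappa> * (moment (Suc q) I / D + D * moment q I) / 2"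
    unfolding moment_def using int[of "Suc q"] int[of q] D0
    by (simp add: field_simps del: fpow.simps)
  also have "\<dots> \<le> (1 + \<kappa>) * card I * X + \<kappa> * (moment (Suc q) I / D + D * X) / 2"
    using X(2) kappa_ge_1 D0 by (intro add_mono mult_left_mono divide_right_mono order.refl) auto
  finally have B: "moment (Suc q) I \<le> real (2 * q + 1) * ((1 + \<kappa>) * card I * X
      + ((1 + \<kappa>) * card I * X + \<kappa> * (moment (Suc q) I / D + D * X) / 2))"
    by (intro order.trans[OF moment_Suc_le_aux[OF I X(1)]] mult_left_mono add_mono order.refl) auto
  also have "\<dots> = real (2 * q + 1) * (1 + \<kappa>) * (2 * card I * X)
      + real (2 * q + 1) * \<kappa> * ((moment (Suc q) I / D + D * X) / 2)"
    by (simp add: algebra_simps add_divide_distrib)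
  also have "\<dots> \<le> 2 * D * (2 * card I * X) + D * ((moment (Suc q) I / D + D * X) / 2)"
  proof (intro add_mono mult_right_mono D)
    \<comment> \<open>Since \<kappa> is at least 1, the factor 1 + \<kappa> costs at most 2
      \<kappa>.\<close>
    have "real (2 * q + 1) * 1 \<le> real (2 * q + 1) * \<kappa>" using kappa_ge_1 by (intro mult_left_mono) auto
    then show "real (2 * q + 1) * (1 + \<kappa>) \<le> 2 * D" using D by (simp add: ring_distribs)
  qed (use X0 D0 moment_nonneg in auto)
  \<comment> \<open>Moving half of \<open>moment (Suc q) I\<close> to the left doubles the other
    terms, which gives the coefficients 8 and 1 of the claim.\<close>
  also have "\<dots> = 4 * D * card I * X + moment (Suc q) I / 2 + D\<^sup>2 * X / 2"
    using D0 by (simp add: field_simps power2_eq_square)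
  finally show ?thesis by (simp add: algebra_simps)
qed

text \<open>The recursion passes from I to \<open>I - {k}\<close>, so the induction ranges over all
  sets of at most n elements. The single value 2 p \<kappa> dominates
  \<open>(2 * q + 1) * \<kappa>\<close> at every step with q < p.\<close>

lemma moment_le:
  fixes p :: nat
  assumes "finite I" "card I \<le> n" "q \<le> p"
  shows "moment q I \<le> m * (8 * (2 * real p * \<kappa>) * n + (2 * real p * \<kappa>)\<^sup>2) ^ q"
  using assms
proof (induction q arbitrary: I)
  case (Suc q)
  let ?D = "2 * real p * \<kappa>"
  let ?X = "m * (8 * ?D * n + ?D\<^sup>2) ^ q"
  have "real (2 * q + 1) * \<kappa> \<le> ?D"
    using Suc.prems kappa_ge_1 by (intro mult_right_mono) auto
  moreover have "moment q (I - {k}) \<le> ?X" if "k \<in> I" for k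
    using Suc.prems that by (intro Suc.IH) auto
  moreover have "moment q I \<le> ?X" using Suc.prems by (intro Suc.IH) auto
  ultimately have "moment (Suc q) I \<le> (8 * ?D * card I + ?D\<^sup>2) * ?X"
    using Suc.prems(1) by (intro moment_Suc_le)
  also have "\<dots> \<le> (8 * ?D * n + ?D\<^sup>2) * ?X"
    using Suc.prems kappa_ge_1 by (intro mult_right_mono add_mono mult_left_mono) auto
  finally show ?case by (simp add: mult_ac)
qed (simp add: moment_0)

end

text \<open>Bienayme's identity: after expanding the square, the products of different coordinates
  factor under the product measure and vanish because f is centred.\<close>

lemma integral_norm_sum_iid_sq:
  fixes f :: "'a \<Rightarrow> complex"
  assumes N: "prob_space N" and f: "integrable N f" "integrable N (\<lambda>x. (cmod (f x))\<^sup>2)" "(\<integral>x. f x \<partial>N) = 0"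
  shows "integrable (PiM {..<n::nat} (\<lambda>_. N)) (\<lambda>\<omega>. (cmod (\<Sum>k<n. f (\<omega> k)))\<^sup>2)"
    and "(\<integral>\<omega>. (cmod (\<Sum>k<n. f (\<omega> k)))\<^sup>2 \<partial>PiM {..<n} (\<lambda>_. N)) = n * (\<integral>x. (cmod (f x))\<^sup>2 \<partial>N)"
proof -
  let ?S = "PiM {..<n} (\<lambda>_. N)"
  interpret prob_space N by fact
  interpret product_prob_space "\<lambda>_. N" "{..<n}" by unfold_locales
  define c where "c = (\<integral>x. (cmod (f x))\<^sup>2 \<partial>N)"
  have fcnj: "integrable N (\<lambda>x. cnj (f x))" using f(1) by simp
  have ff: "integrable N (\<lambda>x. f x * cnj (f x))"
    unfolding complex_norm_square[symmetric] using f(2) by (rule integrable_of_real)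
  have c: "(\<integral>x. f x * cnj (f x) \<partial>N) = complex_of_real c"
    unfolding complex_norm_square[symmetric] c_def by (rule integral_complex_of_real)
  have diag: "has_bochner_integral ?S (\<lambda>\<omega>. f (\<omega> k) * cnj (f (\<omega> k))) (complex_of_real c)" if "k < n" for k
  proof -
    have d: "distr ?S N (\<lambda>\<omega>. \<omega> k) = N" using that by (intro PiM_component) auto
    have meas: "(\<lambda>\<omega>. \<omega> k) \<in> measurable ?S N" using that by (intro measurable_component_singleton) auto
    have "integrable ?S (\<lambda>\<omega>. f (\<omega> k) * cnj (f (\<omega> k)))"
      using integrable_distr[OF meas, of "\<lambda>x. f x * cnj (f x)"] ff unfolding d by simp
    moreover have "(\<integral>\<omega>. f (\<omega> k) * cnj (f (\<omega> k)) \<partial>?S) = complex_of_real c"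
      using integral_distr[OF meas, of "\<lambda>x. f x * cnj (f x)"] ff unfolding d c by simp
    ultimately show ?thesis by (simp add: has_bochner_integral_iff)
  qed
  have off: "has_bochner_integral ?S (\<lambda>\<omega>. f (\<omega> k) * cnj (f (\<omega> k'))) 0"
    if "k < n" "k' < n" "k \<noteq> k'" for k k'
  proof -
    \<comment> \<open>The off-diagonal product is written as a product over all coordinates, with
      factor 1 away from k and k', so that the integral of a product over the product measure
      applies.\<close>
    define g where "g i x = (if i = k then f x else 1) * (if i = k' then cnj (f x) else 1)" for i x
    have g: "integrable N (\<lambda>x. g i x)" for i
      unfolding g_def using f fcnj that by (cases "i = k"; cases "i = k'") auto
    have "(\<Prod>i<n. g i (\<omega> i)) = f (\<omega> k) * cnj (f (\<omega> k'))" for \<omega>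
      using that unfolding g_def prod.distrib by simp
    moreover have "integrable ?S (\<lambda>\<omega>. \<Prod>i<n. g i (\<omega> i))"
      by (intro product_integrable_prod g) auto
    moreover have "(\<integral>\<omega>. (\<Prod>i<n. g i (\<omega> i)) \<partial>?S) = (\<Prod>i<n. integral\<^sup>L N (g i))"
      by (intro product_integral_prod g) auto
    moreover have "(\<Prod>i<n. integral\<^sup>L N (g i)) = 0"
    proof (rule prod_zero)
      have "integral\<^sup>L N (g k) = 0" using f(3) that unfolding g_def by simp
      then show "\<exists>i\<in>{..<n}. integral\<^sup>L N (g i) = 0" using that by auto
    qed simp
    ultimately show ?thesis by (simp add: has_bochner_integral_iff)
  qed
  have "has_bochner_integral ?S (\<lambda>\<omega>. \<Sum>k<n. \<Sum>k'<n. f (\<omega> k) * cnj (f (\<omega> k')))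
      (\<Sum>k<n. \<Sum>k'<n. if k = k' then complex_of_real c else 0)"
    by (intro has_bochner_integral_sum) (use diag off in auto)
  then have "has_bochner_integral ?S (\<lambda>\<omega>. complex_of_real ((cmod (\<Sum>k<n. f (\<omega> k)))\<^sup>2)) (complex_of_real (n * c))"
    by (simp add: complex_norm_square sum_product del: of_real_power)
  from has_bochner_integral_Re[OF this]
  have "has_bochner_integral ?S (\<lambda>\<omega>. (cmod (\<Sum>k<n. f (\<omega> k)))\<^sup>2) (n * c)" by simp
  then show "integrable ?S (\<lambda>\<omega>. (cmod (\<Sum>k<n. f (\<omega> k)))\<^sup>2)"
    "(\<integral>\<omega>. (cmod (\<Sum>k<n. f (\<omega> k)))\<^sup>2 \<partial>?S) = n * (\<integral>x. (cmod (f x))\<^sup>2 \<partial>N)"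
    unfolding c_def by (auto simp: has_bochner_integral_iff)
qed

section \<open>Lower tail of the empirical Gram form\<close>

context bounded_isotropic
begin

lemma fnorm2_single_row:
  "fnorm2 m (\<lambda>i j. if i = 0 \<and> j < m then u j else 0) = (\<Sum>j<m. (cmod (u j))\<^sup>2)"
proof -
  have "fnorm2 m (\<lambda>i j. if i = 0 \<and> j < m then u j else 0)
      = (\<Sum>i<m. if i = 0 then (\<Sum>j<m. (cmod (u j))\<^sup>2) else 0)"
    unfolding fnorm2_def by (intro sum.cong refl) auto
  then show ?thesis using m_pos by simp
qed

text \<open>The vector u is placed in row 0 of an otherwise zero matrix, so that matrix inequalities
  apply to the quadratic form of the total defect at u.\<close>

lemma ftrace_total_defect:
  assumes "U = (\<lambda>i j. if i = 0 \<and> j < m then u j else 0)"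
  shows "ftrace m (fmult m (fmult m U (total_defect I \<omega>)) (fadj U))
    = complex_of_real (card I * (\<Sum>j<m. (cmod (u j))\<^sup>2) - (\<Sum>k\<in>I. (cmod (\<Sum>j<m. u j * v j (\<omega> k)))\<^sup>2))"
proof -
  have row: "(\<Sum>i<m. (cmod (\<Sum>j<m. U i j * v j x))\<^sup>2) = (cmod (\<Sum>j<m. u j * v j x))\<^sup>2" for x
  proof -
    have "(\<Sum>i<m. (cmod (\<Sum>j<m. U i j * v j x))\<^sup>2)
        = (\<Sum>i<m. if i = 0 then (cmod (\<Sum>j<m. u j * v j x))\<^sup>2 else 0)"
      unfolding assms by (intro sum.cong refl) auto
    then show ?thesis using m_pos by simp
  qed
  have "fmult m U (total_defect I \<omega>) = (\<lambda>i j. \<Sum>k\<in>I. fmult m U (defect (\<omega> k)) i j)"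
    unfolding total_defect_def fmult_def by (intro ext, simp add: sum_distrib_left, rule sum.swap)
  then have "ftrace m (fmult m (fmult m U (total_defect I \<omega>)) (fadj U))
      = (\<Sum>k\<in>I. ftrace m (fmult m (fmult m U (defect (\<omega> k))) (fadj U)))"
    by (simp only: fmult_sum_left ftrace_sum)
  also have "\<dots> = complex_of_real (\<Sum>k\<in>I. (\<Sum>j<m. (cmod (u j))\<^sup>2) - (cmod (\<Sum>j<m. u j * v j (\<omega> k)))\<^sup>2)"
    unfolding defect_def ftrace_rank_one_defect row by (simp add: assms fnorm2_single_row)
  finally show ?thesis by (simp add: sum_subtractf)
qed

text \<open>If the Gram form falls below (1 - \<delta>) n |u|^2 for some u, the total defect Z has
  quadratic form above \<delta> n |u|^2 there, and power iteration gives \<open>fnorm2\<close> of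
  Z^p at least (\<delta> n)^(2p). That single event covers all u at once, and Markov's inequality
  bounds its probability by the moment of order p.\<close>

lemma lower_tail_moment:
  assumes \<delta>: "0 < \<delta>" "\<delta> < 1" and \<epsilon>: "0 < \<epsilon>" and p: "1 \<le> p" "ln (m / \<epsilon>) \<le> real p"
    and n: "54 * real p * \<kappa> \<le> \<delta>\<^sup>2 * real n"
  shows "\<exists>B\<in>sets (sample {..<n}). measure (sample {..<n}) B \<le> \<epsilon> \<and>
    (\<forall>\<omega>\<in>space (sample {..<n}) - B. \<forall>u. (1 - \<delta>) * n * (\<Sum>j<m. (cmod (u j))\<^sup>2)
      \<le> (\<Sum>k<n. (cmod (\<Sum>j<m. u j * v j (\<omega> k)))\<^sup>2))"
proof (intro bexI conjI ballI allI)
  let ?T = "\<lambda>\<omega>. fnorm2 m (fpow m (total_defect {..<n} \<omega>) p)"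
  let ?B = "{\<omega> \<in> space (sample {..<n}). (\<delta> * n) ^ (2 * p) \<le> ?T \<omega>}"
  have bdd: "bdd_measurable (sample {..<n}) ?T"
    by (intro bdd_measurable_fnorm2 bdd_measurable_fpow total_defect_bdd order.refl)
  have [measurable]: "?T \<in> borel_measurable (sample {..<n})" by (rule bdd_measurableD[OF bdd])
  show "?B \<in> sets (sample {..<n})" by measurable
  have "0 < 54 * real p * \<kappa>" using p kappa_ge_1 by simp
  then have n0: "0 < n" using n by (cases n) auto
  define D where "D = 2 * real p * \<kappa>"
  have D: "0 \<le> D" "27 * D \<le> \<delta>\<^sup>2 * n" using n kappa_ge_1 unfolding D_def by auto
  have "\<delta>\<^sup>2 * real n \<le> 1 * real n" using \<delta> by (intro mult_right_mono) (auto simp: power_le_one)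
  then have "D \<le> n" using D by simp
  \<comment> \<open>As D is at most n, the sum is at most 9 D n. The constant 54 in the condition on
    n, that is 27 times D, leaves a third of (\<delta> n)^2.\<close>
  have "8 * D * n + D\<^sup>2 \<le> 8 * D * n + D * n"
    unfolding power2_eq_square using \<open>D \<le> n\<close> D by (intro add_left_mono mult_left_mono)
  also have "\<dots> = (27 * D) * n / 3" by simp
  also have "\<dots> \<le> (\<delta>\<^sup>2 * n) * n / 3" using D by (intro divide_right_mono mult_right_mono) auto
  finally have base: "8 * D * n + D\<^sup>2 \<le> (\<delta> * n)\<^sup>2 / 3" by (simp add: power2_eq_square mult_ac)
  have "moment p {..<n} \<le> m * (8 * D * n + D\<^sup>2) ^ p"
    unfolding D_def by (rule moment_le) auto
  also have "\<dots> \<le> m * ((\<delta> * n)\<^sup>2 / 3) ^ p"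
    using base D by (intro mult_left_mono power_mono) auto
  also have "\<dots> = (m * (1 / 3) ^ p) * (\<delta> * n) ^ (2 * p)"
    by (simp add: power_divide power_mult)
  finally have mom: "moment p {..<n} \<le> (m * (1 / 3) ^ p) * (\<delta> * n) ^ (2 * p)" .
  have "measure (sample {..<n}) ?B \<le> moment p {..<n} / (\<delta> * n) ^ (2 * p)"
    unfolding moment_def
    by (rule integral_Markov_inequality_measure[where A = "{}"])
      (use \<delta> n0 in \<open>auto intro!: sample_integrableI bdd fnorm2_nonneg\<close>)
  also have "\<dots> \<le> m * (1 / 3) ^ p"
    using mom \<delta> n0 by (simp add: pos_divide_le_eq)
  also have "\<dots> \<le> m * exp (- real p)"
  proof -
    \<comment> \<open>A base of 1/3 suffices since e is at most 3: p factors turn m into at most m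
      exp(-p), and p is at least ln(m / \<epsilon>).\<close>
    have "1 / 3 \<le> exp (- 1 :: real)" using exp_le by (simp add: exp_minus field_simps)
    then have "(1 / 3) ^ p \<le> exp (- 1 :: real) ^ p" by (intro power_mono) auto
    then show ?thesis by (intro mult_left_mono) (simp_all flip: exp_of_nat_mult)
  qed
  also have "\<dots> \<le> m * exp (- ln (m / \<epsilon>))" using p by (intro mult_left_mono) auto
  also have "\<dots> = \<epsilon>" using m_pos \<epsilon> by (simp add: exp_minus)
  finally show "measure (sample {..<n}) ?B \<le> \<epsilon>" .
  fix \<omega> u assume w: "\<omega> \<in> space (sample {..<n}) - ?B"
  show "(1 - \<delta>) * n * (\<Sum>j<m. (cmod (u j))\<^sup>2) \<le> (\<Sum>k<n. (cmod (\<Sum>j<m. u j * v j (\<omega> k)))\<^sup>2)"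
  proof (rule ccontr)
    assume neg: "\<not> ?thesis"
    define U :: fmat where "U = (\<lambda>i j. if i = 0 \<and> j < m then u j else 0)"
    have U: "fnorm2 m U = (\<Sum>j<m. (cmod (u j))\<^sup>2)" unfolding U_def by (rule fnorm2_single_row)
    have "0 \<le> (\<Sum>k<n. (cmod (\<Sum>j<m. u j * v j (\<omega> k)))\<^sup>2)" by (intro sum_nonneg) auto
    then have "0 < (1 - \<delta>) * n * fnorm2 m U" using neg unfolding U by simp
    then have U0: "0 < fnorm2 m U" using \<delta> n0 fnorm2_nonneg[of m U] by (auto simp: zero_less_mult_iff)
    have "(\<delta> * n) ^ (2 * p) \<le> ?T \<omega>"
    proof (rule fnorm2_fpow_ge[OF supported_total_defect fadj_total_defect _ U0])
      show "supported m U" unfolding supported_def U_def using m_pos by auto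
      show "\<delta> * n * fnorm2 m U \<le> cmod (ftrace m (fmult m (fmult m U (total_defect {..<n} \<omega>)) (fadj U)))"
        unfolding ftrace_total_defect[OF U_def] norm_of_real
        using neg unfolding U by (simp add: algebra_simps)
    qed (use \<delta> in auto)
    then show False using w by auto
  qed
qed

text \<open>For \<open>m = 1\<close> and \<open>\<epsilon>\<close> close to \<open>1\<close> the bound on \<open>n\<close> is too weak for the moment method, and
  Cantelli's one-sided inequality takes over.\<close>

lemma lower_tail_scalar:
  assumes \<delta>: "0 < \<delta>" "\<delta> < 1" and \<epsilon>: "1 / 2 \<le> \<epsilon>" "\<epsilon> < 1" and m1: "m = 1"
    and n: "8 * \<kappa> * (1 - \<epsilon>) \<le> \<delta>\<^sup>2 * real n"
  shows "\<exists>B\<in>sets (sample {..<n}). measure (sample {..<n}) B \<le> \<epsilon> \<and>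
    (\<forall>\<omega>\<in>space (sample {..<n}) - B. \<forall>u. (1 - \<delta>) * n * (\<Sum>j<m. (cmod (u j))\<^sup>2)
      \<le> (\<Sum>k<n. (cmod (\<Sum>j<m. u j * v j (\<omega> k)))\<^sup>2))"
proof (intro bexI conjI ballI allI)
  have m_set: "{..<m} = {0}" using m1 by auto
  let ?z = "\<lambda>\<omega>. Re (total_defect {..<n} \<omega> 0 0)"
  \<comment> \<open>The shift in Cantelli's argument is the variance bound 4 \<kappa> n divided by
    the threshold \<delta> n. With it the quotient in Markov's inequality for (z + a)^2 collapses to
    a / (\<delta> n + a).\<close>
  define a where "a = 4 * \<kappa> / \<delta>"
  have a0: "0 < a" using \<delta> kappa_ge_1 unfolding a_def by simp
  let ?B = "{\<omega> \<in> space (sample {..<n}). (\<delta> * n + a)\<^sup>2 \<le> (?z \<omega> + a)\<^sup>2}"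
  have bdd: "bdd_measurable (sample {..<n}) ?z"
    by (intro bdd_measurable_Re total_defect_bdd order.refl)
  have [measurable]: "?z \<in> borel_measurable (sample {..<n})" by (rule bdd_measurableD[OF bdd])
  show "?B \<in> sets (sample {..<n})" by measurable
  have int: "integrable (sample {..<n}) ?z" "integrable (sample {..<n}) (\<lambda>\<omega>. (?z \<omega>)\<^sup>2)"
    by (intro sample_integrableI bdd bdd_measurable_power)+
  have "(\<integral>\<omega>. total_defect {..<n} \<omega> 0 0 \<partial>sample {..<n}) = (\<Sum>k<n. \<integral>\<omega>. defect (\<omega> k) 0 0 \<partial>sample {..<n})"
    unfolding total_defect_def
    by (intro Bochner_Integration.integral_sum sample_integrableI defect_bdd_sample) auto
  also have "\<dots> = 0"
  proof (intro sum.neutral ballI)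
    fix k assume k: "k \<in> {..<n}"
    show "(\<integral>\<omega>. defect (\<omega> k) 0 0 \<partial>sample {..<n}) = 0"
      using integral_sample_insert[of "{..<n} - {k}" k "\<lambda>\<omega>. defect (\<omega> k) 0 0"]
        defect_bdd_sample[OF k] k by (simp add: insert_absorb integral_defect)
  qed
  finally have z1: "(\<integral>\<omega>. ?z \<omega> \<partial>sample {..<n}) = 0"
    by (subst integral_Re) (simp_all add: sample_integrableI total_defect_bdd)
  \<comment> \<open>The case q = 0 of the unabsorbed recursion: both sums are at most (1 + \<kappa>)
    n because m = 1, and 1 + \<kappa> is at most 2 \<kappa>.\<close>
  have "moment 1 {..<n} \<le> (1 + \<kappa>) * n * m + (\<Sum>k<n. (1 + \<kappa>) * m)"
  proof -
    have one: "(\<integral>\<omega>. fnorm2 m (fmult m (fone m) (defect (\<omega> k))) \<partial>sample {..<n}) \<le> (1 + \<kappa>) * m" if "k < n" for k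
      using integral_fnorm2_indep_le[of "{..<n} - {k}" k 0] that moment_0[of "{..<n} - {k}"]
      unfolding moment_def
      by (simp add: insert_absorb fmult_one_left fmult_one_right supported_defect)
    have bd: "integrable (sample {..<n}) (\<lambda>\<omega>. fnorm2 m (fmult m (fone m) (defect (\<omega> k))))" if "k < n" for k
      by (intro sample_integrableI bdd_measurable_fnorm2 bdd_measurable_fmult bdd_measurable_const defect_bdd_sample)
        (use that in auto)
    have "moment (Suc 0) {..<n} \<le> real (2 * 0 + 1) * ((1 + \<kappa>) * card {..<n} * m
      + (\<integral>\<omega>. (\<Sum>k\<in>{..<n}. fnorm2 m (fmult m (fpow m (total_defect {..<n} \<omega>) 0) (defect (\<omega> k)))) \<partial>sample {..<n}))"
      by (rule moment_Suc_le_aux) (simp_all add: moment_0)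
    also have "\<dots> = (1 + \<kappa>) * n * m + (\<Sum>k<n. \<integral>\<omega>. fnorm2 m (fmult m (fone m) (defect (\<omega> k))) \<partial>sample {..<n})"
      using bd by simp
    also have "\<dots> \<le> (1 + \<kappa>) * n * m + (\<Sum>k<n. (1 + \<kappa>) * m)"
      by (intro add_left_mono sum_mono one) auto
    finally show ?thesis by simp
  qed
  also have "\<dots> \<le> 4 * \<kappa> * n" using kappa_ge_1 mult_right_mono[of 1 \<kappa> "real n"] unfolding m1 by (simp add: algebra_simps)
  finally have mom: "moment 1 {..<n} \<le> 4 * \<kappa> * n" .
  have z2: "(\<integral>\<omega>. (?z \<omega>)\<^sup>2 \<partial>sample {..<n}) \<le> 4 * \<kappa> * n"
  proof (rule order.trans[OF _ mom], unfold moment_def, rule integral_mono[OF int(2)])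
    show "integrable (sample {..<n}) (\<lambda>\<omega>. fnorm2 m (fpow m (total_defect {..<n} \<omega>) 1))"
      by (intro sample_integrableI bdd_measurable_fnorm2 bdd_measurable_fpow total_defect_bdd order.refl)
    fix \<omega>
    have "fnorm2 m (fpow m (total_defect {..<n} \<omega>) 1) = (cmod (total_defect {..<n} \<omega> 0 0))\<^sup>2"
      unfolding fpow_1[OF supported_total_defect] fnorm2_def m_set by simp
    then show "(?z \<omega>)\<^sup>2 \<le> fnorm2 m (fpow m (total_defect {..<n} \<omega>) 1)"
      by (simp only:) (simp add: cmod_power2)
  qed
  have "(\<integral>\<omega>. (?z \<omega> + a)\<^sup>2 \<partial>sample {..<n})
      = (\<integral>\<omega>. (?z \<omega>)\<^sup>2 \<partial>sample {..<n}) + 2 * a * (\<integral>\<omega>. ?z \<omega> \<partial>sample {..<n}) + a\<^sup>2"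
  proof -
    have "(\<integral>\<omega>. (?z \<omega> + a)\<^sup>2 \<partial>sample {..<n}) = (\<integral>\<omega>. (?z \<omega>)\<^sup>2 + (2 * a * ?z \<omega> + a\<^sup>2) \<partial>sample {..<n})"
      by (intro Bochner_Integration.integral_cong refl) (simp add: power2_sum)
    then show ?thesis
      using int prob_space.prob_space[OF prob_space_sample]
      by (simp add: finite_measure.integrable_const prob_space.finite_measure[OF prob_space_sample])
  qed
  also have "\<dots> \<le> 4 * \<kappa> * n + a\<^sup>2" using z1 z2 by simp
  also have "\<dots> = a * (\<delta> * n + a)" using \<delta> unfolding a_def by (simp add: field_simps power2_eq_square)
  finally have second: "(\<integral>\<omega>. (?z \<omega> + a)\<^sup>2 \<partial>sample {..<n}) \<le> a * (\<delta> * n + a)" .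
  have pos: "0 < \<delta> * n + a" using a0 \<delta> by (simp add: add_nonneg_pos)
  have "measure (sample {..<n}) ?B \<le> (\<integral>\<omega>. (?z \<omega> + a)\<^sup>2 \<partial>sample {..<n}) / (\<delta> * n + a)\<^sup>2"
    by (rule integral_Markov_inequality_measure[where A = "{}"])
      (use pos in \<open>auto intro!: sample_integrableI bdd_measurable_intros bdd\<close>)
  also have "\<dots> \<le> a * (\<delta> * n + a) / (\<delta> * n + a)\<^sup>2"
    by (intro divide_right_mono second) simp
  also have "\<dots> = a / (\<delta> * n + a)" using pos by (simp add: power2_eq_square)
  also have "\<dots> \<le> \<epsilon>"
  proof -
    \<comment> \<open>The goal a / (\<delta> n + a) at most \<epsilon> rearranges to a (1 -
      \<epsilon>) at most \<epsilon> \<delta> n. The constant 8 gives \<delta> n / 2, and \<epsilon>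
      is at least 1/2.\<close>
    have "a * (1 - \<epsilon>) \<le> \<delta> * n / 2"
      using n \<delta> unfolding a_def by (simp add: field_simps power2_eq_square)
    also have "\<dots> \<le> \<epsilon> * (\<delta> * n)" using \<epsilon> \<delta> mult_right_mono[of "1/2" \<epsilon> "\<delta> * n"] by simp
    finally show ?thesis using pos by (simp add: pos_divide_le_eq algebra_simps)
  qed
  finally show "measure (sample {..<n}) ?B \<le> \<epsilon>" .
  fix \<omega> u assume w: "\<omega> \<in> space (sample {..<n}) - ?B"
  define U :: fmat where "U = (\<lambda>i j. if i = 0 \<and> j < m then u j else 0)"
  have "(\<delta> * n + a)\<^sup>2 > (?z \<omega> + a)\<^sup>2" using w by auto
  \<comment> \<open>Only the upper deviation has to be excluded: if z reached \<delta> n, then z + a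
    would be positive and its square too large.\<close>
  then have z: "?z \<omega> < \<delta> * n"
    using pos by (meson add_le_cancel_right less_imp_le not_le power_mono)
  have "complex_of_real (card {..<n} * (\<Sum>j<m. (cmod (u j))\<^sup>2) - (\<Sum>k\<in>{..<n}. (cmod (\<Sum>j<m. u j * v j (\<omega> k)))\<^sup>2))
      = ftrace m (fmult m (fmult m U (total_defect {..<n} \<omega>)) (fadj U))"
    by (rule ftrace_total_defect[OF U_def, symmetric])
  also have "\<dots> = u 0 * total_defect {..<n} \<omega> 0 0 * cnj (u 0)"
    unfolding ftrace_def fmult_def fadj_def U_def m_set using m_pos by simp
  also have "\<dots> = complex_of_real ((cmod (u 0))\<^sup>2) * total_defect {..<n} \<omega> 0 0"
    by (simp add: complex_norm_square mult_ac del: of_real_power)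
  finally have "Re (complex_of_real (card {..<n} * (\<Sum>j<m. (cmod (u j))\<^sup>2)
      - (\<Sum>k\<in>{..<n}. (cmod (\<Sum>j<m. u j * v j (\<omega> k)))\<^sup>2)))
      = Re (complex_of_real ((cmod (u 0))\<^sup>2) * total_defect {..<n} \<omega> 0 0)"
    by (rule arg_cong)
  then have "real (card {..<n}) * (\<Sum>j<m. (cmod (u j))\<^sup>2) - (\<Sum>k\<in>{..<n}. (cmod (\<Sum>j<m. u j * v j (\<omega> k)))\<^sup>2)
      = (cmod (u 0))\<^sup>2 * ?z \<omega>"
    unfolding times_complex.sel Re_complex_of_real Im_complex_of_real by simp
  moreover have "(cmod (u 0))\<^sup>2 * ?z \<omega> \<le> (cmod (u 0))\<^sup>2 * (\<delta> * n)"
    using z by (intro mult_left_mono) auto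
  ultimately show "(1 - \<delta>) * n * (\<Sum>j<m. (cmod (u j))\<^sup>2) \<le> (\<Sum>k<n. (cmod (\<Sum>j<m. u j * v j (\<omega> k)))\<^sup>2)"
    unfolding m_set by (simp add: algebra_simps)
qed

text \<open>The order p of the moment is ln(m / \<epsilon>) rounded up, and rounding costs a bounded
  factor only if the logarithm stays away from 0. This holds when m / \<epsilon> is at least 2;
  otherwise m = 1 and \<epsilon> is at least 1/2, which is the scalar case.\<close>

theorem lower_tail:
  assumes \<delta>: "0 < \<delta>" "\<delta> < 1" and \<epsilon>: "0 < \<epsilon>" "\<epsilon> < 1"
    and n: "162 / \<delta>\<^sup>2 * \<kappa> * ln (m / \<epsilon>) \<le> real n"
  shows "\<exists>B\<in>sets (sample {..<n}). measure (sample {..<n}) B \<le> \<epsilon> \<and>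
    (\<forall>\<omega>\<in>space (sample {..<n}) - B. \<forall>u. (1 - \<delta>) * n * (\<Sum>j<m. (cmod (u j))\<^sup>2)
      \<le> (\<Sum>k<n. (cmod (\<Sum>j<m. u j * v j (\<omega> k)))\<^sup>2))"
proof -
  have n': "162 * \<kappa> * ln (m / \<epsilon>) \<le> \<delta>\<^sup>2 * real n" using n \<delta> by (simp add: field_simps)
  \<comment> \<open>Used twice: at 1 / \<epsilon> it turns the logarithm into 1 - \<epsilon> for the
    scalar case, and for arguments of at least 2 it gives the lower bound 1/2.\<close>
  have ln_ge: "1 - 1 / x \<le> ln x" if "0 < x" for x :: real
    using ln_le_minus_one[of "1 / x"] that by (simp add: ln_div)
  show ?thesis
  proof (cases "m = 1 \<and> 1 / 2 \<le> \<epsilon>")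
    case True
    then have "1 - \<epsilon> \<le> ln (m / \<epsilon>)" using ln_ge[of "1 / \<epsilon>"] \<epsilon> by simp
    then have "\<kappa> * (1 - \<epsilon>) \<le> \<kappa> * ln (m / \<epsilon>)" "0 \<le> \<kappa> * (1 - \<epsilon>)"
      using kappa_ge_1 \<epsilon> by (auto intro: mult_left_mono)
    then have "8 * \<kappa> * (1 - \<epsilon>) \<le> \<delta>\<^sup>2 * real n" using n' by linarith
    then show ?thesis using \<delta> \<epsilon> True by (intro lower_tail_scalar) auto
  next
    case False
    have "2 \<le> m / \<epsilon>"
    proof (cases "m = 1")
      case True then show ?thesis using False \<epsilon> by (simp add: field_simps)
    next
      case False
      then have "2 \<le> real m" using m_pos by simp
      then show ?thesis using \<epsilon> by (simp add: field_simps)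
    qed
    then have "1 / (m / \<epsilon>) \<le> 1 / 2" using le_imp_inverse_le[of 2 "m / \<epsilon>"] by (simp add: inverse_eq_divide)
    then have half: "1 / 2 \<le> ln (m / \<epsilon>)" using ln_ge[of "m / \<epsilon>"] \<open>2 \<le> m / \<epsilon>\<close> by linarith
    define p where "p = nat \<lceil>ln (m / \<epsilon>)\<rceil>"
    \<comment> \<open>Rounding up a number that is at least 1/2 at most triples it; hence the
      constant 162 = 3 * 54.\<close>
    have p: "1 \<le> p" "ln (m / \<epsilon>) \<le> real p" "real p \<le> 3 * ln (m / \<epsilon>)"
      using half unfolding p_def by linarith+
    have "54 * real p * \<kappa> \<le> 54 * (3 * ln (m / \<epsilon>)) * \<kappa>"
      using p kappa_ge_1 by (intro mult_right_mono mult_left_mono) auto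
    also have "\<dots> = 162 * \<kappa> * ln (m / \<epsilon>)" by simp
    also note n'
    finally have "54 * real p * \<kappa> \<le> \<delta>\<^sup>2 * real n" .
    then show ?thesis using \<delta> \<epsilon> p by (intro lower_tail_moment)
  qed
qed

end


subsection \<open>Least squares and truncation\<close>

lemma L2_norm_eq_sqrt:
  assumes "(\<integral>\<^sup>+x. ennreal ((norm (f x))\<^sup>2) \<partial>M) = ennreal c" "0 \<le> c"
  shows "L2_norm M f = ennreal (sqrt c)"
  using assms unfolding L2_norm_def Let_def by simp

lemma L2_norm_less_top_iff:
  "L2_norm M f < \<infinity> \<longleftrightarrow> (\<integral>\<^sup>+x. ennreal ((norm (f x))\<^sup>2) \<partial>M) < \<infinity>"
  unfolding L2_norm_def Let_def by (auto simp: less_top)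

lemma in_L2_iff: "in_L2 M f \<longleftrightarrow> f \<in> borel_measurable M \<and> integrable M (\<lambda>x. (norm (f x))\<^sup>2)"
  unfolding in_L2_def L2_norm_less_top_iff integrable_iff_bounded by auto

text \<open>Norms may be infinite, and infinity times 0 is 0 in \<open>ennreal\<close>. So the case
  of a vanishing norm is treated first, where the integrand is zero almost everywhere; with both
  norms nonzero, an infinite one makes the bound trivial.\<close>

lemma nn_integral_mult_le_L2_norm:
  assumes f: "f \<in> borel_measurable M" and g: "g \<in> borel_measurable M"
  shows "(\<integral>\<^sup>+x. ennreal (norm (f x) * norm (g x)) \<partial>M) \<le> L2_norm M f * L2_norm M g"
proof -
  define F where "F = (\<integral>\<^sup>+x. ennreal ((norm (f x))\<^sup>2) \<partial>M)"
  define G where "G = (\<integral>\<^sup>+x. ennreal ((norm (g x))\<^sup>2) \<partial>M)"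
  define I where "I = (\<integral>\<^sup>+x. ennreal (norm (f x)) * ennreal (norm (g x)) \<partial>M)"
  have I: "(\<integral>\<^sup>+x. ennreal (norm (f x) * norm (g x)) \<partial>M) = I"
    unfolding I_def by (simp add: ennreal_mult)
  have CS: "I\<^sup>2 \<le> F * G"
    using Cauchy_Schwarz_nn_integral[of "\<lambda>x. ennreal (norm (f x))" M "\<lambda>x. ennreal (norm (g x))"] f g
    unfolding I_def F_def G_def by (simp add: ennreal_power)
  have zero: "I = 0" if "F = 0 \<or> G = 0"
  proof -
    have "AE x in M. f x = 0 \<or> g x = 0"
      using that
    proof
      assume "F = 0"
      then have "AE x in M. ennreal ((norm (f x))\<^sup>2) = 0"
        unfolding F_def using f by (subst (asm) nn_integral_0_iff_AE) auto
      then show ?thesis by eventually_elim auto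
    next
      assume "G = 0"
      then have "AE x in M. ennreal ((norm (g x))\<^sup>2) = 0"
        unfolding G_def using g by (subst (asm) nn_integral_0_iff_AE) auto
      then show ?thesis by eventually_elim auto
    qed
    then have "AE x in M. ennreal (norm (f x)) * ennreal (norm (g x)) = 0"
      by eventually_elim auto
    then show ?thesis unfolding I_def using f g by (subst nn_integral_0_iff_AE) auto
  qed
  have L: "L2_norm M f = (if F = \<infinity> then \<infinity> else ennreal (sqrt (enn2real F)))"
    "L2_norm M g = (if G = \<infinity> then \<infinity> else ennreal (sqrt (enn2real G)))"
    unfolding L2_norm_def Let_def F_def G_def by auto
  show ?thesis
  proof (cases "F = 0 \<or> G = 0")
    case True then show ?thesis using zero I by simp
  next
    case False
    show ?thesis
    proof (cases "F = \<infinity> \<or> G = \<infinity>")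
      case True
      have "L2_norm M f \<noteq> 0" "L2_norm M g \<noteq> 0"
        unfolding L using False by (auto simp: enn2real_eq_0_iff)
      moreover have "L2_norm M f = \<infinity> \<or> L2_norm M g = \<infinity>" unfolding L using True by auto
      ultimately have "L2_norm M f * L2_norm M g = \<infinity>"
        by (auto simp: ennreal_mult_top ennreal_top_mult)
      then show ?thesis by simp
    next
      case fin: False
      then obtain a b where ab: "F = ennreal a" "0 \<le> a" "G = ennreal b" "0 \<le> b"
        by (metis ennreal_cases infinity_ennreal_def)
      have "I\<^sup>2 \<le> ennreal (a * b)" using CS ab by (simp add: ennreal_mult)
      then have "I \<noteq> \<infinity>" by (auto simp: power2_eq_square top_unique)
      then obtain c where c: "I = ennreal c" "0 \<le> c" by (metis ennreal_cases infinity_ennreal_def)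
      have "c\<^sup>2 \<le> a * b" using \<open>I\<^sup>2 \<le> ennreal (a * b)\<close> c ab by (simp add: ennreal_power)
      then have "c \<le> sqrt a * sqrt b" by (simp add: real_le_rsqrt flip: real_sqrt_mult)
      then show ?thesis unfolding I c L using ab by (simp flip: ennreal_mult)
    qed
  qed
qed

text \<open>Along the complex line spanned by g the squared residual is a quadratic in t. Its
  minimiser \<open>c / G\<close> would lower it by |c|^2 / G, so minimality at 0 forces c = 0; if G
  = 0, all values of g vanish.\<close>

lemma least_squares_orthogonal:
  fixes e g :: "nat \<Rightarrow> complex"
  assumes "\<And>t. (\<Sum>k<n. (cmod (e k))\<^sup>2) \<le> (\<Sum>k<n. (cmod (e k - t * g k))\<^sup>2)"
  shows "(\<Sum>k<n. e k * cnj (g k)) = 0"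
proof -
  define c where "c = (\<Sum>k<n. e k * cnj (g k))"
  define G where "G = (\<Sum>k<n. (cmod (g k))\<^sup>2)"
  have expand: "(\<Sum>k<n. (cmod (e k - t * g k))\<^sup>2)
      = (\<Sum>k<n. (cmod (e k))\<^sup>2) - 2 * Re (cnj t * c) + (cmod t)\<^sup>2 * G" for t
  proof -
    have "(cmod (x - t * y))\<^sup>2 = (cmod x)\<^sup>2 - 2 * Re (cnj t * (x * cnj y)) + (cmod t)\<^sup>2 * (cmod y)\<^sup>2" for x y
      unfolding cmod_power2 by (simp add: power2_eq_square algebra_simps)
    then have "(\<Sum>k<n. (cmod (e k - t * g k))\<^sup>2)
      = (\<Sum>k<n. (cmod (e k))\<^sup>2) - (\<Sum>k<n. 2 * Re (cnj t * (e k * cnj (g k)))) + (\<Sum>k<n. (cmod t)\<^sup>2 * (cmod (g k))\<^sup>2)"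
      by (simp only: sum.distrib sum_subtractf)
    then show ?thesis
      unfolding c_def G_def by (simp only: sum_distrib_left Re_sum)
  qed
  show ?thesis
  proof (cases "G = 0")
    case True
    then have "g k = 0" if "k < n" for k
      using that unfolding G_def by (subst (asm) sum_nonneg_eq_0_iff) auto
    then show ?thesis by simp
  next
    case False
    then have G: "0 < G" unfolding G_def by (simp add: sum_nonneg order_less_le)
    have "Re (cnj (c / G) * c) = (cmod c)\<^sup>2 / G"
      unfolding cmod_power2 by (simp add: power2_eq_square add_divide_distrib)
    moreover have "(cmod (c / G))\<^sup>2 * G = (cmod c)\<^sup>2 / G"
      using G by (simp add: norm_divide power2_eq_square field_simps)
    ultimately have "(cmod c)\<^sup>2 / G \<le> 0"
      using assms[of "c / G"] unfolding expand by linarith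
    then have "(cmod c)\<^sup>2 \<le> 0" using G by (simp add: divide_le_0_iff)
    then have "c = 0" by simp
    then show ?thesis unfolding c_def .
  qed
qed

section \<open>Normal equations and error of the EDMD least-squares problem\<close>

lemma frobenius_norm_sq:
  "(frobenius_norm A)\<^sup>2 = (\<Sum>i<dim_row A. \<Sum>j<dim_col A. (cmod (A $$ (i, j)))\<^sup>2)"
  unfolding frobenius_norm_def by (simp add: sum_nonneg)

lemma edmd_residual_norm_sq:
  assumes "K \<in> carrier_mat l m"
  shows "(frobenius_norm (Phi_mat l \<phi> n \<omega> - K * Psi_mat m \<psi> n \<omega>))\<^sup>2
    = (\<Sum>r<l. \<Sum>k<n. (cmod (\<phi> r (snd (\<omega> k)) - (\<Sum>i<m. K $$ (r, i) * \<psi> i (fst (\<omega> k)))))\<^sup>2)"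
proof -
  have "(Phi_mat l \<phi> n \<omega> - K * Psi_mat m \<psi> n \<omega>) $$ (r, k)
      = \<phi> r (snd (\<omega> k)) - (\<Sum>i<m. K $$ (r, i) * \<psi> i (fst (\<omega> k)))" if "r < l" "k < n" for r k
    using assms that unfolding Phi_mat_def Psi_mat_def
    by (auto simp: scalar_prod_def atLeast0LessThan intro!: sum.cong)
  then show ?thesis
    using assms unfolding frobenius_norm_sq by (simp add: Phi_mat_def Psi_mat_def)
qed

text \<open>Changing only row j by a multiple of h leaves the residuals of all other rows unchanged,
  so minimality of the Frobenius norm gives minimality for row j along h.\<close>

lemma edmd_normal_equation:
  assumes sol: "is_edmd_solution (Phi_mat l \<phi> n \<omega>) (Psi_mat m \<psi> n \<omega>) K" and j: "j < l"
  shows "(\<Sum>k<n. (\<phi> j (snd (\<omega> k)) - (\<Sum>i<m. K $$ (j, i) * \<psi> i (fst (\<omega> k))))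
      * cnj (\<Sum>i<m. h i * \<psi> i (fst (\<omega> k)))) = 0"
proof (rule least_squares_orthogonal)
  fix t
  let ?e = "\<lambda>K r k. \<phi> r (snd (\<omega> k)) - (\<Sum>i<m. K $$ (r, i) * \<psi> i (fst (\<omega> k)))"
  define K' where "K' = Matrix.mat l m (\<lambda>(r, i). K $$ (r, i) + (if r = j then t * h i else 0))"
  have dims: "dim_row (Phi_mat l \<phi> n \<omega>) = l" "dim_row (Psi_mat m \<psi> n \<omega>) = m"
    by (simp_all add: Phi_mat_def Psi_mat_def)
  have K: "K \<in> carrier_mat l m" using sol unfolding is_edmd_solution_def dims by simp
  have K': "K' \<in> carrier_mat l m" unfolding K'_def by simp
  have le: "(\<Sum>r<l. \<Sum>k<n. (cmod (?e K r k))\<^sup>2) \<le> (\<Sum>r<l. \<Sum>k<n. (cmod (?e K' r k))\<^sup>2)"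
  proof -
    have "(frobenius_norm (Phi_mat l \<phi> n \<omega> - K * Psi_mat m \<psi> n \<omega>))\<^sup>2
        \<le> (frobenius_norm (Phi_mat l \<phi> n \<omega> - K' * Psi_mat m \<psi> n \<omega>))\<^sup>2"
      using sol K' unfolding is_edmd_solution_def dims by blast
    then show ?thesis unfolding edmd_residual_norm_sq[OF K] edmd_residual_norm_sq[OF K'] .
  qed
  have other: "?e K' r k = ?e K r k" if "r < l" "r \<noteq> j" for r k
    unfolding K'_def using that by simp
  have row: "?e K' j k = ?e K j k - t * (\<Sum>i<m. h i * \<psi> i (fst (\<omega> k)))" for k
    unfolding K'_def using j by (simp add: ring_distribs sum.distrib sum_distrib_left mult_ac)
  have split: "(\<Sum>r<l. S r) = S j + (\<Sum>r\<in>{..<l} - {j}. S r)" for S :: "nat \<Rightarrow> real"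
    using j by (intro sum.remove) auto
  have "(\<Sum>r\<in>{..<l} - {j}. \<Sum>k<n. (cmod (?e K' r k))\<^sup>2) = (\<Sum>r\<in>{..<l} - {j}. \<Sum>k<n. (cmod (?e K r k))\<^sup>2)"
  proof (intro sum.cong refl)
    fix r k assume "r \<in> {..<l} - {j}"
    then have "r < l" "r \<noteq> j" by auto
    show "(cmod (?e K' r k))\<^sup>2 = (cmod (?e K r k))\<^sup>2" by (simp only: other[OF \<open>r < l\<close> \<open>r \<noteq> j\<close>])
  qed
  then have "(\<Sum>k<n. (cmod (?e K j k))\<^sup>2) \<le> (\<Sum>k<n. (cmod (?e K' j k))\<^sup>2)"
    using le unfolding split by linarith
  then show "(\<Sum>k<n. (cmod (?e K j k))\<^sup>2)
      \<le> (\<Sum>k<n. (cmod (?e K j k - t * (\<Sum>i<m. h i * \<psi> i (fst (\<omega> k)))))\<^sup>2)"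
    unfolding row .
qed

text \<open>Testing the normal equation with the error u = K - M replaces the residual of K by that
  of the arbitrary comparison row M. The empirical energy of u then equals the pairing of u with b,
  and the lower bound c together with Cauchy-Schwarz yields c |u| at most |b|.\<close>

lemma least_squares_error_le:
  fixes a :: "nat \<Rightarrow> nat \<Rightarrow> complex"
  assumes normal: "\<And>h. (\<Sum>k<n. (y k - (\<Sum>i<m. K i * a i k)) * cnj (\<Sum>i<m. h i * a i k)) = 0"
    and lower: "\<And>u. c * (\<Sum>i<m. (cmod (u i))\<^sup>2) \<le> (\<Sum>k<n. (cmod (\<Sum>i<m. u i * a i k))\<^sup>2)"
    and c: "0 < c"
  shows "(\<Sum>i<m. (cmod (K i - M i))\<^sup>2)
    \<le> 1 / c\<^sup>2 * (\<Sum>i<m. (cmod (\<Sum>k<n. (y k - (\<Sum>i<m. M i * a i k)) * cnj (a i k)))\<^sup>2)"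
proof -
  define u where "u i = K i - M i" for i
  define b where "b i = (\<Sum>k<n. (y k - (\<Sum>i<m. M i * a i k)) * cnj (a i k))" for i
  define U where "U = (\<Sum>i<m. (cmod (u i))\<^sup>2)"
  define B where "B = (\<Sum>i<m. (cmod (b i))\<^sup>2)"
  have "(\<Sum>k<n. (\<Sum>i<m. u i * a i k) * cnj (\<Sum>i<m. u i * a i k))
      = (\<Sum>k<n. (y k - (\<Sum>i<m. M i * a i k)) * cnj (\<Sum>i<m. u i * a i k))
      - (\<Sum>k<n. (y k - (\<Sum>i<m. K i * a i k)) * cnj (\<Sum>i<m. u i * a i k))"
    unfolding sum_subtractf[symmetric] left_diff_distrib[symmetric]
    by (intro sum.cong refl) (simp add: u_def left_diff_distrib sum_subtractf)
  also have "\<dots> = (\<Sum>k<n. (y k - (\<Sum>i<m. M i * a i k)) * cnj (\<Sum>i<m. u i * a i k))"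
    unfolding normal by simp
  also have "\<dots> = (\<Sum>i<m. cnj (u i) * b i)"
  proof -
    define r where "r k = y k - (\<Sum>i<m. M i * a i k)" for k
    have "(\<Sum>k<n. r k * cnj (\<Sum>i<m. u i * a i k)) = (\<Sum>k<n. \<Sum>i<m. cnj (u i) * (r k * cnj (a i k)))"
      by (simp add: sum_distrib_left mult_ac)
    also have "\<dots> = (\<Sum>i<m. cnj (u i) * (\<Sum>k<n. r k * cnj (a i k)))"
      unfolding sum_distrib_left by (rule sum.swap)
    finally show ?thesis unfolding r_def b_def .
  qed
  finally have eq: "complex_of_real (\<Sum>k<n. (cmod (\<Sum>i<m. u i * a i k))\<^sup>2) = (\<Sum>i<m. cnj (u i) * b i)"
    by (simp add: complex_norm_square del: of_real_power)
  have "c * U \<le> (\<Sum>k<n. (cmod (\<Sum>i<m. u i * a i k))\<^sup>2)" unfolding U_def by (rule lower)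
  also have "\<dots> = cmod (complex_of_real (\<Sum>k<n. (cmod (\<Sum>i<m. u i * a i k))\<^sup>2))"
    unfolding norm_of_real by (simp add: sum_nonneg)
  also have "\<dots> \<le> (\<Sum>i<m. cmod (u i) * cmod (b i))"
    unfolding eq by (rule order.trans[OF norm_sum]) (simp add: norm_mult)
  finally have "c * U \<le> (\<Sum>i<m. cmod (u i) * cmod (b i))" .
  moreover have U0: "0 \<le> U" unfolding U_def by (intro sum_nonneg) auto
  ultimately have "(c * U)\<^sup>2 \<le> (\<Sum>i<m. cmod (u i) * cmod (b i))\<^sup>2" using c by (intro power_mono) auto
  also have "\<dots> \<le> U * B" unfolding U_def B_def by (rule Cauchy_Schwarz_ineq_sum)
  finally have sq: "U * (c\<^sup>2 * U) \<le> U * B" by (simp add: power2_eq_square mult_ac)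
  have "c\<^sup>2 * U \<le> B"
  proof (cases "U = 0")
    case True then show ?thesis unfolding B_def by (simp add: sum_nonneg)
  next
    case False then show ?thesis using sq U0 by simp
  qed
  then have "U \<le> 1 / c\<^sup>2 * B" using c by (simp add: field_simps)
  then show ?thesis unfolding U_def u_def B_def b_def .
qed

section \<open>Truncation of coefficient rows\<close>

lemma truncation_coeff:
  assumes "0 < L" "0 \<le> s"
  shows "enn2real (min 1 (ennreal L / ennreal s)) = (if s \<le> L then 1 else L / s)"
\<comment> \<open>Division by zero gives infinity in \<open>ennreal\<close>, so the minimum is 1, in
  agreement with the branch for \<open>s \<le> L\<close>.\<close>
proof (cases "s = 0")
  case True
  then show ?thesis using assms by (simp add: ennreal_divide_zero)
next
  case False
  then have "ennreal L / ennreal s = ennreal (L / s)" using assms by (simp add: divide_ennreal)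
  moreover have "1 \<le> ennreal (L / s)" if "s \<le> L"
    unfolding ennreal_1[symmetric] using that assms False by (intro ennreal_leI) (simp add: field_simps)
  moreover have "ennreal (L / s) \<le> 1" if "\<not> s \<le> L"
    unfolding ennreal_1[symmetric] using that assms by (intro ennreal_leI) (simp add: field_simps)
  ultimately show ?thesis using assms by (auto simp: min_absorb1 min_absorb2)
qed

text \<open>Truncation is the projection of the row \<open>K\<close> onto the ball of radius \<open>L\<close>, which contains
  \<open>M\<close>; hence it does not increase the distance to \<open>M\<close>.\<close>

lemma truncated_row_error_le:
  fixes K M :: "nat \<Rightarrow> complex"
  assumes L: "0 < L" and M: "(\<Sum>i<m. (cmod (M i))\<^sup>2) \<le> L\<^sup>2"
    and s: "s = sqrt (\<Sum>i<m. (cmod (K i))\<^sup>2)" and \<alpha>: "\<alpha> = (if s \<le> L then 1 else L / s)"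
  shows "(\<Sum>i<m. (cmod (of_real \<alpha> * K i - M i))\<^sup>2) \<le> (\<Sum>i<m. (cmod (K i - M i))\<^sup>2)"
    and "(\<Sum>i<m. (cmod (of_real \<alpha> * K i - M i))\<^sup>2) \<le> 4 * L\<^sup>2"
proof -
  define MM where "MM = (\<Sum>i<m. (cmod (M i))\<^sup>2)"
  define ip where "ip = (\<Sum>i<m. Re (K i * cnj (M i)))"
  have s2: "(\<Sum>i<m. (cmod (K i))\<^sup>2) = s\<^sup>2" unfolding s by (simp add: sum_nonneg)
  have s0: "0 \<le> s" unfolding s by (simp add: sum_nonneg)
  have expand: "(\<Sum>i<m. (cmod (of_real t * K i - M i))\<^sup>2) = t\<^sup>2 * s\<^sup>2 - 2 * t * ip + MM" for t
  proof -
    have "(cmod (of_real t * x - y))\<^sup>2 = t\<^sup>2 * (cmod x)\<^sup>2 - 2 * t * Re (x * cnj y) + (cmod y)\<^sup>2" for x y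
      unfolding cmod_power2 by (simp add: power2_eq_square algebra_simps)
    then show ?thesis
      unfolding ip_def MM_def s2[symmetric] by (simp only: sum.distrib sum_subtractf sum_distrib_left)
  qed
  have "ip \<le> (\<Sum>i<m. cmod (K i) * cmod (M i))"
    unfolding ip_def by (intro sum_mono order.trans[OF complex_Re_le_cmod]) (simp add: norm_mult)
  also have "\<dots> \<le> s * L"
  proof (rule power2_le_imp_le)
    have "(\<Sum>i<m. cmod (K i) * cmod (M i))\<^sup>2 \<le> s\<^sup>2 * MM"
      unfolding MM_def s2[symmetric] by (rule Cauchy_Schwarz_ineq_sum)
    also have "\<dots> \<le> s\<^sup>2 * L\<^sup>2" using M unfolding MM_def by (intro mult_left_mono) auto
    finally show "(\<Sum>i<m. cmod (K i) * cmod (M i))\<^sup>2 \<le> (s * L)\<^sup>2" by (simp add: power_mult_distrib)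
  qed (use s0 L in auto)
  finally have ip: "ip \<le> s * L" .
  show "(\<Sum>i<m. (cmod (of_real \<alpha> * K i - M i))\<^sup>2) \<le> (\<Sum>i<m. (cmod (K i - M i))\<^sup>2)"
  proof (cases "s \<le> L")
    case True then show ?thesis using \<alpha> by simp
  next
    case False
    then have \<alpha>': "\<alpha> * s = L" "0 < s" using \<alpha> L by auto
    have "\<alpha> \<le> 1" unfolding \<alpha> using False L by simp
    \<comment> \<open>The difference of the squared distances to M before and after scaling has the
      factor 1 - \<alpha>. The other factor is s^2 + L s - 2 ip, nonnegative because L < s and
      \<open>ip \<le> s * L\<close>.\<close>
    have "(1\<^sup>2 * s\<^sup>2 - 2 * 1 * ip + MM) - (\<alpha>\<^sup>2 * s\<^sup>2 - 2 * \<alpha> * ip + MM) = (1 - \<alpha>) * (s\<^sup>2 + (\<alpha> * s) * s - 2 * ip)"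
      by (simp add: power2_eq_square algebra_simps)
    also have "\<dots> \<ge> 0"
    proof (rule mult_nonneg_nonneg)
      have "L * s \<le> s\<^sup>2" using False \<alpha>' by (simp add: power2_eq_square)
      then show "0 \<le> s\<^sup>2 + (\<alpha> * s) * s - 2 * ip" unfolding \<alpha>' using ip by (simp add: mult.commute)
    qed (use \<open>\<alpha> \<le> 1\<close> in simp)
    finally have "\<alpha>\<^sup>2 * s\<^sup>2 - 2 * \<alpha> * ip + MM \<le> 1\<^sup>2 * s\<^sup>2 - 2 * 1 * ip + MM" by simp
    then show ?thesis using expand[of \<alpha>] expand[of 1] by simp
  qed
  have "(\<alpha> * s)\<^sup>2 \<le> L\<^sup>2" using \<alpha> L s0 by (intro power_mono) (auto split: if_splits)
  \<comment> \<open>Nonnegativity of the squared distance for the reflected scalar - \<alpha> bounds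
    the cross term, so the squared error is at most twice the sum of two squared norms, each at most
    L^2.\<close>
  moreover have "- (2 * \<alpha> * ip) \<le> \<alpha>\<^sup>2 * s\<^sup>2 + MM"
    using expand[of "- \<alpha>"] sum_nonneg[of "{..<m}" "\<lambda>i. (cmod (of_real (- \<alpha>) * K i - M i))\<^sup>2"] by simp
  ultimately show "(\<Sum>i<m. (cmod (of_real \<alpha> * K i - M i))\<^sup>2) \<le> 4 * L\<^sup>2"
    using M unfolding expand MM_def[symmetric] by (simp add: power_mult_distrib)
qed

section \<open>The law of a snapshot pair\<close>

lemma pair_law_kernel_measurable:
  assumes \<rho>: "\<rho> \<in> space (prob_algebra S)" and P: "P \<tau> \<in> S \<rightarrow>\<^sub>M prob_algebra S"
  shows "P \<tau> \<in> \<rho> \<rightarrow>\<^sub>M prob_algebra \<rho>"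
    and "(\<lambda>x. P \<tau> x \<bind> (\<lambda>y. return (\<rho> \<Otimes>\<^sub>M \<rho>) (x, y))) \<in> \<rho> \<rightarrow>\<^sub>M prob_algebra (\<rho> \<Otimes>\<^sub>M \<rho>)"
proof -
  have sets: "sets \<rho> = sets S" using \<rho> by (simp add: space_prob_algebra)
  \<comment> \<open>\<open>pair_law\<close> uses \<rho> itself as the base space of its product, and
    only the sigma-algebra of that base matters here.\<close>
  then have "prob_algebra \<rho> = prob_algebra S"
    unfolding prob_algebra_def by (simp add: subprob_algebra_cong[OF sets])
  then show K: "P \<tau> \<in> \<rho> \<rightarrow>\<^sub>M prob_algebra \<rho>"
    using P by (simp add: measurable_cong_sets[OF sets refl])
  show "(\<lambda>x. P \<tau> x \<bind> (\<lambda>y. return (\<rho> \<Otimes>\<^sub>M \<rho>) (x, y))) \<in> \<rho> \<rightarrow>\<^sub>M prob_algebra (\<rho> \<Otimes>\<^sub>M \<rho>)"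
    by (rule measurable_bind_prob_space2[OF K]) simp
qed

text \<open>Both facts come from unfolding the two nested binds. The marginal transfers integrals of
  functions of the initial point to \<rho>, and the almost-everywhere rule carries
  \<open>noise_free\<close> over to the data.\<close>

lemma
  assumes \<rho>: "\<rho> \<in> space (prob_algebra S)" and P: "P \<tau> \<in> S \<rightarrow>\<^sub>M prob_algebra S"
  shows prob_space_pair_law: "prob_space (pair_law \<rho> P \<tau>)"
    and sets_pair_law: "sets (pair_law \<rho> P \<tau>) = sets (\<rho> \<Otimes>\<^sub>M \<rho>)"
    and distr_pair_law_fst: "distr (pair_law \<rho> P \<tau>) \<rho> fst = \<rho>"
    and AE_pair_law: "Measurable.pred (\<rho> \<Otimes>\<^sub>M \<rho>) Q \<Longrightarrow>
      (AE z in pair_law \<rho> P \<tau>. Q z) \<longleftrightarrow> (AE x in \<rho>. AE y in P \<tau> x. Q (x, y))"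
proof -
  note K = pair_law_kernel_measurable[of \<rho> S P \<tau>, OF \<rho> P]
  let ?G = "\<lambda>x. P \<tau> x \<bind> (\<lambda>y. return (\<rho> \<Otimes>\<^sub>M \<rho>) (x, y))"
  have prob: "prob_space \<rho>" using \<rho> by (simp add: space_prob_algebra)
  then have \<rho>': "\<rho> \<in> space (prob_algebra \<rho>)" by (simp add: space_prob_algebra)
  show "prob_space (pair_law \<rho> P \<tau>)" unfolding pair_law_def by (rule prob_space_bind'[OF \<rho>' K(2)])
  show "sets (pair_law \<rho> P \<tau>) = sets (\<rho> \<Otimes>\<^sub>M \<rho>)" unfolding pair_law_def by (rule sets_bind'[OF \<rho>' K(2)])
  have ne: "space \<rho> \<noteq> {}" by (rule prob_space.not_empty[OF prob])
  have Px: "prob_space (P \<tau> x)" "sets (P \<tau> x) = sets \<rho>" if "x \<in> space \<rho>" for x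
    using measurable_space[OF K(1) that] by (auto simp: space_prob_algebra)
  have inner: "(\<lambda>y. return (\<rho> \<Otimes>\<^sub>M \<rho>) (x, y)) \<in> P \<tau> x \<rightarrow>\<^sub>M subprob_algebra (\<rho> \<Otimes>\<^sub>M \<rho>)" if "x \<in> space \<rho>" for x
    using that measurable_cong_sets[OF Px(2)[OF that] refl]
    by (auto intro!: measurable_compose[OF measurable_Pair1' return_measurable])
  \<comment> \<open>Given the initial point, the first coordinate of the pair is deterministic, so
    the inner kernel projects to a point mass.\<close>
  have point: "distr (?G x) \<rho> fst = return \<rho> x" if x: "x \<in> space \<rho>" for x
  proof -
    have "distr (?G x) \<rho> fst = P \<tau> x \<bind> (\<lambda>y. distr (return (\<rho> \<Otimes>\<^sub>M \<rho>) (x, y)) \<rho> fst)"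
      by (rule distr_bind[OF inner[OF x]]) (use prob_space.not_empty[OF Px(1)[OF x]] in auto)
    also have "\<dots> = P \<tau> x \<bind> (\<lambda>y. return \<rho> x)"
      using x sets_eq_imp_space_eq[OF Px(2)[OF x]]
      by (intro bind_cong_All ballI) (auto simp: distr_return space_pair_measure)
    also have "\<dots> = return \<rho> x"
      using x by (intro bind_const' Px prob_space_imp_subprob_space prob_space_return)
    finally show ?thesis .
  qed
  have "distr (\<rho> \<bind> ?G) \<rho> fst = \<rho> \<bind> (\<lambda>x. distr (?G x) \<rho> fst)"
    by (rule distr_bind[OF measurable_prob_algebraD[OF K(2)] ne measurable_fst])
  also have "\<dots> = \<rho> \<bind> return \<rho>" using point by (intro bind_cong_All ballI)
  also have "\<dots> = \<rho>" by (rule bind_return')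
  finally show "distr (pair_law \<rho> P \<tau>) \<rho> fst = \<rho>" unfolding pair_law_def .
  show "(AE z in pair_law \<rho> P \<tau>. Q z) \<longleftrightarrow> (AE x in \<rho>. AE y in P \<tau> x. Q (x, y))"
    if Q: "Measurable.pred (\<rho> \<Otimes>\<^sub>M \<rho>) Q"
  proof -
    have "(AE z in pair_law \<rho> P \<tau>. Q z) \<longleftrightarrow> (AE x in \<rho>. AE z in ?G x. Q z)"
      unfolding pair_law_def by (rule AE_bind[OF measurable_prob_algebraD[OF K(2)] Q])
    also have "\<dots> \<longleftrightarrow> (AE x in \<rho>. AE y in P \<tau> x. Q (x, y))"
    proof (intro AE_cong)
      fix x assume x: "x \<in> space \<rho>"
      have "(AE z in ?G x. Q z) \<longleftrightarrow> (AE y in P \<tau> x. AE z in return (\<rho> \<Otimes>\<^sub>M \<rho>) (x, y). Q z)"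
        by (rule AE_bind[OF inner[OF x] Q])
      also have "\<dots> \<longleftrightarrow> (AE y in P \<tau> x. Q (x, y))"
        using x sets_eq_imp_space_eq[OF Px(2)[OF x]] Q
        by (intro AE_cong AE_return) (auto simp: space_pair_measure)
      finally show "(AE z in ?G x. Q z) \<longleftrightarrow> (AE y in P \<tau> x. Q (x, y))" .
    qed
    finally show ?thesis .
  qed
qed


subsection \<open>The error bound\<close>

lemma L2_norm_cong_AE:
  assumes "AE x in M. f x = g x"
  shows "L2_norm M f = L2_norm M g"
proof -
  have "(\<integral>\<^sup>+x. ennreal ((norm (f x))\<^sup>2) \<partial>M) = (\<integral>\<^sup>+x. ennreal ((norm (g x))\<^sup>2) \<partial>M)"
    by (rule nn_integral_cong_AE) (use assms in eventually_elim, simp)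
  then show ?thesis unfolding L2_norm_def by simp
qed

lemma sum_sq_nonneg: "0 \<le> sum_sq m \<psi> x"
  unfolding sum_sq_def by (intro sum_nonneg) auto

lemma edmd_error_bound:
  fixes \<rho> :: "'a measure" and Kmn :: "(nat \<Rightarrow> 'a \<times> 'a) \<Rightarrow> complex mat"
  assumes \<delta>: "0 < \<delta>" "\<delta> < 1"
    and \<rho>: "\<rho> \<in> space (prob_algebra S)" and \<epsilon>: "0 < \<epsilon>" "\<epsilon> < 1" and m: "1 \<le> m"
    and P: "P \<tau> \<in> S \<rightarrow>\<^sub>M prob_algebra S"
    and \<phi>: "\<And>j. j < l \<Longrightarrow> in_L2 \<rho> (\<phi> j)"
    and koopman: "\<And>j. j < l \<Longrightarrow> in_L2 \<rho> (koopman P \<tau> (\<phi> j))"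
    and nf: "\<And>j. j < l \<Longrightarrow> noise_free \<rho> P \<tau> (\<phi> j)"
    and ortho: "L2_orthonormal \<rho> m \<psi>"
    and Km: "is_projected_koopman_mat \<rho> P \<tau> m \<psi> l \<phi> Km"
    and L: "\<And>j. j < l \<Longrightarrow> 0 < L j" "\<And>j. j < l \<Longrightarrow> L2_norm \<rho> (mat_koopman m \<psi> Km j) \<le> ennreal (L j)"
    and n: "ennreal (162 / \<delta>\<^sup>2) * Linf_norm \<rho> (sum_sq m \<psi>) * ennreal (ln (real m / \<epsilon>)) \<le> of_nat n"
    and sol: "\<And>\<omega>. \<omega> \<in> space (data_law \<rho> P \<tau> n) \<Longrightarrow>
       is_edmd_solution (Phi_mat l \<phi> n \<omega>) (Psi_mat m \<psi> n \<omega>) (Kmn \<omega>)"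
  shows "(\<integral>\<^sup>+\<omega>. ennreal ((frobenius_norm
             (truncation_mat \<rho> m \<psi> l L (Kmn \<omega>) * Kmn \<omega> - Km))\<^sup>2) \<partial>(data_law \<rho> P \<tau> n))
        \<le> ennreal (1 / real n) * (L2_norm \<rho> (sum_sq m \<psi>) / ennreal ((1 - \<delta>)\<^sup>2)) *
             (\<Sum>j<l. L2_norm \<rho> (\<lambda>x. (koopman P \<tau> (\<phi> j) x - mat_koopman m \<psi> Km j x)\<^sup>2))
           + ennreal (4 * (\<Sum>j<l. (L j)\<^sup>2) * \<epsilon>)"
proof -
  define N where "N = pair_law \<rho> P \<tau>"
  interpret \<rho>: prob_space \<rho> using \<rho> by (simp add: space_prob_algebra)
  interpret N: prob_space N unfolding N_def by (rule prob_space_pair_law[of \<rho> S P \<tau>, OF \<rho> P])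
  have sets_N: "sets N = sets (\<rho> \<Otimes>\<^sub>M \<rho>)" unfolding N_def by (rule sets_pair_law[of \<rho> S P \<tau>, OF \<rho> P])
  have fst_N: "fst \<in> measurable N \<rho>" by (simp add: measurable_cong_sets[OF sets_N refl])
  have distr_N: "distr N \<rho> fst = \<rho>" unfolding N_def by (rule distr_pair_law_fst[of \<rho> S P \<tau>, OF \<rho> P])
  have int_fst: "(\<integral>z. f (fst z) \<partial>N) = (\<integral>x. f x \<partial>\<rho>)" if "f \<in> borel_measurable \<rho>"
    for f :: "'a \<Rightarrow> 'b::{banach, second_countable_topology}"
    using integral_distr[OF fst_N that] unfolding distr_N by simp
  have integrable_fst: "integrable N (\<lambda>z. f (fst z))" if "integrable \<rho> f"
    for f :: "'a \<Rightarrow> 'b::{banach, second_countable_topology}"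
    using integrable_distr[OF fst_N, of f] that unfolding distr_N by simp
  have data: "data_law \<rho> P \<tau> n = PiM {..<n} (\<lambda>_. N)" unfolding data_law_def N_def ..

  have \<psi>_meas: "\<psi> i \<in> borel_measurable \<rho>" if "i < m" for i
    using ortho that unfolding L2_orthonormal_def in_L2_def by blast
  have sum_sq_meas: "sum_sq m \<psi> \<in> borel_measurable \<rho>"
    unfolding sum_sq_def using \<psi>_meas by (intro borel_measurable_sum) auto

  have ln_pos: "0 < ln (real m / \<epsilon>)"
    using m \<epsilon> by (intro ln_gt_zero) (simp add: field_simps)
  \<comment> \<open>The logarithm is positive, so an infinite essential supremum would require
    infinitely many samples.\<close>
  have "Linf_norm \<rho> (sum_sq m \<psi>) \<noteq> \<infinity>"
  proof
    assume "Linf_norm \<rho> (sum_sq m \<psi>) = \<infinity>"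
    then have "ennreal (162 / \<delta>\<^sup>2) * Linf_norm \<rho> (sum_sq m \<psi>) * ennreal (ln (real m / \<epsilon>)) = \<infinity>"
      using \<delta> ln_pos by (simp add: ennreal_mult_top ennreal_top_mult)
    then show False using n by (simp add: top_unique)
  qed
  then obtain \<kappa> where \<kappa>: "Linf_norm \<rho> (sum_sq m \<psi>) = ennreal \<kappa>" "0 \<le> \<kappa>"
    by (metis ennreal_cases infinity_ennreal_def)
  have AE_\<kappa>: "AE x in \<rho>. sum_sq m \<psi> x \<le> \<kappa>"
    using esssup_AE[of "\<lambda>x. ennreal (norm (sum_sq m \<psi> x))" \<rho>]
    unfolding \<kappa>(1)[unfolded Linf_norm_def]
    by eventually_elim (use \<kappa>(2) sum_sq_nonneg in auto)
  have n_real: "162 / \<delta>\<^sup>2 * \<kappa> * ln (real m / \<epsilon>) \<le> real n"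
  proof -
    have split: "ennreal (a * \<kappa> * b) = ennreal a * ennreal \<kappa> * ennreal b" if "0 \<le> a" "0 \<le> b" for a b
      using that \<kappa>(2) by (simp add: ennreal_mult)
    have "ennreal (162 / \<delta>\<^sup>2 * \<kappa> * ln (real m / \<epsilon>)) \<le> ennreal (real n)"
    proof (subst split)
      show "ennreal (162 / \<delta>\<^sup>2) * ennreal \<kappa> * ennreal (ln (real m / \<epsilon>)) \<le> ennreal (real n)"
        using n unfolding ennreal_of_nat_eq_real_of_nat \<kappa>(1) .
    qed (use ln_pos in simp_all)
    then show ?thesis by simp
  qed

  \<comment> \<open>The dictionary is set to zero on the null set where the essential bound fails.
    The bound then holds at every point, and all integrals and norms stay the same.\<close>
  define v where "v i x = (if sum_sq m \<psi> x \<le> \<kappa> then \<psi> i x else 0)" for i x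
  have v_meas: "v i \<in> borel_measurable \<rho>" if "i < m" for i
    unfolding v_def using \<psi>_meas[OF that] sum_sq_meas by measurable
  have v_AE: "AE x in \<rho>. \<forall>i. v i x = \<psi> i x"
    using AE_\<kappa> by eventually_elim (simp add: v_def)
  have v_bound: "(\<Sum>i<m. (cmod (v i x))\<^sup>2) \<le> \<kappa>" for x
    using \<kappa>(2) by (cases "sum_sq m \<psi> x \<le> \<kappa>") (simp_all add: v_def sum_sq_def)
  have iso: "(\<integral>x. v i x * cnj (v j x) \<partial>\<rho>) = (if i = j then 1 else 0)" if ij: "i < m" "j < m" for i j
  proof -
    note [measurable] = v_meas[OF ij(1)] v_meas[OF ij(2)] \<psi>_meas[OF ij(1)] \<psi>_meas[OF ij(2)]
    have "(\<integral>x. v i x * cnj (v j x) \<partial>\<rho>) = (\<integral>x. \<psi> i x * cnj (\<psi> j x) \<partial>\<rho>)"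
    proof (rule integral_cong_AE)
      show "AE x in \<rho>. v i x * cnj (v j x) = \<psi> i x * cnj (\<psi> j x)"
        using v_AE by eventually_elim simp
    qed measurable
    then show ?thesis using ortho ij unfolding L2_orthonormal_def L2_inner_def by simp
  qed
  interpret iso: bounded_isotropic \<rho> m v \<kappa>
    by unfold_locales (use v_meas v_bound iso m in auto)
  \<comment> \<open>The same functions read on pairs through the first coordinate; isotropy
    transfers because that marginal is \<rho>.\<close>
  interpret data: bounded_isotropic N m "\<lambda>i z. v i (fst z)" \<kappa>
  proof unfold_locales
    fix i j assume ij: "i < m" "j < m"
    note [measurable] = v_meas[OF ij(1)] v_meas[OF ij(2)]
    show "(\<integral>z. v i (fst z) * cnj (v j (fst z)) \<partial>N) = (if i = j then 1 else 0)"
      using int_fst[of "\<lambda>x. v i x * cnj (v j x)"] iso[OF ij] by simp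
  qed (use v_bound m measurable_compose[OF fst_N v_meas] in auto)

  have n0: "0 < n"
  proof -
    have "0 < 162 / \<delta>\<^sup>2 * \<kappa> * ln (real m / \<epsilon>)"
      using \<delta> ln_pos iso.kappa_ge_1 by simp
    then show ?thesis using n_real by (cases n) auto
  qed
  \<comment> \<open>B is the exceptional event on which the Gram form may be too small.\<close>
  obtain B where B: "B \<in> sets (data_law \<rho> P \<tau> n)" "measure (data_law \<rho> P \<tau> n) B \<le> \<epsilon>"
    and lower: "\<And>\<omega> u. \<omega> \<in> space (data_law \<rho> P \<tau> n) \<Longrightarrow> \<omega> \<notin> B \<Longrightarrow>
      (1 - \<delta>) * n * (\<Sum>i<m. (cmod (u i))\<^sup>2) \<le> (\<Sum>k<n. (cmod (\<Sum>i<m. u i * v i (fst (\<omega> k))))\<^sup>2)"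
    using data.lower_tail[OF \<delta> \<epsilon> n_real] unfolding data by blast

  \<comment> \<open>Parseval turns the norms in the hypothesis on \<open>L\<close> and in
    \<open>truncation_mat\<close> into Euclidean norms of matrix rows, which makes truncation a
    statement about vectors.\<close>
  have L2_mat: "L2_norm \<rho> (mat_koopman m \<psi> K j) = ennreal (sqrt (\<Sum>i<m. (cmod (K $$ (j, i)))\<^sup>2))" for K j
  proof -
    have "(\<integral>\<^sup>+x. ennreal ((cmod (\<Sum>i<m. K $$ (j, i) * v i x))\<^sup>2) \<partial>\<rho>)
        = ennreal (\<integral>x. (cmod (\<Sum>i<m. K $$ (j, i) * v i x))\<^sup>2 \<partial>\<rho>)"
      by (intro nn_integral_eq_integral iso.integrableI bdd_measurable_intros iso.v_bdd) auto
    then have "L2_norm \<rho> (\<lambda>x. \<Sum>i<m. K $$ (j, i) * v i x) = ennreal (sqrt (\<Sum>i<m. (cmod (K $$ (j, i)))\<^sup>2))"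
      unfolding iso.integral_linear_form_sq by (intro L2_norm_eq_sqrt sum_nonneg) auto
    moreover have "L2_norm \<rho> (mat_koopman m \<psi> K j) = L2_norm \<rho> (\<lambda>x. \<Sum>i<m. K $$ (j, i) * v i x)"
      by (rule L2_norm_cong_AE) (use v_AE in eventually_elim, simp add: mat_koopman_def)
    ultimately show ?thesis by simp
  qed
  have Km_row: "(\<Sum>i<m. (cmod (Km $$ (j, i)))\<^sup>2) \<le> (L j)\<^sup>2" if "j < l" for j
  proof -
    have "sqrt (\<Sum>i<m. (cmod (Km $$ (j, i)))\<^sup>2) \<le> L j"
      using L(2)[OF that] L(1)[OF that] unfolding L2_mat by simp
    then show ?thesis by (simp add: real_le_lsqrt sqrt_le_D)
  qed
  have Km_carrier: "Km \<in> carrier_mat l m" using Km unfolding is_projected_koopman_mat_def by blast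

  \<comment> \<open>The projection residual, written with the bounded dictionary.\<close>
  define r where "r j x = koopman P \<tau> (\<phi> j) x - (\<Sum>i<m. Km $$ (j, i) * v i x)" for j x
  have r_AE: "AE x in \<rho>. r j x = koopman P \<tau> (\<phi> j) x - mat_koopman m \<psi> Km j x" for j
    using v_AE by eventually_elim (simp add: r_def mat_koopman_def)
  have koopman_meas: "koopman P \<tau> (\<phi> j) \<in> borel_measurable \<rho>" if "j < l" for j
    using koopman[OF that] unfolding in_L2_def by simp
  have r_meas: "r j \<in> borel_measurable \<rho>" if "j < l" for j
    unfolding r_def using koopman_meas[OF that] v_meas
    by (intro borel_measurable_diff borel_measurable_sum borel_measurable_times) auto
  have r_L2: "integrable \<rho> (\<lambda>x. (cmod (r j x))\<^sup>2)" if "j < l" for j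
  proof (rule Bochner_Integration.integrable_bound)
    let ?b = "\<lambda>x. \<Sum>i<m. Km $$ (j, i) * v i x"
    show "integrable \<rho> (\<lambda>x. 2 * (cmod (koopman P \<tau> (\<phi> j) x))\<^sup>2 + 2 * (cmod (?b x))\<^sup>2)"
    proof (intro Bochner_Integration.integrable_add integrable_mult_right)
      show "integrable \<rho> (\<lambda>x. (cmod (koopman P \<tau> (\<phi> j) x))\<^sup>2)"
        using koopman[OF that] unfolding in_L2_iff by simp
      show "integrable \<rho> (\<lambda>x. (cmod (?b x))\<^sup>2)"
        by (intro iso.integrableI bdd_measurable_intros iso.v_bdd) auto
    qed
    show "(\<lambda>x. (cmod (r j x))\<^sup>2) \<in> borel_measurable \<rho>" using r_meas[OF that] by measurable
    have "(cmod (a - b))\<^sup>2 \<le> 2 * (cmod a)\<^sup>2 + 2 * (cmod b)\<^sup>2" for a b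
    proof -
      have "(cmod (a - b))\<^sup>2 + (cmod (a + b))\<^sup>2 = 2 * (cmod a)\<^sup>2 + 2 * (cmod b)\<^sup>2"
        unfolding cmod_power2 by (simp add: power2_eq_square algebra_simps)
      then show ?thesis by (smt (verit) zero_le_power2)
    qed
    then show "AE x in \<rho>. norm ((cmod (r j x))\<^sup>2)
        \<le> norm (2 * (cmod (koopman P \<tau> (\<phi> j) x))\<^sup>2 + 2 * (cmod (?b x))\<^sup>2)"
      unfolding r_def by (intro AE_I2) simp
  qed

  \<comment> \<open>The coordinates of the vector that each sample contributes to the error of row
    j. They are square integrable because v is bounded.\<close>
  define f where "f j i x = r j x * cnj (v i x)" for j i x
  have f_meas: "f j i \<in> borel_measurable \<rho>" if "j < l" "i < m" for j i
    unfolding f_def using r_meas[OF that(1)] v_meas[OF that(2)] by measurable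
  have f_L2: "integrable \<rho> (\<lambda>x. (cmod (f j i x))\<^sup>2)" if "j < l" "i < m" for j i
  proof (rule Bochner_Integration.integrable_bound)
    show "integrable \<rho> (\<lambda>x. \<kappa> * (cmod (r j x))\<^sup>2)" using r_L2[OF that(1)] by simp
    show "(\<lambda>x. (cmod (f j i x))\<^sup>2) \<in> borel_measurable \<rho>" using f_meas[OF that] by measurable
    have "(cmod (f j i x))\<^sup>2 \<le> \<kappa> * (cmod (r j x))\<^sup>2" for x
    proof -
      have "(cmod (v i x))\<^sup>2 \<le> (\<Sum>i<m. (cmod (v i x))\<^sup>2)" using that by (intro member_le_sum) auto
      then have "(cmod (v i x))\<^sup>2 * (cmod (r j x))\<^sup>2 \<le> \<kappa> * (cmod (r j x))\<^sup>2"
        using v_bound[of x] by (intro mult_right_mono) auto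
      then show ?thesis unfolding f_def by (simp add: norm_mult power_mult_distrib mult.commute)
    qed
    then show "AE x in \<rho>. norm ((cmod (f j i x))\<^sup>2) \<le> norm (\<kappa> * (cmod (r j x))\<^sup>2)"
      using \<kappa>(2) by (intro AE_I2) simp
  qed
  have f_int: "integrable \<rho> (f j i)" if "j < l" "i < m" for j i
  proof (rule Bochner_Integration.integrable_bound)
    show "integrable \<rho> (\<lambda>x. 1 + (cmod (f j i x))\<^sup>2)" using f_L2[OF that] by simp
    show "f j i \<in> borel_measurable \<rho>" by (rule f_meas[OF that])
    have "t \<le> 1 + t\<^sup>2" for t :: real using zero_le_power2[of "t - 1"] by (simp add: power2_diff) (smt (verit) zero_le_power2)
    then show "AE x in \<rho>. norm (f j i x) \<le> norm (1 + (cmod (f j i x))\<^sup>2)"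
      by (intro AE_I2) (simp add: abs_of_nonneg)
  qed
  \<comment> \<open>The summands are centred because the projection residual is orthogonal to every
    dictionary function.\<close>
  have f_mean: "(\<integral>x. f j i x \<partial>\<rho>) = 0" if ji: "j < l" "i < m" for j i
  proof -
    have "\<psi> i \<in> function_span m \<psi>"
      unfolding function_span_def
      using ji by (auto intro!: exI[of _ "\<lambda>k. if k = i then 1 else 0"] simp: if_distrib[of "\<lambda>x. x * _"] cong: if_cong)
    then have "L2_inner \<rho> (\<lambda>x. koopman P \<tau> (\<phi> j) x - mat_koopman m \<psi> Km j x) (\<psi> i) = 0"
      using Km ji unfolding is_projected_koopman_mat_def is_L2_projection_def by blast
    moreover have "(\<integral>x. f j i x \<partial>\<rho>) = (\<integral>x. (koopman P \<tau> (\<phi> j) x - mat_koopman m \<psi> Km j x) * cnj (\<psi> i x) \<partial>\<rho>)"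
    proof (rule integral_cong_AE)
      show "f j i \<in> borel_measurable \<rho>" by (rule f_meas[OF ji])
      have "mat_koopman m \<psi> Km j \<in> borel_measurable \<rho>"
        unfolding mat_koopman_def using \<psi>_meas by (intro borel_measurable_sum borel_measurable_times) auto
      then show "(\<lambda>x. (koopman P \<tau> (\<phi> j) x - mat_koopman m \<psi> Km j x) * cnj (\<psi> i x)) \<in> borel_measurable \<rho>"
        using koopman_meas[OF ji(1)] \<psi>_meas[OF ji(2)] by measurable
      show "AE x in \<rho>. f j i x = (koopman P \<tau> (\<phi> j) x - mat_koopman m \<psi> Km j x) * cnj (\<psi> i x)"
        using r_AE[of j] v_AE by eventually_elim (simp add: f_def)
    qed
    ultimately show ?thesis unfolding L2_inner_def by simp
  qed

  define Q where "Q j = (\<Sum>i<m. \<integral>x. (cmod (f j i x))\<^sup>2 \<partial>\<rho>)" for j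
  have Q0: "0 \<le> Q j" for j unfolding Q_def by (intro sum_nonneg Bochner_Integration.integral_nonneg) auto
  \<comment> \<open>\<open>Q j\<close> is the integral of |r|^2 times the sum of |v|^2.
    Cauchy-Schwarz splits it into the two norms of the claim, in extended form because the square of
    the residual may have infinite norm.\<close>
  have Q_le: "ennreal (Q j) \<le> L2_norm \<rho> (\<lambda>x. (koopman P \<tau> (\<phi> j) x - mat_koopman m \<psi> Km j x)\<^sup>2)
      * L2_norm \<rho> (sum_sq m \<psi>)" if j: "j < l" for j
  proof -
    have "Q j = (\<integral>x. (\<Sum>i<m. (cmod (f j i x))\<^sup>2) \<partial>\<rho>)"
      unfolding Q_def using f_L2[OF j] by (intro Bochner_Integration.integral_sum[symmetric]) auto
    moreover have "(\<integral>\<^sup>+x. ennreal (\<Sum>i<m. (cmod (f j i x))\<^sup>2) \<partial>\<rho>)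
        = ennreal (\<integral>x. (\<Sum>i<m. (cmod (f j i x))\<^sup>2) \<partial>\<rho>)"
      by (intro nn_integral_eq_integral Bochner_Integration.integrable_sum AE_I2 sum_nonneg)
        (use f_L2[OF j] in auto)
    ultimately have "ennreal (Q j) = (\<integral>\<^sup>+x. ennreal (\<Sum>i<m. (cmod (f j i x))\<^sup>2) \<partial>\<rho>)" by simp
    also have "\<dots> \<le> (\<integral>\<^sup>+x. ennreal (norm ((r j x)\<^sup>2) * norm (sum_sq m \<psi> x)) \<partial>\<rho>)"
    proof (intro nn_integral_mono ennreal_leI)
      fix x
      have "(\<Sum>i<m. (cmod (f j i x))\<^sup>2) = (cmod (r j x))\<^sup>2 * (\<Sum>i<m. (cmod (v i x))\<^sup>2)"
        unfolding f_def by (simp add: norm_mult power_mult_distrib sum_distrib_left)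
      also have "\<dots> \<le> (cmod (r j x))\<^sup>2 * sum_sq m \<psi> x"
        unfolding sum_sq_def v_def by (intro mult_left_mono sum_mono) auto
      finally show "(\<Sum>i<m. (cmod (f j i x))\<^sup>2) \<le> norm ((r j x)\<^sup>2) * norm (sum_sq m \<psi> x)"
        using sum_sq_nonneg[of m \<psi> x] by (simp add: norm_power)
    qed
    also have "\<dots> \<le> L2_norm \<rho> (\<lambda>x. (r j x)\<^sup>2) * L2_norm \<rho> (sum_sq m \<psi>)"
      using r_meas[OF j] sum_sq_meas by (intro nn_integral_mult_le_L2_norm) auto
    also have "L2_norm \<rho> (\<lambda>x. (r j x)\<^sup>2) = L2_norm \<rho> (\<lambda>x. (koopman P \<tau> (\<phi> j) x - mat_koopman m \<psi> Km j x)\<^sup>2)"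
      by (rule L2_norm_cong_AE) (use r_AE[of j] in eventually_elim, simp)
    finally show ?thesis .
  qed

  \<comment> \<open>Almost every pair satisfies two identities: the bounded dictionary agrees with
    \<psi> at the initial point, and the recorded value equals its conditional mean. The residual of
    the projected row then depends on the initial point only.\<close>
  define good where "good z \<longleftrightarrow> sum_sq m \<psi> (fst z) \<le> \<kappa> \<and> (\<forall>j<l. \<phi> j (snd z) = koopman P \<tau> (\<phi> j) (fst z))" for z
  have "AE z in N. good z"
  proof -
    have "AE z in N. sum_sq m \<psi> (fst z) \<le> \<kappa>"
      by (rule AE_distrD[OF fst_N]) (unfold distr_N, rule AE_\<kappa>)
    moreover have "AE z in N. \<forall>j\<in>{..<l}. \<phi> j (snd z) = koopman P \<tau> (\<phi> j) (fst z)"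
    proof (intro AE_finite_allI)
      fix j assume "j \<in> {..<l}"
      then have j: "j < l" by simp
      have [measurable]: "\<phi> j \<in> borel_measurable \<rho>" using \<phi>[OF j] unfolding in_L2_def by simp
      note [measurable] = koopman_meas[OF j]
      have "Measurable.pred (\<rho> \<Otimes>\<^sub>M \<rho>) (\<lambda>z. \<phi> j (snd z) = koopman P \<tau> (\<phi> j) (fst z))"
        by measurable
      from AE_pair_law[of \<rho> S P \<tau>, OF \<rho> P this]
      show "AE z in N. \<phi> j (snd z) = koopman P \<tau> (\<phi> j) (fst z)"
        using nf[OF j] unfolding noise_free_def N_def by simp
    qed simp
    ultimately show ?thesis by eventually_elim (simp add: good_def)
  qed
  then have AE_good: "AE \<omega> in data_law \<rho> P \<tau> n. \<forall>k\<in>{..<n}. good (\<omega> k)"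
    unfolding data by (intro AE_finite_allI AE_PiM_component N.prob_space_axioms) auto

  define c where "c = (1 - \<delta>) * real n"
  have c: "0 < c" unfolding c_def using \<delta> n0 by simp
  \<comment> \<open>A measurable dominating function: the least-squares error for samples outside B,
    plus the worst case after truncation on B.\<close>
  define G where "G j \<omega> = 1 / c\<^sup>2 * (\<Sum>i<m. (cmod (\<Sum>k<n. f j i (fst (\<omega> k))))\<^sup>2)
      + 4 * (L j)\<^sup>2 * indicat_real B \<omega>" for j \<omega>
  have G0: "0 \<le> G j \<omega>" for j \<omega> unfolding G_def by (intro add_nonneg_nonneg mult_nonneg_nonneg sum_nonneg) auto
  have pointwise: "(frobenius_norm (truncation_mat \<rho> m \<psi> l L (Kmn \<omega>) * Kmn \<omega> - Km))\<^sup>2 \<le> (\<Sum>j<l. G j \<omega>)"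
    if w: "\<omega> \<in> space (data_law \<rho> P \<tau> n)" and gd: "\<forall>k\<in>{..<n}. good (\<omega> k)" for \<omega>
  proof -
    define K where "K = Kmn \<omega>"
    note sol' = sol[OF w, folded K_def]
    have K: "K \<in> carrier_mat l m"
      using sol' unfolding is_edmd_solution_def by (simp add: Phi_mat_def Psi_mat_def)
    define s where "s j = sqrt (\<Sum>i<m. (cmod (K $$ (j, i)))\<^sup>2)" for j
    define \<alpha> where "\<alpha> j = (if s j \<le> L j then 1 else L j / s j)" for j
    have s0: "0 \<le> s j" for j unfolding s_def by (simp add: sum_nonneg)
    have entry: "(truncation_mat \<rho> m \<psi> l L K * K - Km) $$ (j, i) = of_real (\<alpha> j) * K $$ (j, i) - Km $$ (j, i)"
      if "j < l" "i < m" for j i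
    proof -
      have coeff: "enn2real (min 1 (ennreal (L j) / ennreal (s j))) = \<alpha> j"
        unfolding \<alpha>_def by (rule truncation_coeff[OF L(1)[OF that(1)] s0])
      have "(truncation_mat \<rho> m \<psi> l L K * K) $$ (j, i)
          = (\<Sum>k<l. (if j = k then of_real (\<alpha> j) else 0) * K $$ (k, i))"
        using that K coeff
        by (auto simp: truncation_mat_def L2_mat s_def[symmetric] scalar_prod_def atLeast0LessThan intro!: sum.cong)
      also have "\<dots> = of_real (\<alpha> j) * K $$ (j, i)"
        using that by (simp add: if_distrib[of "\<lambda>x. x * _"] cong: if_cong)
      finally show ?thesis using that Km_carrier by simp
    qed
    have "(frobenius_norm (truncation_mat \<rho> m \<psi> l L K * K - Km))\<^sup>2
        = (\<Sum>j<l. \<Sum>i<m. (cmod (of_real (\<alpha> j) * K $$ (j, i) - Km $$ (j, i)))\<^sup>2)"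
    proof -
      have "dim_row (truncation_mat \<rho> m \<psi> l L K * K - Km) = l"
        "dim_col (truncation_mat \<rho> m \<psi> l L K * K - Km) = m"
        using Km_carrier by auto
      then show ?thesis
        unfolding frobenius_norm_sq by (simp only:) (intro sum.cong refl, simp only: lessThan_iff entry)
    qed
    also have "\<dots> \<le> (\<Sum>j<l. G j \<omega>)"
    proof (rule sum_mono)
      fix j assume "j \<in> {..<l}"
      then have j: "j < l" by simp
      note trunc = truncated_row_error_le[where M = "\<lambda>i. Km $$ (j, i)" and K = "\<lambda>i. K $$ (j, i)",
          OF L(1)[OF j] Km_row[OF j] s_def \<alpha>_def]
      show "(\<Sum>i<m. (cmod (of_real (\<alpha> j) * K $$ (j, i) - Km $$ (j, i)))\<^sup>2) \<le> G j \<omega>"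
      \<comment> \<open>On B only the crude truncation bound is available. Off B the least-squares
        estimate applies to the raw row, and truncation does not increase the error.\<close>
      proof (cases "\<omega> \<in> B")
        case True
        have "0 \<le> 1 / c\<^sup>2 * (\<Sum>i<m. (cmod (\<Sum>k<n. f j i (fst (\<omega> k))))\<^sup>2)"
          by (intro mult_nonneg_nonneg sum_nonneg) auto
        then show ?thesis using trunc(2) True unfolding G_def by simp
      next
        case False
        have v\<psi>: "v i (fst (\<omega> k)) = \<psi> i (fst (\<omega> k))" if "k < n" for i k
          using gd that unfolding good_def v_def by auto
        have resid: "\<phi> j (snd (\<omega> k)) - (\<Sum>i<m. Km $$ (j, i) * v i (fst (\<omega> k))) = r j (fst (\<omega> k))" if "k < n" for k
          using gd that j unfolding good_def r_def by auto
        have "(\<Sum>i<m. (cmod (K $$ (j, i) - Km $$ (j, i)))\<^sup>2)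
            \<le> 1 / c\<^sup>2 * (\<Sum>i<m. (cmod (\<Sum>k<n. (\<phi> j (snd (\<omega> k)) - (\<Sum>i<m. Km $$ (j, i) * v i (fst (\<omega> k))))
              * cnj (v i (fst (\<omega> k)))))\<^sup>2)"
        proof (rule least_squares_error_le[OF _ _ c])
          fix h
          show "(\<Sum>k<n. (\<phi> j (snd (\<omega> k)) - (\<Sum>i<m. K $$ (j, i) * v i (fst (\<omega> k))))
              * cnj (\<Sum>i<m. h i * v i (fst (\<omega> k)))) = 0"
            \<comment> \<open>The solution is computed from \<psi>, but at the sampled points \<psi>
              and v coincide.\<close>
            using edmd_normal_equation[OF sol' j, of h] v\<psi> by simp
        next
          fix u show "c * (\<Sum>i<m. (cmod (u i))\<^sup>2) \<le> (\<Sum>k<n. (cmod (\<Sum>i<m. u i * v i (fst (\<omega> k))))\<^sup>2)"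
            unfolding c_def by (rule lower[OF w False])
        qed
        also have "\<dots> = G j \<omega>"
          unfolding G_def f_def using False resid by simp
        finally show ?thesis using trunc(1) by simp
      qed
    qed
    finally show ?thesis unfolding K_def .
  qed

  have int_f: "integrable (data_law \<rho> P \<tau> n) (\<lambda>\<omega>. (cmod (\<Sum>k<n. f j i (fst (\<omega> k))))\<^sup>2)"
      "(\<integral>\<omega>. (cmod (\<Sum>k<n. f j i (fst (\<omega> k))))\<^sup>2 \<partial>data_law \<rho> P \<tau> n) = n * (\<integral>x. (cmod (f j i x))\<^sup>2 \<partial>\<rho>)"
    if ji: "j < l" "i < m" for j i
  proof -
    have "integrable N (\<lambda>z. f j i (fst z))" "integrable N (\<lambda>z. (cmod (f j i (fst z)))\<^sup>2)"
      "(\<integral>z. f j i (fst z) \<partial>N) = 0"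
      using integrable_fst[OF f_int[OF ji]] integrable_fst[OF f_L2[OF ji]]
        int_fst[OF f_meas[OF ji]] f_mean[OF ji] by simp_all
    note iid = integral_norm_sum_iid_sq[OF N.prob_space_axioms this, of n]
    have "(\<integral>z. (cmod (f j i (fst z)))\<^sup>2 \<partial>N) = (\<integral>x. (cmod (f j i x))\<^sup>2 \<partial>\<rho>)"
      using int_fst[of "\<lambda>x. (cmod (f j i x))\<^sup>2"] f_meas[OF ji] by simp
    then show "integrable (data_law \<rho> P \<tau> n) (\<lambda>\<omega>. (cmod (\<Sum>k<n. f j i (fst (\<omega> k))))\<^sup>2)"
      "(\<integral>\<omega>. (cmod (\<Sum>k<n. f j i (fst (\<omega> k))))\<^sup>2 \<partial>data_law \<rho> P \<tau> n) = n * (\<integral>x. (cmod (f j i x))\<^sup>2 \<partial>\<rho>)"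
      using iid unfolding data by simp_all
  qed
  interpret D: prob_space "data_law \<rho> P \<tau> n" unfolding data by (rule data.prob_space_sample)
  have int_B: "integrable (data_law \<rho> P \<tau> n) (indicat_real B)"
    using B(1) by (intro integrable_real_indicator) (auto simp: D.emeasure_eq_measure)
  have G_le: "(\<integral>\<^sup>+\<omega>. ennreal (G j \<omega>) \<partial>data_law \<rho> P \<tau> n)
      \<le> ennreal (1 / real n) * (L2_norm \<rho> (sum_sq m \<psi>) / ennreal ((1 - \<delta>)\<^sup>2)) *
          L2_norm \<rho> (\<lambda>x. (koopman P \<tau> (\<phi> j) x - mat_koopman m \<psi> Km j x)\<^sup>2)
        + ennreal (4 * (L j)\<^sup>2 * \<epsilon>)" if j: "j < l" for j
  proof -
    have int_G: "integrable (data_law \<rho> P \<tau> n) (G j)"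
      unfolding G_def using int_f(1)[OF j] int_B
      by (intro Bochner_Integration.integrable_add integrable_mult_right Bochner_Integration.integrable_sum) auto
    have "(\<integral>\<omega>. G j \<omega> \<partial>data_law \<rho> P \<tau> n) = 1 / c\<^sup>2 * (n * Q j) + 4 * (L j)\<^sup>2 * measure (data_law \<rho> P \<tau> n) B"
    proof -
      have "(\<integral>\<omega>. (\<Sum>i<m. (cmod (\<Sum>k<n. f j i (fst (\<omega> k))))\<^sup>2) \<partial>data_law \<rho> P \<tau> n) = n * Q j"
        using int_f[OF j] unfolding Q_def sum_distrib_left by (subst Bochner_Integration.integral_sum) auto
      moreover have "integrable (data_law \<rho> P \<tau> n) (\<lambda>\<omega>. \<Sum>i<m. (cmod (\<Sum>k<n. f j i (fst (\<omega> k))))\<^sup>2)"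
        using int_f(1)[OF j] by (intro Bochner_Integration.integrable_sum) auto
      moreover have "(\<integral>\<omega>. indicat_real B \<omega> \<partial>data_law \<rho> P \<tau> n) = measure (data_law \<rho> P \<tau> n) B"
        using B(1) by (simp add: Int_absorb2 sets.sets_into_space)
      ultimately show ?thesis unfolding G_def using int_B by simp
    qed
    also have "\<dots> \<le> 1 / c\<^sup>2 * (n * Q j) + 4 * (L j)\<^sup>2 * \<epsilon>"
      using B(2) by (intro add_left_mono mult_left_mono) auto
    \<comment> \<open>The second moment of the sum grows like n while the lower Gram bound enters
      squared; this leaves the rate 1/n.\<close>
    also have "1 / c\<^sup>2 * (n * Q j) = 1 / real n * (1 / (1 - \<delta>)\<^sup>2) * Q j"
    proof -
      have "1 / (d * (k * k)) * (k * q) = 1 / k * (1 / d) * q" if "0 < d" "0 < k" for d k q :: real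
        using that by (simp add: field_simps)
      moreover have "c\<^sup>2 = (1 - \<delta>)\<^sup>2 * (real n * real n)"
        unfolding c_def by (simp add: power2_eq_square mult_ac)
      ultimately show ?thesis using n0 \<delta> by simp
    qed
    finally have "(\<integral>\<omega>. G j \<omega> \<partial>data_law \<rho> P \<tau> n)
        \<le> 1 / real n * (1 / (1 - \<delta>)\<^sup>2) * Q j + 4 * (L j)\<^sup>2 * \<epsilon>" .
    then have "(\<integral>\<^sup>+\<omega>. ennreal (G j \<omega>) \<partial>data_law \<rho> P \<tau> n)
        \<le> ennreal (1 / real n * (1 / (1 - \<delta>)\<^sup>2) * Q j + 4 * (L j)\<^sup>2 * \<epsilon>)"
      using int_G G0 by (subst nn_integral_eq_integral) (auto intro: ennreal_leI)
    also have "\<dots> = ennreal (1 / real n) * ennreal (1 / (1 - \<delta>)\<^sup>2) * ennreal (Q j) + ennreal (4 * (L j)\<^sup>2 * \<epsilon>)"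
    proof -
      have "ennreal (a * b * q + d) = ennreal a * ennreal b * ennreal q + ennreal d"
        if "0 \<le> a" "0 \<le> b" "0 \<le> q" "0 \<le> d" for a b q d
        using that by (simp add: ennreal_mult)
      from this[of "1 / real n" "1 / (1 - \<delta>)\<^sup>2" "Q j" "4 * (L j)\<^sup>2 * \<epsilon>"]
      show ?thesis using Q0[of j] \<epsilon> by auto
    qed
    also have "\<dots> \<le> ennreal (1 / real n) * ennreal (1 / (1 - \<delta>)\<^sup>2) *
        (L2_norm \<rho> (\<lambda>x. (koopman P \<tau> (\<phi> j) x - mat_koopman m \<psi> Km j x)\<^sup>2) * L2_norm \<rho> (sum_sq m \<psi>))
        + ennreal (4 * (L j)\<^sup>2 * \<epsilon>)"
      by (intro add_right_mono mult_left_mono Q_le j) auto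
    also have "ennreal (1 / real n) * ennreal (1 / (1 - \<delta>)\<^sup>2) *
        (L2_norm \<rho> (\<lambda>x. (koopman P \<tau> (\<phi> j) x - mat_koopman m \<psi> Km j x)\<^sup>2) * L2_norm \<rho> (sum_sq m \<psi>))
      = ennreal (1 / real n) * (L2_norm \<rho> (sum_sq m \<psi>) / ennreal ((1 - \<delta>)\<^sup>2)) *
          L2_norm \<rho> (\<lambda>x. (koopman P \<tau> (\<phi> j) x - mat_koopman m \<psi> Km j x)\<^sup>2)"
    proof -
      have "ennreal (1 / (1 - \<delta>)\<^sup>2) = inverse (ennreal ((1 - \<delta>)\<^sup>2))"
        using \<delta> by (subst inverse_ennreal) (auto simp: inverse_eq_divide)
      then show ?thesis unfolding divide_ennreal_def by (simp add: mult_ac)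
    qed
    finally show ?thesis .
  qed

  have "(\<integral>\<^sup>+\<omega>. ennreal ((frobenius_norm
      (truncation_mat \<rho> m \<psi> l L (Kmn \<omega>) * Kmn \<omega> - Km))\<^sup>2) \<partial>(data_law \<rho> P \<tau> n))
      \<le> (\<integral>\<^sup>+\<omega>. (\<Sum>j<l. ennreal (G j \<omega>)) \<partial>(data_law \<rho> P \<tau> n))"
  \<comment> \<open>Domination is needed only for samples all of whose pairs are good, which is
    almost every sample.\<close>
  proof (rule nn_integral_mono_AE)
    show "AE \<omega> in data_law \<rho> P \<tau> n. ennreal ((frobenius_norm
      (truncation_mat \<rho> m \<psi> l L (Kmn \<omega>) * Kmn \<omega> - Km))\<^sup>2) \<le> (\<Sum>j<l. ennreal (G j \<omega>))"
      using AE_good AE_space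
      by eventually_elim (auto simp: sum_ennreal G0 intro!: ennreal_leI pointwise)
  qed
  also have "\<dots> = (\<Sum>j<l. \<integral>\<^sup>+\<omega>. ennreal (G j \<omega>) \<partial>(data_law \<rho> P \<tau> n))"
  proof (rule nn_integral_sum)
    fix j assume "j \<in> {..<l}"
    then have "integrable (data_law \<rho> P \<tau> n) (G j)"
      unfolding G_def using int_f(1) int_B
      by (intro Bochner_Integration.integrable_add integrable_mult_right Bochner_Integration.integrable_sum) auto
    then show "(\<lambda>\<omega>. ennreal (G j \<omega>)) \<in> borel_measurable (data_law \<rho> P \<tau> n)" by simp
  qed
  also have "\<dots> \<le> (\<Sum>j<l. ennreal (1 / real n) * (L2_norm \<rho> (sum_sq m \<psi>) / ennreal ((1 - \<delta>)\<^sup>2)) *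
          L2_norm \<rho> (\<lambda>x. (koopman P \<tau> (\<phi> j) x - mat_koopman m \<psi> Km j x)\<^sup>2)
        + ennreal (4 * (L j)\<^sup>2 * \<epsilon>))"
    by (intro sum_mono G_le) auto
  also have "\<dots> = ennreal (1 / real n) * (L2_norm \<rho> (sum_sq m \<psi>) / ennreal ((1 - \<delta>)\<^sup>2)) *
             (\<Sum>j<l. L2_norm \<rho> (\<lambda>x. (koopman P \<tau> (\<phi> j) x - mat_koopman m \<psi> Km j x)\<^sup>2))
           + ennreal (4 * (\<Sum>j<l. (L j)\<^sup>2) * \<epsilon>)"
  proof -
    have "(\<Sum>j<l. ennreal (4 * (L j)\<^sup>2 * \<epsilon>)) = ennreal (\<Sum>j<l. 4 * (L j)\<^sup>2 * \<epsilon>)"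
      using \<epsilon> by (intro sum_ennreal) auto
    also have "(\<Sum>j<l. 4 * (L j)\<^sup>2 * \<epsilon>) = 4 * (\<Sum>j<l. (L j)\<^sup>2) * \<epsilon>"
      by (simp add: sum_distrib_left sum_distrib_right)
    finally show ?thesis by (simp add: sum.distrib sum_distrib_left)
  qed
  finally show ?thesis .
qed

theorem theorem1:
  fixes \<delta> :: real
  assumes "0 < \<delta>" and "\<delta> < 1"
  shows "\<exists>c::real. 0 < c \<and> (\<forall>(d::nat) (X :: state set) (\<rho> :: state measure)
      (P :: real \<Rightarrow> state \<Rightarrow> state measure) (\<tau>::real) (\<epsilon>::real) (m::nat) (l::nat)
      (\<psi> :: nat \<Rightarrow> state \<Rightarrow> complex) (\<phi> :: nat \<Rightarrow> state \<Rightarrow> complex) (L :: nat \<Rightarrow> real)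
      (Km :: complex mat) (n::nat) (Kmn :: (nat \<Rightarrow> state \<times> state) \<Rightarrow> complex mat).
    X \<subseteq> space (\<Pi>\<^sub>M i\<in>{..<d}. (borel :: real measure)) \<longrightarrow>
    \<rho> \<in> space (prob_algebra (state_space d X)) \<longrightarrow>
    0 < \<tau> \<longrightarrow> 0 < \<epsilon> \<longrightarrow> \<epsilon> < 1 \<longrightarrow> 1 \<le> m \<longrightarrow> 1 \<le> l \<longrightarrow>
    P \<tau> \<in> state_space d X \<rightarrow>\<^sub>M prob_algebra (state_space d X) \<longrightarrow>
    (\<forall>j<l. in_L2 \<rho> (\<phi> j)) \<longrightarrow>
    (\<forall>j<l. AE x in \<rho>. integrable (P \<tau> x) (\<phi> j)) \<longrightarrow>
    (\<forall>j<l. in_L2 \<rho> (koopman P \<tau> (\<phi> j))) \<longrightarrow>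
    (\<forall>j<l. noise_free \<rho> P \<tau> (\<phi> j)) \<longrightarrow>
    L2_orthonormal \<rho> m \<psi> \<longrightarrow>
    in_L2 \<rho> (sum_sq m \<psi>) \<longrightarrow>
    is_projected_koopman_mat \<rho> P \<tau> m \<psi> l \<phi> Km \<longrightarrow>
    (\<forall>j<l. 0 < L j \<and> L2_norm \<rho> (mat_koopman m \<psi> Km j) \<le> ennreal (L j)) \<longrightarrow>
    of_nat n \<ge> ennreal c * Linf_norm \<rho> (sum_sq m \<psi>) * ennreal (ln (real m / \<epsilon>)) \<longrightarrow>
    (\<forall>\<omega>\<in>space (data_law \<rho> P \<tau> n).
       is_edmd_solution (Phi_mat l \<phi> n \<omega>) (Psi_mat m \<psi> n \<omega>) (Kmn \<omega>)) \<longrightarrow>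
    (\<forall>j<l. \<forall>i<m. (\<lambda>\<omega>. Kmn \<omega> $$ (j, i)) \<in> borel_measurable (data_law \<rho> P \<tau> n)) \<longrightarrow>
    \<P>(\<omega> in data_law \<rho> P \<tau> n.
        (\<integral>\<^sup>+\<omega>'. ennreal ((frobenius_norm
             (truncation_mat \<rho> m \<psi> l L (Kmn \<omega>') * Kmn \<omega>' - Km))\<^sup>2) \<partial>(data_law \<rho> P \<tau> n))
        \<le> ennreal (1 / real n) * (L2_norm \<rho> (sum_sq m \<psi>) / ennreal ((1 - \<delta>)\<^sup>2)) *
             (\<Sum>j<l. L2_norm \<rho> (\<lambda>x. (koopman P \<tau> (\<phi> j) x - mat_koopman m \<psi> Km j x)\<^sup>2))
           + ennreal (4 * (\<Sum>j<l. (L j)\<^sup>2) * \<epsilon>))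
      \<ge> 1 - real l * \<epsilon>)"
proof (intro exI[of _ "162 / \<delta>\<^sup>2"] conjI allI impI)
  \<comment> \<open>The witness is the constant of \<open>lower_tail\<close>; it involves \<delta>
    alone.\<close>
  show "0 < 162 / \<delta>\<^sup>2" using assms by simp
next
  fix d X and \<rho> :: "state measure" and P \<tau> \<epsilon> m l and \<psi> \<phi> :: "nat \<Rightarrow> state \<Rightarrow> complex"
    and L Km n and Kmn :: "(nat \<Rightarrow> state \<times> state) \<Rightarrow> complex mat"
  assume \<rho>: "\<rho> \<in> space (prob_algebra (state_space d X))"
    and \<epsilon>: "0 < (\<epsilon>::real)" "\<epsilon> < 1" and m: "1 \<le> m"
    and P: "P \<tau> \<in> state_space d X \<rightarrow>\<^sub>M prob_algebra (state_space d X)"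
    and \<phi>: "\<forall>j<l. in_L2 \<rho> (\<phi> j)" "\<forall>j<l. in_L2 \<rho> (koopman P \<tau> (\<phi> j))" "\<forall>j<l. noise_free \<rho> P \<tau> (\<phi> j)"
    and \<psi>: "L2_orthonormal \<rho> m \<psi>" and Km: "is_projected_koopman_mat \<rho> P \<tau> m \<psi> l \<phi> Km"
    and L: "\<forall>j<l. 0 < L j \<and> L2_norm \<rho> (mat_koopman m \<psi> Km j) \<le> ennreal (L j)"
    and n: "of_nat n \<ge> ennreal (162 / \<delta>\<^sup>2) * Linf_norm \<rho> (sum_sq m \<psi>) * ennreal (ln (real m / \<epsilon>))"
    and sol: "\<forall>\<omega>\<in>space (data_law \<rho> P \<tau> n).
       is_edmd_solution (Phi_mat l \<phi> n \<omega>) (Psi_mat m \<psi> n \<omega>) (Kmn \<omega>)"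
  have prob: "prob_space (data_law \<rho> P \<tau> n)"
    unfolding data_law_def by (intro prob_space_PiM prob_space_pair_law[of \<rho> "state_space d X" P \<tau>, OF \<rho> P])
  have bound: "(\<integral>\<^sup>+\<omega>'. ennreal ((frobenius_norm
             (truncation_mat \<rho> m \<psi> l L (Kmn \<omega>') * Kmn \<omega>' - Km))\<^sup>2) \<partial>(data_law \<rho> P \<tau> n))
        \<le> ennreal (1 / real n) * (L2_norm \<rho> (sum_sq m \<psi>) / ennreal ((1 - \<delta>)\<^sup>2)) *
             (\<Sum>j<l. L2_norm \<rho> (\<lambda>x. (koopman P \<tau> (\<phi> j) x - mat_koopman m \<psi> Km j x)\<^sup>2))
           + ennreal (4 * (\<Sum>j<l. (L j)\<^sup>2) * \<epsilon>)"
    by (rule edmd_error_bound[where S = "state_space d X"])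
      (use assms \<rho> \<epsilon> m P \<phi> \<psi> Km L n sol in auto)
  \<comment> \<open>The integral inequality \<open>bound\<close> does not involve the outer sample,
    so the event is the whole space and has probability 1.\<close>
  have "1 - real l * \<epsilon> \<le> 1" using \<epsilon> by simp
  also have "1 = measure (data_law \<rho> P \<tau> n) (space (data_law \<rho> P \<tau> n))"
    using prob_space.prob_space[OF prob] by simp
  finally show "\<P>(\<omega> in data_law \<rho> P \<tau> n.
        (\<integral>\<^sup>+\<omega>'. ennreal ((frobenius_norm
             (truncation_mat \<rho> m \<psi> l L (Kmn \<omega>') * Kmn \<omega>' - Km))\<^sup>2) \<partial>(data_law \<rho> P \<tau> n))
        \<le> ennreal (1 / real n) * (L2_norm \<rho> (sum_sq m \<psi>) / ennreal ((1 - \<delta>)\<^sup>2)) *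
             (\<Sum>j<l. L2_norm \<rho> (\<lambda>x. (koopman P \<tau> (\<phi> j) x - mat_koopman m \<psi> Km j x)\<^sup>2))
           + ennreal (4 * (\<Sum>j<l. (L j)\<^sup>2) * \<epsilon>))
      \<ge> 1 - real l * \<epsilon>"
    using bound by simp
qed

end
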